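(* Let $P$ be a polynomial of degree $n$ with leading coefficient $p_n$ such that $E=P^{-1}([-1,1])=E_1\cup E_2\cup E_3$ has exactly three connected components, labeled from left to right, with $E=-E$ and $E_j^*=E_j$ for $j=1,2,3$. Let $n_j$ be the number of zeros of $P$ in $E_j$, let $z_1<z_2$ be the critical points of $P$ in $\mathbb{R}\setminus E$, and let $a_1,a_2,a_3$ be the centers of the lemniscatic domain corresponding to $E$. Then $z_2=-z_1$, $n_1=n_3$, $a_1<a_2=0<a_3$ with $a_1=-a_3$ and $$a_3=\sqrt{n}\,\sqrt[n]{\frac{\big|P(z_2)+\sqrt{P(z_2)^2-1}\big|}{2|p_n|\,n_2^{n_2/2}(2n_3)^{n_3}}}$$ with the positive real $n$-th root. In this formula, $z_2$ can also be replaced by $z_1$.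
   Context: Notation: $\widehat{\mathbb{C}}=\mathbb{C}\cup\{\infty\}$; $K^{c}=\widehat{\mathbb{C}}\setminus K$; $K^*=\{\overline z: z\in K\}$; $-K=\{-z:z\in K\}$; $\operatorname{cap}$ is logarithmic capacity. Walsh's theorem (known; defines the centers): Let $E_1,\dots,E_\ell\subseteq\mathbb{C}$ be disjoint, simply connected (i.e. connected with connected complement in $\widehat{\mathbb C}$), infinite compact sets and $E=\bigcup_{j=1}^\ell E_j$, so that $E^c$ is an $\ell$-connected domain. Then there exist a unique compact set of the form $L=\{w\in\mathbb{C}: |U(w)|\le \operatorname{cap}(E)\}$, $U(w)=\prod_{j=1}^\ell (w-a_j)^{m_j}$, with distinct $a_1,\dots,a_\ell\in\mathbb{C}$ (the centers) and real $m_1,\dots,m_\ell>0$ (the exponents), $\sum_j m_j=1$, and a unique conformal map $\Phi:E^c\to L^c$ with $\Phi(z)=z+O(1/z)$ at $\infty$. The set $L$ has $\ell$ disjoint compact components $L_1,\dots,L_\ell$ with $a_j\in L_j$, labeled such that $\Phi$ maps a Jordan curve surrounding $E_j$ onto a Jordan curve surrounding $L_j$. For a polynomial $P$ of degree $n\ge1$, the set $E=P^{-1}([-1,1])$ has finitely many components, each an infinite compact set, and $E^c$ is connected, so Walsh's theorem applies. Conventions: Zeros are counted with multiplicity. When all components satisfy $E_j^*=E_j$, each $E_j\cap\mathbb{R}$ is a point or an interval, and labeling from left to right means that $x\in E_j\cap\mathbb{R}$, $y\in E_{j+1}\cap\mathbb{R}$ implies $x<y$. The function $\sqrt{P(z)^2-1}$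 on $\mathbb{C}\setminus E$ denotes the analytic branch (with branch cut along $E$) which behaves as $P(z)$ at $\infty$; equivalently, the square root for which $|P(z)+\sqrt{P(z)^2-1}|>1$ on $\mathbb{C}\setminus E$. In the setting of the claim, $P$ has exactly two critical points in $\mathbb{C}\setminus E$, and they are real and simple. *)

theory Defs
  imports
    "HOL-Complex_Analysis.Complex_Analysis"
    "HOL-Probability.Probability_Measure"
    "HOL-Library.Landau_Symbols"
begin

text \<open>
  The logarithmic energy of \<open>\<mu>\<close> is the double integral of \<open>log (1 / |z - w|)\<close>, with value
  \<open>\<infinity>\<close> on the diagonal. It is written as positive part minus negative part, because the Bochner
  integral would silently be \<open>0\<close> for measures of infinite energy, and \<open>ln 0 = 0\<close> would assign
  finite energy to point masses. For measures with bounded support the negative part is finite.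
\<close>

definition log_energy :: "complex measure \<Rightarrow> ereal" where
  "log_energy \<mu> =
     enn2ereal (\<integral>\<^sup>+ z. \<integral>\<^sup>+ w. (if z = w then \<infinity> else ennreal (- ln (dist z w))) \<partial>\<mu> \<partial>\<mu>)
     - enn2ereal (\<integral>\<^sup>+ z. \<integral>\<^sup>+ w. ennreal (ln (dist z w)) \<partial>\<mu> \<partial>\<mu>)"

definition robin_constant :: "complex set \<Rightarrow> ereal" where
  "robin_constant K =
     (INF \<mu> \<in> {\<mu>. prob_space \<mu> \<and> sets \<mu> = sets borel \<and> emeasure \<mu> K = 1}. log_energy \<mu>)"

definition log_capacity :: "complex set \<Rightarrow> real" where
  "log_capacity K =
     (if robin_constant K = \<infinity> then 0 else exp (- real_of_ereal (robin_constant K)))"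

text \<open>
  \<open>U(w) = \<Prod>j. (w - a\<^sub>j) ^ m\<^sub>j\<close> is multivalued for real exponents, but its modulus is not.
\<close>

definition lemniscate :: "nat \<Rightarrow> (nat \<Rightarrow> complex) \<Rightarrow> (nat \<Rightarrow> real) \<Rightarrow> real \<Rightarrow> complex set" where
  "lemniscate l a m c = {w. (\<Prod>j=1..l. norm (w - a j) powr m j) \<le> c}"

definition jordan_surrounds ::
  "(real \<Rightarrow> complex) \<Rightarrow> complex set \<Rightarrow> complex set \<Rightarrow> bool" where
  "jordan_surrounds \<gamma> A B \<longleftrightarrow>
     simple_path \<gamma> \<and> pathfinish \<gamma> = pathstart \<gamma> \<and>
     A \<subseteq> inside (path_image \<gamma>) \<and> B - A \<subseteq> outside (path_image \<gamma>)"

text \<open>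
  Walsh's conformal map onto a lemniscatic domain, for \<open>E = E\<^sub>1 \<union> \<dots> \<union> E\<^sub>l\<close>. The map between
  the complements in the Riemann sphere sends \<open>\<infinity>\<close> to \<open>\<infinity>\<close>, so it is given by its restriction
  to the finite points, which is a biholomorphic map of \<open>- E\<close> onto \<open>- L\<close> with the stated
  expansion at infinity. The last conjunct fixes the labelling of the centers.
\<close>

definition walsh_map ::
  "nat \<Rightarrow> (nat \<Rightarrow> complex set) \<Rightarrow> (nat \<Rightarrow> complex) \<Rightarrow> (nat \<Rightarrow> real) \<Rightarrow> (complex \<Rightarrow> complex) \<Rightarrow> bool" where
  "walsh_map l Ej a m \<Phi> \<longleftrightarrow>
     (let E = (\<Union>j\<in>{1..l}. Ej j); L = lemniscate l a m (log_capacity E) in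
        inj_on a {1..l} \<and> (\<forall>j\<in>{1..l}. m j > 0) \<and> (\<Sum>j=1..l. m j) = 1 \<and>
        \<Phi> holomorphic_on (- E) \<and> bij_betw \<Phi> (- E) (- L) \<and>
        (\<lambda>z. \<Phi> z - z) \<in> O[at_infinity](\<lambda>z. 1 / z) \<and>
        (\<exists>Lj. bij_betw Lj {1..l} (components L) \<and>
           (\<forall>j\<in>{1..l}. a j \<in> Lj j \<and>
              (\<exists>\<gamma>. path_image \<gamma> \<subseteq> - E \<and> jordan_surrounds \<gamma> (Ej j) E \<and>
                   jordan_surrounds (\<Phi> \<circ> \<gamma>) (Lj j) L))))"

definition walsh_centers :: "nat \<Rightarrow> (nat \<Rightarrow> complex set) \<Rightarrow> (nat \<Rightarrow> complex) \<Rightarrow> bool" where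
  "walsh_centers l Ej a \<longleftrightarrow> (\<exists>m \<Phi>. walsh_map l Ej a m \<Phi>)"

definition preimage_interval :: "complex poly \<Rightarrow> complex set" where
  "preimage_interval P = {z. poly P z \<in> complex_of_real ` {-1..1}}"

definition zero_count :: "complex poly \<Rightarrow> complex set \<Rightarrow> nat" where
  "zero_count P A = (\<Sum>z | poly P z = 0 \<and> z \<in> A. order z P)"

text \<open>
  \<open>S\<close> is the analytic branch of \<open>\<surd>(P\<^sup>2 - 1)\<close> off \<open>E\<close> that behaves as \<open>P\<close> at infinity.
\<close>

definition sqrt_branch :: "complex poly \<Rightarrow> (complex \<Rightarrow> complex) \<Rightarrow> bool" where
  "sqrt_branch P S \<longleftrightarrow>
     S holomorphic_on (- preimage_interval P) \<and>
     (\<forall>z. z \<notin> preimage_interval P \<longrightarrow> (S z)\<^sup>2 = (poly P z)\<^sup>2 - 1) \<and>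
     ((\<lambda>z. S z / poly P z) \<longlongrightarrow> 1) at_infinity"

end

theory Submission
  imports Defs "HOL-Computational_Algebra.Fundamental_Theorem_Algebra"
begin

text \<open>
  With \<open>J = P + \<surd>(P\<^sup>2 - 1)\<close>, the function \<open>ln |J| / n\<close> is the Green function of the complement of
  \<open>E\<close>, and \<open>ln |U \<circ> \<Phi>| - ln c\<close> is another one, so the maximum principle gives
  \<open>|J| = 2 |p\<^sub>n| |U \<circ> \<Phi>|\<^sup>n\<close>. Of the capacity \<open>c\<close> only \<open>c \<ge> 0\<close> is needed for this. Winding numbers along the curves that fix the labelling then give \<open>m\<^sub>j = n\<^sub>j / n\<close>,
  so \<open>U\<^sup>n\<close> is the modulus of a polynomial \<open>A\<close>.

  Walsh's map is unique: a conformal map \<open>f\<close> between two lemniscatic domains with \<open>|B \<circ> f| = |A|\<close>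
  extends over each component of the lemniscate, because \<open>A\<close> is a power of a Riemann map there; the
  extension is entire and equals the identity by Liouville. Applied to \<open>- \<Phi> (- z)\<close> and
  \<open>cnj (\<Phi> (cnj z))\<close>, this makes \<open>\<Phi>\<close> odd and real on the real axis, so the centers are
  \<open>- b, 0, b\<close>. Critical points of \<open>P\<close> off \<open>E\<close> correspond to solutions of \<open>w\<^sup>2 = m\<^sub>2 b\<^sup>2\<close>;
  since \<open>\<Phi> z\<^sub>2\<close> is real, so is \<open>b\<close>, and evaluating \<open>|J|\<close> at \<open>z\<^sub>2\<close> gives the formula.
\<close>

section \<open>Functions that are locally real parts of holomorphic functions\<close>

text \<open>Nothing is known about the boundary behaviour of \<open>\<Phi>\<close>, and this shapes
  every argument. Harmonic functions are compared through bounds off compact subsets instead of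
  boundary values; inversion at a point of \<open>E\<close> makes infinity an interior point, where
  the logarithmic poles of the two Green functions cancel. A conformal map between lemniscate
  exteriors is extended from slightly larger level sets, where each component is a topological disc
  with a single root. Labels are decided by points of the domain that lie near a component:
  \<open>\<Phi> \<circ> \<gamma>\<close> winds around \<open>\<Phi> z\<close> as
  \<open>\<gamma>\<close> winds around \<open>z\<close>. The exponents are a priori only real, so
  \<open>U \<circ> \<Phi>\<close> need not be the modulus of a single-valued function. Identities
  between weighted logarithms of moduli are therefore differentiated, and the relation between
  logarithmic derivatives is integrated along curves. Only the two outer centers are matched
  directly with components, by approaching along the real axis from both ends; the center
  \<open>0\<close> gets the label that is left.\<close>

definition locally_Re_holomorphic :: "(complex \<Rightarrow> real) \<Rightarrow> complex set \<Rightarrow> bool" where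
  "locally_Re_holomorphic h D \<longleftrightarrow>
     (\<forall>p\<in>D. \<exists>r>0. ball p r \<subseteq> D \<and> (\<exists>F. F holomorphic_on ball p r \<and> (\<forall>z\<in>ball p r. h z = Re (F z))))"

lemma locally_Re_holomorphic_ln_norm:
  assumes "open D" "G holomorphic_on D" "\<And>z. z \<in> D \<Longrightarrow> G z \<noteq> 0"
  shows "locally_Re_holomorphic (\<lambda>z. ln (norm (G z))) D"
  unfolding locally_Re_holomorphic_def
proof
  fix p assume "p \<in> D"
  then obtain r where r: "r > 0" "ball p r \<subseteq> D" using assms(1) openE by blast
  have "G holomorphic_on ball p r" "\<And>z. z \<in> ball p r \<Longrightarrow> G z \<noteq> 0"
    using r assms holomorphic_on_subset by blast+
  then obtain g where g: "g holomorphic_on ball p r" "\<And>z. z \<in> ball p r \<Longrightarrow> exp (g z) = G z"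
    using holomorphic_logarithm_exists[OF convex_ball open_ball, of G p r p] r by auto
  have "\<forall>z\<in>ball p r. ln (norm (G z)) = Re (g z)"
    using g(2) by (metis ln_exp norm_exp_eq_Re)
  with r g show "\<exists>r>0. ball p r \<subseteq> D \<and> (\<exists>F. F holomorphic_on ball p r \<and> (\<forall>z\<in>ball p r. ln (norm (G z)) = Re (F z)))"
    by blast
qed

lemma locally_Re_holomorphic_add:
  assumes "locally_Re_holomorphic g D" "locally_Re_holomorphic h D"
  shows "locally_Re_holomorphic (\<lambda>z. g z + h z) D"
  unfolding locally_Re_holomorphic_def
proof
  fix p assume "p \<in> D"
  obtain r F where r: "r > 0" "ball p r \<subseteq> D" "F holomorphic_on ball p r" "\<forall>z\<in>ball p r. g z = Re (F z)"
    using assms(1) \<open>p \<in> D\<close> unfolding locally_Re_holomorphic_def by blast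
  obtain r' F' where r': "r' > 0" "ball p r' \<subseteq> D" "F' holomorphic_on ball p r'" "\<forall>z\<in>ball p r'. h z = Re (F' z)"
    using assms(2) \<open>p \<in> D\<close> unfolding locally_Re_holomorphic_def by blast
  let ?m = "min r r'"
  have sub: "ball p ?m \<subseteq> ball p r" "ball p ?m \<subseteq> ball p r'" by auto
  have "(\<lambda>z. F z + F' z) holomorphic_on ball p ?m"
    using holomorphic_on_subset[OF r(3) sub(1)] holomorphic_on_subset[OF r'(3) sub(2)]
    by (intro holomorphic_intros)
  moreover have "\<forall>z\<in>ball p ?m. g z + h z = Re (F z + F' z)" using r(4) r'(4) sub by auto
  ultimately show "\<exists>r>0. ball p r \<subseteq> D \<and> (\<exists>F. F holomorphic_on ball p r \<and> (\<forall>z\<in>ball p r. g z + h z = Re (F z)))"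
    using r r' sub by (intro exI[of _ ?m]) auto
qed

lemma locally_Re_holomorphic_cmult:
  assumes "locally_Re_holomorphic h D"
  shows "locally_Re_holomorphic (\<lambda>z. c * h z) D"
  unfolding locally_Re_holomorphic_def
proof
  fix p assume "p \<in> D"
  obtain r F where r: "r > 0" "ball p r \<subseteq> D" "F holomorphic_on ball p r" "\<forall>z\<in>ball p r. h z = Re (F z)"
    using assms(1) \<open>p \<in> D\<close> unfolding locally_Re_holomorphic_def by blast
  have "(\<lambda>z. of_real c * F z) holomorphic_on ball p r" "\<forall>z\<in>ball p r. c * h z = Re (of_real c * F z)"
    using r by (auto intro!: holomorphic_intros)
  then show "\<exists>r>0. ball p r \<subseteq> D \<and> (\<exists>F. F holomorphic_on ball p r \<and> (\<forall>z\<in>ball p r. c * h z = Re (F z)))"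
    using r by blast
qed

lemma locally_Re_holomorphic_sum:
  assumes "open D" "\<And>i. i \<in> I \<Longrightarrow> locally_Re_holomorphic (h i) D"
  shows "locally_Re_holomorphic (\<lambda>z. \<Sum>i\<in>I. h i z) D"
  using assms(2)
proof (induction I rule: infinite_finite_induct)
  case (insert x F)
  then show ?case using locally_Re_holomorphic_add by simp
\<comment> \<open>Empty and infinite index sets give the zero function, which is
  \<open>ln (norm 1)\<close>.\<close>
qed (use locally_Re_holomorphic_ln_norm[OF assms(1), of "\<lambda>_. 1"] in auto)

lemma locally_Re_holomorphic_imp_continuous_on:
  assumes "locally_Re_holomorphic h D"
  shows "continuous_on D h"
proof (rule continuous_at_imp_continuous_on, rule ballI)
  fix p assume "p \<in> D"
  then obtain r F where r: "r > 0" "F holomorphic_on ball p r" "\<forall>z\<in>ball p r. h z = Re (F z)"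
    using assms unfolding locally_Re_holomorphic_def by blast
  have "continuous_on (ball p r) h"
    using holomorphic_on_imp_continuous_on[OF r(2)] r(3)
    using continuous_on_Re[of "ball p r" F] continuous_on_cong[of "ball p r" "ball p r" h "\<lambda>z. Re (F z)"] by auto
  then show "isCont h p" using r(1) by (simp add: continuous_on_eq_continuous_at)
qed

text \<open>Where \<open>h\<close> takes its minimum, \<open>exp (- F)\<close> has maximal modulus
  on a disc, so the set of minimum points is open; by continuity its complement is open in
  \<open>D\<close> as well.\<close>

lemma locally_Re_holomorphic_min_constant:
  assumes h: "locally_Re_holomorphic h D" and "connected D" "q \<in> D"
    and min: "\<And>z. z \<in> D \<Longrightarrow> h q \<le> h z" and "z \<in> D"
  shows "h z = h q"
proof -
  have cont: "continuous_on D h" using h by (rule locally_Re_holomorphic_imp_continuous_on)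
  have "(\<lambda>z. h z = h q) constant_on D"
  proof (rule locally_constant_imp_constant[OF \<open>connected D\<close>])
    fix a assume "a \<in> D"
    show "\<exists>T. openin (top_of_set D) T \<and> a \<in> T \<and> (\<forall>x\<in>T. (h x = h q) = (h a = h q))"
    proof (cases "h a = h q")
      case True
      obtain r F where r: "r > 0" "ball a r \<subseteq> D" "F holomorphic_on ball a r" "\<forall>z\<in>ball a r. h z = Re (F z)"
        using h \<open>a \<in> D\<close> unfolding locally_Re_holomorphic_def by blast
      have "(\<lambda>z. exp (- F z)) constant_on ball a r"
      proof (rule maximum_modulus_principle[where U = "ball a r" and \<xi> = a])
        show "norm (exp (- F z)) \<le> norm (exp (- F a))" if "z \<in> ball a r" for z
          using min[of z] r that True by (auto simp: norm_exp_eq_Re)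
      qed (use r in \<open>auto intro!: holomorphic_intros\<close>)
      then obtain c where c: "\<And>z. z \<in> ball a r \<Longrightarrow> exp (- F z) = c"
        unfolding constant_on_def by blast
      have "h z = - ln (norm c)" if "z \<in> ball a r" for z
        using c[OF that] r(4) that by (auto simp: norm_exp_eq_Re)
      then have "\<forall>z\<in>ball a r. h z = h a" using r(1) by simp
      then have "\<forall>x\<in>ball a r. (h x = h q) = (h a = h q)" by simp
      moreover have "openin (top_of_set D) (ball a r)" using r(2) open_subset by blast
      ultimately show ?thesis using r(1) by (metis centre_in_ball)
    next
      case False
      have "openin (top_of_set D) (D \<inter> h -` (- {h q}))"
        by (rule continuous_openin_preimage_gen[OF cont]) auto
      with False \<open>a \<in> D\<close> show ?thesis by (intro exI[of _ "D \<inter> h -` (- {h q})"]) auto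
    qed
  qed
  then show ?thesis using assms(3,5) unfolding constant_on_def by metis
qed

text \<open>The hypothesis \<open>bd\<close> expresses that the lower limit of \<open>h\<close> at
  the boundary is at least \<open>b\<close>, without boundary values. If \<open>h p < b\<close>, the
  minimum over a suitable \<open>K\<close> is global, so \<open>h\<close> is constant; then nothing
  lies off \<open>K\<close>, and \<open>D = K\<close> is open, compact and nonempty, which is
  impossible in the plane.\<close>

lemma locally_Re_holomorphic_lower_bound:
  assumes h: "locally_Re_holomorphic h D" and "open D" "connected D"
    and bd: "\<And>e. e > 0 \<Longrightarrow> \<exists>K. compact K \<and> K \<subseteq> D \<and> (\<forall>z\<in>D - K. h z > b - e)"
    and "p \<in> D"
  shows "b \<le> h p"
proof (rule ccontr)
  assume "\<not> b \<le> h p"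
  then have "b - h p > 0" by simp
  from bd[OF this] obtain K where K: "compact K" "K \<subseteq> D" "\<forall>z\<in>D - K. h z > h p" by auto
  have "p \<in> K" using K(3) \<open>p \<in> D\<close> by blast
  obtain q where q: "q \<in> K" "\<forall>z\<in>K. h q \<le> h z"
    using continuous_attains_inf[OF K(1) _ continuous_on_subset[OF locally_Re_holomorphic_imp_continuous_on[OF h] K(2)]]
      \<open>p \<in> K\<close> by blast
  have min: "h q \<le> h z" if "z \<in> D" for z
  proof (cases "z \<in> K")
    case False
    then have "h p < h z" using K(3) that by blast
    moreover have "h q \<le> h p" using q(2) \<open>p \<in> K\<close> by blast
    ultimately show ?thesis by linarith
  qed (use q in blast)
  have "D \<subseteq> K"
  proof
    fix z assume "z \<in> D"
    have "q \<in> D" using q(1) K(2) by blast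
    note const = locally_Re_holomorphic_min_constant[OF h \<open>connected D\<close> this min]
    have "h z = h q" "h p = h q"
      using const[OF _ \<open>z \<in> D\<close>] const[OF _ \<open>p \<in> D\<close>] by simp_all
    then have "\<not> h p < h z" by simp
    then show "z \<in> K" using K(3) \<open>z \<in> D\<close> by blast
  qed
  then have "D = K" using K by blast
  then have "D = {}" using K \<open>open D\<close> compact_open by blast
  then show False using \<open>p \<in> D\<close> by blast
qed

section \<open>Polynomial lemniscates and the uniqueness of the lemniscatic map\<close>

lemma compact_poly_sublevel:
  fixes A :: "complex poly"
  assumes "degree A > 0"
  shows "compact {w. norm (poly A w) \<le> s}"
proof -
  have "\<forall>\<^sub>F w in at_infinity. s + 1 \<le> norm (poly A w)"
    using filterlim_poly_at_infinity[OF assms] unfolding filterlim_at_infinity[OF order_refl]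
    by (metis filterlim_at_infinity_conv_norm_at_top filterlim_at_top filterlim_poly_at_infinity[OF assms])
  then obtain b where "\<And>w. b \<le> norm w \<Longrightarrow> s + 1 \<le> norm (poly A w)"
    unfolding eventually_at_infinity by blast
  then have "{w. norm (poly A w) \<le> s} \<subseteq> cball 0 b"
    by (force simp: not_le dest: less_imp_le)
  moreover have "closed {w. norm (poly A w) \<le> s}"
    by (intro closed_Collect_le continuous_intros)
  ultimately show ?thesis
    by (meson bounded_cball bounded_subset compact_eq_bounded_closed)
qed

lemma frontier_component_poly_sublevel:
  fixes A :: "complex poly"
  assumes "w \<in> closure (connected_component_set {w. norm (poly A w) < s} z)"
    and "w \<notin> connected_component_set {w. norm (poly A w) < s} z"
  shows "norm (poly A w) = s"
proof -
  let ?V = "{w. norm (poly A w) < s}"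
  have op: "open ?V" by (intro open_Collect_less continuous_intros)
  have "w \<in> frontier (connected_component_set ?V z)"
    using assms open_connected_component[OF op] by (auto simp: frontier_def interior_open)
  then have "w \<in> frontier ?V" using frontier_of_connected_component_subset by blast
  then have "w \<in> closure ?V" "w \<notin> ?V" using op by (auto simp: frontier_def interior_open)
  moreover have "closure ?V \<subseteq> {w. norm (poly A w) \<le> s}"
    by (rule closure_minimal) (auto intro!: closed_Collect_le continuous_intros)
  ultimately show ?thesis by auto
qed

text \<open>Without a root, \<open>1 / A\<close> is holomorphic on the component and has modulus
  \<open>1 / s\<close> on its frontier, so the maximum principle forces
  \<open>norm (poly A z) \<ge> s\<close>.\<close>

lemma component_poly_sublevel_has_root:
  fixes A :: "complex poly"
  assumes deg: "degree A > 0" and z: "norm (poly A z) < s"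
  obtains a where "poly A a = 0" "a \<in> connected_component_set {w. norm (poly A w) < s} z"
proof -
  let ?V = "{w. norm (poly A w) < s}"
  let ?C = "connected_component_set ?V z"
  have op: "open ?C" by (intro open_connected_component open_Collect_less continuous_intros)
  have zC: "z \<in> ?C" using z by simp
  have "?C \<subseteq> {w. norm (poly A w) \<le> s}" using connected_component_subset[of ?V z] by auto
  then have bd: "bounded ?C" using compact_poly_sublevel[OF deg] bounded_subset compact_imp_bounded by blast
  have "\<exists>a. poly A a = 0 \<and> a \<in> ?C"
  proof (rule ccontr)
    assume no: "\<not> ?thesis"
    have s0: "s > 0" using z by (meson le_less_trans norm_ge_zero)
    have fr: "norm (poly A w) = s" if "w \<in> closure ?C" "w \<notin> ?C" for w
      using frontier_component_poly_sublevel that by blast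
    have nz: "poly A w \<noteq> 0" if "w \<in> closure ?C" for w
      using no fr[OF that] s0 by (cases "w \<in> ?C") auto
    have "norm (inverse (poly A z)) \<le> 1 / s"
    proof (rule maximum_modulus_frontier[of "\<lambda>w. inverse (poly A w)" ?C])
      have "poly A w \<noteq> 0" if "w \<in> interior ?C" for w
        using nz that interior_subset closure_subset by blast
      then show "(\<lambda>w. inverse (poly A w)) holomorphic_on interior ?C"
        by (intro holomorphic_intros)
      show "continuous_on (closure ?C) (\<lambda>w. inverse (poly A w))"
        using nz by (intro continuous_intros) auto
      show "norm (inverse (poly A w)) \<le> 1 / s" if "w \<in> frontier ?C" for w
      proof -
        have "norm (poly A w) = s" using fr[of w] that op by (simp add: frontier_def interior_open)
        then show ?thesis by (simp add: norm_inverse divide_inverse)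
      qed
    qed (use bd zC in auto)
    have "poly A z \<noteq> 0" using nz[OF subsetD[OF closure_subset zC]] .
    have "norm (poly A z) \<ge> s"
    proof -
      have "inverse (norm (poly A z)) \<le> inverse s"
        using \<open>norm (inverse (poly A z)) \<le> 1 / s\<close> by (simp only: norm_inverse inverse_eq_divide[symmetric])
      then show ?thesis using \<open>poly A z \<noteq> 0\<close> inverse_le_imp_le by (metis zero_less_norm_iff)
    qed
    then show False using z by simp
  qed
  then show ?thesis using that by blast
qed

text \<open>Creates the room needed for the extension: an annular zone above level \<open>R\<close>
  around each component, still with one root each. If two roots stayed joined at every level above
  \<open>R\<close>, their components at the levels \<open>R + 1 / Suc n\<close> would be nested
  continua, and the intersection would join the roots at level \<open>R\<close>. Finitely many pairs
  of roots allow a common level.\<close>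

lemma eventually_separated_poly_sublevel:
  fixes A :: "complex poly"
  assumes deg: "degree A > 0"
    and sep: "\<And>a b. poly A a = 0 \<Longrightarrow> poly A b = 0 \<Longrightarrow> a \<noteq> b \<Longrightarrow>
                \<not> connected_component {w. norm (poly A w) \<le> R} a b"
  shows "\<forall>\<^sub>F s in at_right R. \<forall>a b. poly A a = 0 \<longrightarrow> poly A b = 0 \<longrightarrow> a \<noteq> b \<longrightarrow>
           \<not> connected_component {w. norm (poly A w) < s} a b"
proof -
  let ?Z = "{a. poly A a = 0}"
  have fin: "finite ?Z" using deg by (intro poly_roots_finite) auto
  have one: "\<forall>\<^sub>F s in at_right R. a \<noteq> b \<longrightarrow> \<not> connected_component {w. norm (poly A w) < s} a b"
    if a: "poly A a = 0" and b: "poly A b = 0" for a b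
  proof (cases "a = b")
    case ne: False
    have "\<exists>s>R. \<not> connected_component {w. norm (poly A w) < s} a b"
    proof (rule ccontr)
      assume "\<not> ?thesis"
      then have cc: "connected_component {w. norm (poly A w) < s} a b" if "s > R" for s
        using that by blast
      define K where "K n = connected_component_set {w. norm (poly A w) \<le> R + 1 / real (Suc n)} a" for n
      have "compact (K n)" for n
      proof -
        let ?L = "{w. norm (poly A w) \<le> R + 1 / real (Suc n)}"
        have "compact ?L" by (rule compact_poly_sublevel[OF deg])
        then show ?thesis unfolding K_def
          by (meson bounded_subset closed_connected_component compact_eq_bounded_closed connected_component_subset)
      qed
      moreover have "connected (K n)" for n unfolding K_def by simp
      moreover have "K n \<subseteq> K m" if "m \<le> n" for m n
        unfolding K_def
      proof (rule connected_component_mono)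
        have "1 / real (Suc n) \<le> 1 / real (Suc m)" using that by (simp add: field_simps)
        then show "{w. norm (poly A w) \<le> R + 1 / real (Suc n)} \<subseteq> {w. norm (poly A w) \<le> R + 1 / real (Suc m)}"
          by auto
      qed
      ultimately have con: "connected (\<Inter> (range K))" by (rule connected_nest)
      have bK: "b \<in> K n" for n
      proof -
        have "connected_component {w. norm (poly A w) < R + 1 / real (Suc n)} a b"
          by (rule cc) simp
        then have "connected_component {w. norm (poly A w) \<le> R + 1 / real (Suc n)} a b"
          by (rule connected_component_of_subset) auto
        then show ?thesis by (simp add: K_def)
      qed
      have aK: "a \<in> K n" for n
      proof -
        have "connected_component {w. norm (poly A w) \<le> R + 1 / real (Suc n)} a b"
          using bK by (simp add: K_def)
        then show ?thesis unfolding K_def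
          using connected_component_in connected_component_refl mem_Collect_eq by (metis (mono_tags, lifting))
      qed
      have "\<Inter> (range K) \<subseteq> {w. norm (poly A w) \<le> R}"
      proof
        fix w assume "w \<in> \<Inter> (range K)"
        then have "w \<in> K n" for n by blast
        then have "norm (poly A w) \<le> R + 1 / real (Suc n)" for n
          by (auto simp: K_def dest: connected_component_in)
        moreover have "(\<lambda>n. R + 1 / real (Suc n)) \<longlonglongrightarrow> R + 0"
          by (intro tendsto_intros lim_1_over_n[THEN LIMSEQ_Suc])
        ultimately have "norm (poly A w) \<le> R + 0"
          using LIMSEQ_le_const by blast
        then show "w \<in> {w. norm (poly A w) \<le> R}" by simp
      qed
      then have "connected_component {w. norm (poly A w) \<le> R} a b"
        unfolding connected_component_def using con bK aK by (intro exI[of _ "\<Inter> (range K)"]) blast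
      then show False using sep a b ne by blast
    qed
    then obtain s0 where s0: "s0 > R" "\<not> connected_component {w. norm (poly A w) < s0} a b" by blast
    have "\<forall>\<^sub>F s in at_right R. s < s0" using s0(1) eventually_at_right by blast
    then show ?thesis
    proof eventually_elim
      case (elim s)
      then have "{w. norm (poly A w) < s} \<subseteq> {w. norm (poly A w) < s0}" by auto
      then show ?case using s0(2) connected_component_of_subset by blast
    qed
  qed simp
  have "\<forall>\<^sub>F s in at_right R. \<forall>a\<in>?Z. \<forall>b\<in>?Z. a \<noteq> b \<longrightarrow> \<not> connected_component {w. norm (poly A w) < s} a b"
    using one by (intro eventually_ball_finite fin ballI) auto
  then show ?thesis by eventually_elim auto
qed

text \<open>A loop in the component that winds around \<open>w\<close> has \<open>w\<close> inside.
  The maximum principle puts the whole inside of the loop below level \<open>s\<close>, and the loop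
  together with its inside is connected, so \<open>w\<close> already belongs to the
  component.\<close>

lemma simply_connected_component_poly_sublevel:
  fixes A :: "complex poly"
  assumes deg: "degree A > 0"
  shows "simply_connected (connected_component_set {w. norm (poly A w) < s} z)" (is "simply_connected ?C")
proof -
  let ?V = "{w. norm (poly A w) < s}"
  have op: "open ?C" by (intro open_connected_component open_Collect_less continuous_intros)
  have "winding_number g w = 0"
    if g: "path g" "path_image g \<subseteq> ?C" "pathfinish g = pathstart g" and w: "w \<notin> ?C" for g w
  proof (rule ccontr)
    assume nz: "winding_number g w \<noteq> 0"
    let ?I = "inside (path_image g)"
    have "w \<in> ?I"
      using nz winding_number_zero_in_outside[OF g(1,3)] g(2) w inside_Un_outside by blast
    have cp: "compact (path_image g)" by (rule compact_path_image[OF g(1)])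
    have "continuous_on (path_image g) (\<lambda>w. norm (poly A w))" by (intro continuous_intros)
    then obtain p where p: "p \<in> path_image g" "\<And>y. y \<in> path_image g \<Longrightarrow> norm (poly A y) \<le> norm (poly A p)"
      using continuous_attains_sup[OF cp] by (meson path_image_nonempty)
    have "p \<in> ?V" using p(1) g(2) connected_component_subset by blast
    have bd: "norm (poly A y) \<le> norm (poly A p)" if "y \<in> ?I" for y
    proof (rule maximum_modulus_frontier[of "poly A" ?I])
      show "bounded ?I" by (simp add: bounded_inside compact_imp_bounded cp)
      show "norm (poly A z) \<le> norm (poly A p)" if "z \<in> frontier ?I" for z
        using p(2) frontier_inside_subset[OF compact_imp_closed[OF cp]] that by blast
    qed (use that in \<open>auto intro!: holomorphic_intros continuous_intros\<close>)
    have "path_image g \<subseteq> ?V" using g(2) connected_component_subset by blast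
    moreover have "?I \<subseteq> ?V" using bd \<open>p \<in> ?V\<close> by (auto intro: le_less_trans)
    ultimately have "path_image g \<union> ?I \<subseteq> ?V" by blast
    moreover have "connected (path_image g \<union> ?I)"
      using connected_with_inside compact_imp_closed[OF cp] connected_path_image g(1) by blast
    ultimately have "path_image g \<union> ?I \<subseteq> connected_component_set ?V p"
      using p(1) by (intro connected_component_maximal) auto
    moreover have "connected_component_set ?V p = ?C"
      using p(1) g(2) connected_component_eq by blast
    ultimately show False using w \<open>w \<in> ?I\<close> by blast
  qed
  then show ?thesis unfolding simply_connected_eq_winding_number_zero[OF op] by auto
qed

text \<open>Take a Riemann map \<open>\<phi>\<close> with \<open>\<phi> a = 0\<close>. The quotient
  of \<open>A\<close> by \<open>\<phi> ^ k\<close>, with \<open>k\<close> the order of the root, has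
  no zeros, and its modulus tends to \<open>s\<close> at the frontier because
  \<open>norm (poly A z)\<close> tends to \<open>s\<close> and \<open>norm (\<phi> z)\<close> to 1.
  Hence it is constantly \<open>s\<close>.\<close>

lemma component_poly_sublevel_uniformization:
  fixes A :: "complex poly"
  defines "\<Omega> \<equiv> \<lambda>s. connected_component_set {w. norm (poly A w) < s}"
  assumes deg: "degree A > 0" and "s > 0" and root: "poly A a = 0"
    and only: "\<And>b. b \<in> \<Omega> s a \<Longrightarrow> poly A b = 0 \<Longrightarrow> b = a"
  obtains \<phi> \<psi> where "\<phi> holomorphic_on \<Omega> s a" "\<psi> holomorphic_on ball 0 1"
    "\<And>z. z \<in> \<Omega> s a \<Longrightarrow> \<phi> z \<in> ball 0 1 \<and> \<psi> (\<phi> z) = z"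
    "\<And>z. z \<in> ball 0 1 \<Longrightarrow> \<psi> z \<in> \<Omega> s a \<and> \<phi> (\<psi> z) = z"
    "\<And>z. z \<in> \<Omega> s a \<Longrightarrow> norm (poly A z) = s * norm (\<phi> z) ^ order a A"
proof -
  let ?V = "{w. norm (poly A w) < s}"
  define C where "C = \<Omega> s a"
  have C: "C = connected_component_set ?V a" by (simp add: C_def \<Omega>_def)
  have op: "open C" unfolding C by (intro open_connected_component open_Collect_less continuous_intros)
  have con: "connected C" unfolding C by simp
  have aC: "a \<in> C" using root \<open>s > 0\<close> by (simp add: C)
  have sub: "C \<subseteq> ?V" unfolding C by (rule connected_component_subset)
  have bd: "bounded C"
    by (rule bounded_subset[OF compact_imp_bounded[OF compact_poly_sublevel[OF deg, of s]]]) (use sub in auto)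
  have "simply_connected C" unfolding C by (rule simply_connected_component_poly_sublevel[OF deg])
  moreover have "C \<noteq> {}" "C \<noteq> UNIV" using aC bd not_bounded_UNIV by auto
  ultimately obtain f g where fg: "f holomorphic_on C" "g holomorphic_on ball 0 1"
    "\<And>z. z \<in> C \<Longrightarrow> f z \<in> ball 0 1 \<and> g (f z) = z" "\<And>z. z \<in> ball 0 1 \<Longrightarrow> g z \<in> C \<and> f (g z) = z"
    using op Riemann_mapping_theorem[of C] by (metis (no_types, lifting))
  obtain m m' where m: "m (f a) = 0" "m holomorphic_on ball 0 1" "m ` ball 0 1 \<subseteq> ball 0 1"
    "m' holomorphic_on ball 0 1" "m' ` ball 0 1 \<subseteq> ball 0 1"
    "\<And>z. z \<in> ball 0 1 \<Longrightarrow> m (m' z) = z" "\<And>z. z \<in> ball 0 1 \<Longrightarrow> m' (m z) = z"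
    using ball_biholomorphism_exists[of "f a"] fg(3)[OF aC] by blast
  define \<phi> where "\<phi> = m \<circ> f"
  define \<psi> where "\<psi> = g \<circ> m'"
  have hol: "\<phi> holomorphic_on C" "\<psi> holomorphic_on ball 0 1"
    unfolding \<phi>_def \<psi>_def using fg m by (auto intro!: holomorphic_on_compose_gen[where t = "ball 0 1"])
  have \<phi>\<psi>: "\<phi> z \<in> ball 0 1 \<and> \<psi> (\<phi> z) = z" if "z \<in> C" for z
  proof -
    have "m (f z) \<in> ball 0 1" using fg(3)[OF that] m(3) by blast
    then show ?thesis unfolding \<phi>_def \<psi>_def using fg(3)[OF that] m(7) by auto
  qed
  have \<psi>\<phi>: "\<psi> z \<in> C \<and> \<phi> (\<psi> z) = z" if "z \<in> ball 0 1" for z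
  proof -
    have "m' z \<in> ball 0 1" using m(5) that by blast
    then show ?thesis unfolding \<phi>_def \<psi>_def using fg(4) m(6) that by auto
  qed
  have inj: "inj_on \<phi> C" using \<phi>\<psi> by (metis inj_onI)
  have \<phi>a: "\<phi> a = 0" using m by (simp add: \<phi>_def)
  define \<phi>1 where "\<phi>1 w = (if w = a then deriv \<phi> a else (\<phi> w - \<phi> a) / (w - a))" for w
  have hol1: "\<phi>1 holomorphic_on C"
    unfolding \<phi>1_def by (rule pole_lemma[OF hol(1)]) (use aC op in \<open>simp add: interior_open\<close>)
  have \<phi>1: "\<phi> w = (w - a) * \<phi>1 w" for w by (simp add: \<phi>1_def \<phi>a)
  have \<phi>1nz: "\<phi>1 w \<noteq> 0" if "w \<in> C" for w
    using holomorphic_injective_imp_regular[OF hol(1) op inj aC] inj_onD[OF inj _ that aC]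
    by (auto simp: \<phi>1_def)
  define k where "k = order a A"
  have "A \<noteq> 0" using deg by auto
  obtain q where q: "A = [:-a, 1:] ^ k * q" "\<not> [:-a, 1:] dvd q"
    using order_decomp[OF \<open>A \<noteq> 0\<close>, of a] unfolding k_def by blast
  have "k > 0" using root \<open>A \<noteq> 0\<close> order_root[of A a] by (simp add: k_def)
  have Aq: "poly A w = (w - a) ^ k * poly q w" for w by (subst q(1)) simp
  \<comment> \<open>This is \<open>A / \<phi> ^ k\<close> with the factors
    \<open>(w - a) ^ k\<close> cancelled, so that it is defined and nonzero also at
    \<open>a\<close>.\<close>
  define Q where "Q w = poly q w / \<phi>1 w ^ k" for w
  have Q: "norm (poly A w) = norm (Q w) * norm (\<phi> w) ^ k" if "w \<in> C" for w
    using \<phi>1nz[OF that] by (simp add: Aq Q_def \<phi>1 norm_mult norm_divide norm_power power_mult_distrib)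
  have Qnz: "Q w \<noteq> 0" if "w \<in> C" for w
  proof -
    have "poly q w \<noteq> 0"
    proof
      assume 0: "poly q w = 0"
      then have "w = a" using only[of w] that by (simp add: Aq C_def)
      then show False using q(2) 0 by (simp add: poly_eq_0_iff_dvd)
    qed
    then show ?thesis using \<phi>1nz[OF that] by (simp add: Q_def)
  qed
  have "Q holomorphic_on C" unfolding Q_def using hol1 \<phi>1nz by (intro holomorphic_intros) auto
  then have h: "locally_Re_holomorphic (\<lambda>z. ln (norm (Q z))) C"
    using Qnz op by (intro locally_Re_holomorphic_ln_norm)
  have Qs: "norm (Q w) = s" if "w \<in> C" for w
  proof -
    have "ln s \<le> ln (norm (Q w))"
    proof (rule locally_Re_holomorphic_lower_bound[OF h op con _ that])
      fix e :: real assume "e > 0"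
      define t where "t = s * exp (- e)"
      have "t < s" using \<open>s > 0\<close> \<open>e > 0\<close> by (simp add: t_def)
      let ?K = "{w \<in> C. norm (poly A w) \<le> t}"
      \<comment> \<open>On the frontier of \<open>C\<close> the modulus is \<open>s > t\<close>, so
        no frontier point is added and \<open>?K\<close> is closed.\<close>
      have "?K = closure C \<inter> {w. norm (poly A w) \<le> t}"
      proof (intro equalityI subsetI)
        fix w assume w: "w \<in> closure C \<inter> {w. norm (poly A w) \<le> t}"
        then have "norm (poly A w) \<noteq> s" using \<open>t < s\<close> by auto
        then have "w \<in> C" using frontier_component_poly_sublevel[of w A s a] w unfolding C by blast
        then show "w \<in> ?K" using w by simp
      qed (use closure_subset[of C] in auto)
      then have "compact ?K"
        using compact_poly_sublevel[OF deg, of t] by (metis closed_Int_compact closed_closure)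
      moreover have "ln s - e < ln (norm (Q z))" if z: "z \<in> C - ?K" for z
      proof -
        have "norm (\<phi> z) ^ k \<le> 1" using \<phi>\<psi>[of z] z by (intro power_le_one) auto
        then have "norm (poly A z) \<le> norm (Q z)" using Q[of z] z by (simp add: mult_left_le)
        then have "t < norm (Q z)" using z by auto
        moreover have "t > 0" using \<open>s > 0\<close> by (simp add: t_def)
        ultimately have "ln t < ln (norm (Q z))" by (intro ln_less_cancel_iff[THEN iffD2]) linarith+
        then show ?thesis using \<open>s > 0\<close> by (simp add: t_def ln_mult)
      qed
      ultimately show "\<exists>K. compact K \<and> K \<subseteq> C \<and> (\<forall>z\<in>C - K. ln s - e < ln (norm (Q z)))"
        by (intro exI[of _ ?K]) blast
    qed
    moreover have "- ln s \<le> (- 1) * ln (norm (Q w))"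
    proof (rule locally_Re_holomorphic_lower_bound[OF locally_Re_holomorphic_cmult[OF h] op con _ that])
      fix e :: real assume "e > 0"
      \<comment> \<open>Where \<open>norm (\<phi> z) > \<rho>\<close>, division by
        \<open>norm (\<phi> z) ^ k\<close> costs less than the factor \<open>exp e\<close>, since
        \<open>\<rho> ^ k = exp (- e)\<close>.\<close>
      define \<rho> where "\<rho> = exp (- e / k)"
      have "\<rho> > 0" "\<rho> < 1" using \<open>e > 0\<close> \<open>k > 0\<close> by (auto simp: \<rho>_def)
      have \<rho>k: "\<rho> ^ k = exp (- e)" using \<open>k > 0\<close> by (simp add: \<rho>_def flip: exp_of_nat_mult)
      let ?K = "\<psi> ` cball 0 \<rho>"
      have "cball 0 \<rho> \<subseteq> ball (0::complex) 1" using \<open>\<rho> < 1\<close> by auto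
      then have "compact ?K" "?K \<subseteq> C"
        using holomorphic_on_imp_continuous_on[OF hol(2)] \<psi>\<phi>
        by (auto intro!: compact_continuous_image continuous_on_subset[where s = "ball 0 1"])
      moreover have "- ln s - e < (- 1) * ln (norm (Q z))" if z: "z \<in> C - ?K" for z
      proof -
        have "norm (\<phi> z) > \<rho>"
        proof (rule ccontr)
          assume "\<not> \<rho> < norm (\<phi> z)"
          then have "\<phi> z \<in> cball 0 \<rho>" by simp
          then have "\<psi> (\<phi> z) \<in> ?K" by (rule imageI)
          then show False using z \<phi>\<psi>[of z] by auto
        qed
        then have "exp (- e) < norm (\<phi> z) ^ k"
          unfolding \<rho>k[symmetric] using \<open>\<rho> > 0\<close> \<open>k > 0\<close> by (intro power_strict_mono) auto
        then have "norm (Q z) * exp (- e) < norm (Q z) * norm (\<phi> z) ^ k"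
          using Qnz[of z] z by simp
        also have "\<dots> < s" using Q[of z] z sub by auto
        finally have "ln (norm (Q z) * exp (- e)) < ln s"
          using Qnz[of z] z \<open>s > 0\<close> by (subst ln_less_cancel_iff) auto
        then show ?thesis using Qnz[of z] z by (simp add: ln_mult)
      qed
      ultimately show "\<exists>K. compact K \<and> K \<subseteq> C \<and> (\<forall>z\<in>C - K. - ln s - e < (- 1) * ln (norm (Q z)))"
        by (intro exI[of _ ?K]) blast
    qed
    ultimately have "ln (norm (Q w)) = ln s" by simp
    then show ?thesis using Qnz[OF that] \<open>s > 0\<close> by (metis ln_inj_iff zero_less_norm_iff)
  qed
  show ?thesis
  proof (rule that)
    show "norm (poly A z) = s * norm (\<phi> z) ^ order a A" if "z \<in> \<Omega> s a" for z
      using Q[of z] Qs[of z] that by (simp add: C_def k_def)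
  qed (use hol \<phi>\<psi> \<psi>\<phi> in \<open>auto simp: C_def\<close>)
qed

section \<open>Conformal maps between lemniscate exteriors\<close>

text \<open>
  Lifting \<open>g\<close> to the strip of logarithms turns the modulus identity into
  \<open>g (exp u) = c * exp (k / k' * u)\<close>; periodicity makes \<open>k / k'\<close> an integer, injectivity makes it \<open>1\<close>.
\<close>

lemma injective_annulus_map_power_modulus:
  fixes g :: "complex \<Rightarrow> complex"
  assumes "0 < r" "r < 1" and g: "g holomorphic_on {\<zeta>. r < norm \<zeta> \<and> norm \<zeta> < 1}"
    and inj: "inj_on g {\<zeta>. r < norm \<zeta> \<and> norm \<zeta> < 1}" and "k > 0" "k' > 0"
    and mod: "\<And>\<zeta>. r < norm \<zeta> \<Longrightarrow> norm \<zeta> < 1 \<Longrightarrow> norm (g \<zeta>) ^ k' = norm \<zeta> ^ k"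
  obtains \<kappa> where "norm \<kappa> = 1" "\<And>\<zeta>. r < norm \<zeta> \<Longrightarrow> norm \<zeta> < 1 \<Longrightarrow> g \<zeta> = \<kappa> * \<zeta>"
proof -
  define U where "U = {u :: complex. ln r < Re u} \<inter> {u. Re u < 0}"
  have U: "open U" "convex U" unfolding U_def
    by (auto intro!: open_Int convex_Int open_halfspace_Re_gt open_halfspace_Re_lt convex_halfspace_Re_gt convex_halfspace_Re_lt)
  have expU: "r < norm (exp u) \<and> norm (exp u) < 1" if "u \<in> U" for u
  proof -
    have "exp (ln r) < exp (Re u)" using that unfolding U_def by (simp only: exp_less_cancel_iff) simp
    then show ?thesis using that \<open>0 < r\<close> by (simp add: norm_exp_eq_Re U_def)
  qed
  define q :: complex where "q = of_real (real k / real k')"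
  \<comment> \<open>The modulus identity says exactly that \<open>G\<close> has modulus 1 on the
    strip, hence is constant.\<close>
  define G where "G u = g (exp u) * exp (- q * u)" for u
  have hol: "G holomorphic_on U"
    unfolding G_def
  proof (intro holomorphic_intros)
    show "(\<lambda>u. g (exp u)) holomorphic_on U"
    proof -
      have "exp ` U \<subseteq> {\<zeta>. r < norm \<zeta> \<and> norm \<zeta> < 1}" using expU by blast
      then show ?thesis using holomorphic_on_compose_gen[OF holomorphic_on_exp g, of U] by (simp add: o_def)
    qed
  qed
  have nG: "norm (G u) = 1" if "u \<in> U" for u
  proof -
    have "norm (G u) ^ k' = norm (g (exp u)) ^ k' * exp (- (real k / real k') * Re u) ^ k'"
      by (simp add: G_def norm_mult norm_exp_eq_Re q_def power_mult_distrib)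
    also have "norm (g (exp u)) ^ k' = exp (Re u) ^ k"
      using mod[of "exp u"] expU[OF that] by (simp add: norm_exp_eq_Re)
    also have "exp (Re u) ^ k = exp (real k * Re u)" by (simp add: exp_of_nat_mult)
    also have "exp (- (real k / real k') * Re u) ^ k' = exp (- (real k * Re u))"
      using \<open>k' > 0\<close> by (subst exp_of_nat_mult[symmetric]) simp
    also have "exp (real k * Re u) * exp (- (real k * Re u)) = 1" by (simp add: exp_minus)
    finally have "norm (G u) ^ k' = 1 ^ k'" by simp
    then show ?thesis using \<open>k' > 0\<close> power_eq_iff_eq_base[of k' "norm (G u)" 1] by simp
  qed
  \<comment> \<open>A point on the middle line of the strip \<open>ln r < Re u < 0\<close>; all its
    vertical translates stay in the strip.\<close>
  define u0 :: complex where "u0 = of_real (ln r / 2)"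
  have u0: "u0 + \<i> * of_real t \<in> U" for t using \<open>0 < r\<close> \<open>r < 1\<close> by (simp add: U_def u0_def)
  have "G constant_on U"
    by (rule maximum_modulus_principle[OF hol U(1) convex_connected[OF U(2)] U(1) subset_refl u0[of 0]])
       (use nG u0[of 0] in auto)
  then obtain c where c: "\<And>u. u \<in> U \<Longrightarrow> G u = c" unfolding constant_on_def by blast
  have gexp: "g (exp u) = c * exp (q * u)" if "u \<in> U" for u
    using c[OF that] by (simp add: G_def exp_minus field_simps)
  have nc: "norm c = 1" using nG[OF u0] c[OF u0] by metis
  have "exp (q * (u0 + \<i> * of_real (2 * pi))) = exp (q * u0)"
    using gexp[OF u0[of 0]] gexp[OF u0[of "2 * pi"]] nc by (auto simp: exp_add exp_two_pi_i' mult.commute)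
  then have "exp (q * (\<i> * of_real (2 * pi))) = 1" by (simp add: ring_distribs exp_add)
  then obtain j :: int where "real k / real k' * (2 * pi) = of_int (2 * j) * pi"
    by (auto simp: exp_eq_1 q_def)
  then have "(real k / real k' - of_int j) * (2 * pi) = 0" by (simp add: algebra_simps)
  then have j: "real k / real k' = of_int j" using pi_neq_zero by simp
  then have "j > 0" using \<open>k > 0\<close> \<open>k' > 0\<close> by (metis divide_pos_pos of_int_0_less_iff of_nat_0_less_iff)
  have qj: "q = of_int j" by (simp add: q_def j)
  \<comment> \<open>Shifting \<open>u\<close> by \<open>\<i> * ?t\<close> multiplies
    \<open>exp (q * u)\<close> by \<open>exp (2 * pi * \<i>) = 1\<close> and so keeps the value of
    \<open>g\<close>. Injectivity makes \<open>?t\<close> a multiple of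
    \<open>2 * pi\<close>.\<close>
  let ?t = "2 * pi / real_of_int j"
  have "g (exp (u0 + \<i> * of_real ?t)) = c * exp (q * u0 + 2 * pi * \<i>)"
    using \<open>j > 0\<close> by (subst gexp[OF u0]) (simp add: qj ring_distribs mult.commute)
  also have "\<dots> = g (exp (u0 + \<i> * of_real 0))"
    by (subst gexp[OF u0]) (simp add: exp_add exp_two_pi_i')
  finally have "exp (u0 + \<i> * of_real ?t) = exp (u0 + \<i> * of_real 0)"
    using inj_onD[OF inj] expU[OF u0] by (metis (mono_tags, lifting) mem_Collect_eq)
  then have "exp (\<i> * of_real ?t) = 1" by (simp add: exp_add)
  then obtain m :: int where m: "?t = of_int (2 * m) * pi" by (auto simp: exp_eq_1)
  then have "real_of_int (m * j) = 1" using \<open>j > 0\<close> by (simp add: field_simps)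
  then have "j = 1" using \<open>j > 0\<close> by (metis of_int_eq_1_iff zmult_eq_1_iff less_irrefl not_less_iff_gr_or_eq neg_less_0_iff_less zero_less_one order_less_trans)
  show ?thesis
  proof (rule that[OF nc])
    fix \<zeta> :: complex assume \<zeta>: "r < norm \<zeta>" "norm \<zeta> < 1"
    then have "\<zeta> \<noteq> 0" using \<open>0 < r\<close> by auto
    then have "Ln \<zeta> \<in> U" using \<zeta> \<open>0 < r\<close> by (simp add: U_def)
    from gexp[OF this] show "g \<zeta> = c * \<zeta>" using \<open>\<zeta> \<noteq> 0\<close> \<open>j = 1\<close> by (simp add: qj)
  qed
qed

text \<open>In the Riemann coordinates of the two components, \<open>f\<close> becomes an injective
  map of an annulus whose modulus is governed by powers, hence a rotation. The rotation is defined
  on the whole disc, and undoing the coordinates gives the extension.\<close>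

lemma component_poly_sublevel_extension:
  fixes A B :: "complex poly"
  defines "\<Omega> \<equiv> \<lambda>A s. connected_component_set {w. norm (poly A w) < s}"
  assumes degA: "degree A > 0" and degB: "degree B > 0" and "0 < R" "R < s"
    and sepA: "\<And>a b. poly A a = 0 \<Longrightarrow> poly A b = 0 \<Longrightarrow> a \<noteq> b \<Longrightarrow> \<not> connected_component {w. norm (poly A w) < s} a b"
    and sepB: "\<And>a b. poly B a = 0 \<Longrightarrow> poly B b = 0 \<Longrightarrow> a \<noteq> b \<Longrightarrow> \<not> connected_component {w. norm (poly B w) < s} a b"
    and hol: "f holomorphic_on {w. R < norm (poly A w)}" and inj: "inj_on f {w. R < norm (poly A w)}"
    and AB: "\<And>w. R < norm (poly A w) \<Longrightarrow> norm (poly B (f w)) = norm (poly A w)"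
    and a: "poly A a = 0"
  obtains g where "g holomorphic_on \<Omega> A s a"
    "\<And>w. w \<in> \<Omega> A s a \<Longrightarrow> R < norm (poly A w) \<Longrightarrow> g w = f w"
proof -
  have "s > 0" using \<open>0 < R\<close> \<open>R < s\<close> by simp
  have "b = a" if "b \<in> \<Omega> A s a" "poly A b = 0" for b
    using sepA[OF a that(2)] that(1) by (auto simp: \<Omega>_def)
  from component_poly_sublevel_uniformization[OF degA \<open>s > 0\<close> a this[unfolded \<Omega>_def]]
  obtain \<phi> \<psi> where \<phi>: "\<phi> holomorphic_on \<Omega> A s a" "\<psi> holomorphic_on ball 0 1"
    "\<And>z. z \<in> \<Omega> A s a \<Longrightarrow> \<phi> z \<in> ball 0 1 \<and> \<psi> (\<phi> z) = z"
    "\<And>z. z \<in> ball 0 1 \<Longrightarrow> \<psi> z \<in> \<Omega> A s a \<and> \<phi> (\<psi> z) = z"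
    "\<And>z. z \<in> \<Omega> A s a \<Longrightarrow> norm (poly A z) = s * norm (\<phi> z) ^ order a A"
    unfolding \<Omega>_def by blast
  define k where "k = order a A"
  have "A \<noteq> 0" "B \<noteq> 0" using degA degB by auto
  have "k > 0" using a \<open>A \<noteq> 0\<close> order_root[of A a] by (simp add: k_def)
  \<comment> \<open>Chosen so that \<open>s * r ^ k = R\<close>: the annulus
    \<open>r < norm \<zeta> < 1\<close> corresponds to the part of the component above level
    \<open>R\<close>.\<close>
  define r where "r = root k (R / s)"
  have r: "0 < r" "r < 1" "s * r ^ k = R"
    using \<open>k > 0\<close> \<open>0 < R\<close> \<open>R < s\<close> by (auto simp: r_def)
  let ?Ann = "{\<zeta> :: complex. r < norm \<zeta> \<and> norm \<zeta> < 1}"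
  have AnnA: "R < norm (poly A (\<psi> \<zeta>)) \<and> norm (poly A (\<psi> \<zeta>)) = s * norm \<zeta> ^ k \<and> \<psi> \<zeta> \<in> \<Omega> A s a \<and> \<phi> (\<psi> \<zeta>) = \<zeta>"
    if "r < norm \<zeta>" "norm \<zeta> < 1" for \<zeta>
  proof -
    have "\<psi> \<zeta> \<in> \<Omega> A s a" "\<phi> (\<psi> \<zeta>) = \<zeta>" using \<phi>(4) that by auto
    moreover from this have "norm (poly A (\<psi> \<zeta>)) = s * norm \<zeta> ^ k" using \<phi>(5) by (simp add: k_def)
    moreover have "s * r ^ k < s * norm \<zeta> ^ k"
      using that(1) r(1) \<open>s > 0\<close> \<open>k > 0\<close> by (intro mult_strict_left_mono power_strict_mono) auto
    ultimately show ?thesis using r(3) by simp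
  qed
  have Annr: "r < norm (\<phi> w) \<and> norm (\<phi> w) < 1" if "w \<in> \<Omega> A s a" "R < norm (poly A w)" for w
  proof -
    have "norm (\<phi> w) < 1" using \<phi>(3)[OF that(1)] by simp
    moreover have "s * r ^ k < s * norm (\<phi> w) ^ k" using \<phi>(5)[OF that(1)] that(2) r(3) by (simp add: k_def)
    then have "r < norm (\<phi> w)" using \<open>s > 0\<close> power_less_imp_less_base by force
    ultimately show ?thesis by simp
  qed
  have subball: "?Ann \<subseteq> ball 0 1" by auto
  have conAnn: "connected ?Ann"
    using connected_annulus(1)[of r "0::complex" 1] by (simp add: dist_norm)
  have hol\<psi>: "\<psi> holomorphic_on ?Ann" using \<phi>(2) subball by (rule holomorphic_on_subset)
  have im\<psi>: "\<psi> ` ?Ann \<subseteq> {w. R < norm (poly A w)}" using AnnA by blast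
  have holf: "(f \<circ> \<psi>) holomorphic_on ?Ann" by (rule holomorphic_on_compose_gen[OF hol\<psi> hol im\<psi>])
  let ?VB = "{w. norm (poly B w) < s}"
  have modf: "norm (poly B (f (\<psi> \<zeta>))) = s * norm \<zeta> ^ k" if "r < norm \<zeta>" "norm \<zeta> < 1" for \<zeta>
    using AnnA[OF that] AB by auto
  have imV: "(f \<circ> \<psi>) ` ?Ann \<subseteq> ?VB"
  proof clarsimp
    fix \<zeta> :: complex assume \<zeta>: "r < norm \<zeta>" "norm \<zeta> < 1"
    have "norm \<zeta> ^ k < 1" using \<zeta> \<open>k > 0\<close> by (simp add: power_less_one_iff)
    then show "norm (poly B (f (\<psi> \<zeta>))) < s" using modf[OF \<zeta>] \<open>s > 0\<close> by simp
  qed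
  \<comment> \<open>Any point of the annulus would do: the annulus is connected, so the image of one
    point selects the component for \<open>B\<close> that receives all of it.\<close>
  define \<zeta>0 :: complex where "\<zeta>0 = of_real ((r + 1) / 2)"
  have \<zeta>0: "r < norm \<zeta>0" "norm \<zeta>0 < 1" using r unfolding \<zeta>0_def norm_of_real by auto
  have "norm (poly B (f (\<psi> \<zeta>0))) < s" using imV \<zeta>0 by auto
  then obtain b where b: "poly B b = 0" "b \<in> connected_component_set ?VB (f (\<psi> \<zeta>0))"
    using component_poly_sublevel_has_root[OF degB] by blast
  have \<Omega>b: "connected_component_set ?VB (f (\<psi> \<zeta>0)) = \<Omega> B s b"
    unfolding \<Omega>_def using connected_component_eq[OF b(2)] by (rule sym)
  have imf: "(f \<circ> \<psi>) ` ?Ann \<subseteq> \<Omega> B s b"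
    unfolding \<Omega>b[symmetric]
  proof (rule connected_component_maximal[OF _ _ imV])
    show "f (\<psi> \<zeta>0) \<in> (f \<circ> \<psi>) ` ?Ann" using \<zeta>0 by auto
    show "connected ((f \<circ> \<psi>) ` ?Ann)"
      by (rule connected_continuous_image[OF holomorphic_on_imp_continuous_on[OF holf] conAnn])
  qed
  have "c = b" if "c \<in> \<Omega> B s b" "poly B c = 0" for c
    using sepB[OF b(1) that(2)] that(1) by (auto simp: \<Omega>_def)
  from component_poly_sublevel_uniformization[OF degB \<open>s > 0\<close> b(1) this[unfolded \<Omega>_def]]
  obtain \<phi>' \<psi>' where \<phi>': "\<phi>' holomorphic_on \<Omega> B s b" "\<psi>' holomorphic_on ball 0 1"
    "\<And>z. z \<in> \<Omega> B s b \<Longrightarrow> \<phi>' z \<in> ball 0 1 \<and> \<psi>' (\<phi>' z) = z"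
    "\<And>z. z \<in> ball 0 1 \<Longrightarrow> \<psi>' z \<in> \<Omega> B s b \<and> \<phi>' (\<psi>' z) = z"
    "\<And>z. z \<in> \<Omega> B s b \<Longrightarrow> norm (poly B z) = s * norm (\<phi>' z) ^ order b B"
    unfolding \<Omega>_def by blast
  define k' where "k' = order b B"
  have "k' > 0" using b(1) \<open>B \<noteq> 0\<close> order_root[of B b] by (simp add: k'_def)
  define g where "g = \<phi>' \<circ> (f \<circ> \<psi>)"
  have inB: "f (\<psi> \<zeta>) \<in> \<Omega> B s b" if "r < norm \<zeta>" "norm \<zeta> < 1" for \<zeta>
    using imf that by auto
  have gh: "g holomorphic_on ?Ann"
    unfolding g_def by (rule holomorphic_on_compose_gen[OF holf \<phi>'(1) imf])
  have gi: "inj_on g ?Ann"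
  proof (rule inj_onI)
    fix x y assume xy: "x \<in> ?Ann" "y \<in> ?Ann" "g x = g y"
    then have "\<psi>' (\<phi>' (f (\<psi> x))) = \<psi>' (\<phi>' (f (\<psi> y)))" by (simp add: g_def)
    moreover have "f (\<psi> x) \<in> \<Omega> B s b" "f (\<psi> y) \<in> \<Omega> B s b" using inB xy by blast+
    ultimately have "f (\<psi> x) = f (\<psi> y)" using \<phi>'(3) by simp
    moreover have "R < norm (poly A (\<psi> x))" "R < norm (poly A (\<psi> y))" using AnnA xy by blast+
    ultimately have "\<psi> x = \<psi> y" using inj unfolding inj_on_def mem_Collect_eq by blast
    then have "\<phi> (\<psi> x) = \<phi> (\<psi> y)" by simp
    moreover have "\<phi> (\<psi> x) = x" "\<phi> (\<psi> y) = y" using AnnA xy by blast+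
    ultimately show "x = y" by simp
  qed
  have gm: "norm (g \<zeta>) ^ k' = norm \<zeta> ^ k" if "r < norm \<zeta>" "norm \<zeta> < 1" for \<zeta>
    using \<phi>'(5)[OF inB[OF that]] modf[OF that] \<open>s > 0\<close> by (simp add: g_def k'_def)
  obtain \<kappa> where \<kappa>: "norm \<kappa> = 1" "\<And>\<zeta>. r < norm \<zeta> \<Longrightarrow> norm \<zeta> < 1 \<Longrightarrow> g \<zeta> = \<kappa> * \<zeta>"
    using injective_annulus_map_power_modulus[OF r(1,2) gh gi \<open>k > 0\<close> \<open>k' > 0\<close> gm] by blast
  show ?thesis
  proof (rule that)
    have h: "(\<lambda>w. \<kappa> * \<phi> w) holomorphic_on \<Omega> A s a" using \<phi>(1) by (intro holomorphic_intros)
    have "(\<lambda>w. \<kappa> * \<phi> w) ` \<Omega> A s a \<subseteq> ball 0 1" using \<phi>(3) \<kappa>(1) by (auto simp: norm_mult)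
    then have "(\<psi>' \<circ> (\<lambda>w. \<kappa> * \<phi> w)) holomorphic_on \<Omega> A s a"
      by (rule holomorphic_on_compose_gen[OF h \<phi>'(2)])
    then show "(\<lambda>w. \<psi>' (\<kappa> * \<phi> w)) holomorphic_on \<Omega> A s a" by (simp add: o_def)
    show "\<psi>' (\<kappa> * \<phi> w) = f w" if "w \<in> \<Omega> A s a" "R < norm (poly A w)" for w
    proof -
      have "\<kappa> * \<phi> w = g (\<phi> w)" using \<kappa>(2) Annr[OF that] by simp
      also have "\<dots> = \<phi>' (f w)" using \<phi>(3)[OF that(1)] by (simp add: g_def)
      finally have "\<psi>' (\<kappa> * \<phi> w) = \<psi>' (\<phi>' (f w))" by simp
      moreover have "f w \<in> \<Omega> B s b" using inB[of "\<phi> w"] Annr[OF that] \<phi>(3)[OF that(1)] by simp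
      ultimately show ?thesis using \<phi>'(3) by simp
    qed
  qed
qed

text \<open>Every component below level \<open>s\<close> contains exactly one root of
  \<open>A\<close>. The local extensions are therefore indexed by the roots, live on disjoint sets,
  and together with the exterior cover the plane.\<close>

theorem lemniscate_exterior_map_eq_ident:
  fixes A B :: "complex poly"
  assumes degA: "degree A > 0" and degB: "degree B > 0" and "0 < R"
    and sepA: "\<And>a b. poly A a = 0 \<Longrightarrow> poly A b = 0 \<Longrightarrow> a \<noteq> b \<Longrightarrow> \<not> connected_component {w. norm (poly A w) \<le> R} a b"
    and sepB: "\<And>a b. poly B a = 0 \<Longrightarrow> poly B b = 0 \<Longrightarrow> a \<noteq> b \<Longrightarrow> \<not> connected_component {w. norm (poly B w) \<le> R} a b"
    and hol: "f holomorphic_on {w. R < norm (poly A w)}" and inj: "inj_on f {w. R < norm (poly A w)}"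
    and AB: "\<And>w. R < norm (poly A w) \<Longrightarrow> norm (poly B (f w)) = norm (poly A w)"
    and lim: "((\<lambda>w. f w - w) \<longlongrightarrow> 0) at_infinity"
    and w: "R < norm (poly A w)"
  shows "f w = w"
proof -
  have "\<exists>s. s > R \<and> (\<forall>a b. poly A a = 0 \<longrightarrow> poly A b = 0 \<longrightarrow> a \<noteq> b \<longrightarrow> \<not> connected_component {w. norm (poly A w) < s} a b)
      \<and> (\<forall>a b. poly B a = 0 \<longrightarrow> poly B b = 0 \<longrightarrow> a \<noteq> b \<longrightarrow> \<not> connected_component {w. norm (poly B w) < s} a b)"
    using eventually_conj[OF eventually_at_right_less
      eventually_conj[OF eventually_separated_poly_sublevel[OF degA sepA] eventually_separated_poly_sublevel[OF degB sepB]]]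
    by (rule eventually_happens'[OF trivial_limit_at_right_real])
  then obtain s where s: "s > R"
    and sA: "\<And>a b. poly A a = 0 \<Longrightarrow> poly A b = 0 \<Longrightarrow> a \<noteq> b \<Longrightarrow> \<not> connected_component {w. norm (poly A w) < s} a b"
    and sB: "\<And>a b. poly B a = 0 \<Longrightarrow> poly B b = 0 \<Longrightarrow> a \<noteq> b \<Longrightarrow> \<not> connected_component {w. norm (poly B w) < s} a b"
    by blast
  let ?V = "{w. norm (poly A w) < s}"
  let ?\<Omega> = "connected_component_set ?V"
  have "\<exists>g. poly A a = 0 \<longrightarrow> g holomorphic_on ?\<Omega> a \<and> (\<forall>w\<in>?\<Omega> a. R < norm (poly A w) \<longrightarrow> g w = f w)" for a
  proof (cases "poly A a = 0")
    case True
    show ?thesis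
      by (rule component_poly_sublevel_extension[OF degA degB \<open>0 < R\<close> s sA sB hol inj AB True]) blast+
  qed simp
  then obtain G where G: "\<And>a. poly A a = 0 \<Longrightarrow> G a holomorphic_on ?\<Omega> a"
    "\<And>a w. poly A a = 0 \<Longrightarrow> w \<in> ?\<Omega> a \<Longrightarrow> R < norm (poly A w) \<Longrightarrow> G a w = f w"
    by metis
  have "\<exists>a. norm (poly A w) < s \<longrightarrow> poly A a = 0 \<and> w \<in> ?\<Omega> a" for w
    using component_poly_sublevel_has_root[OF degA, of w s] connected_component_sym by (metis mem_Collect_eq)
  \<comment> \<open>\<open>c w\<close> is the root in the component of \<open>w\<close>. By the
    separation it is constant on each component, which is what makes the glued function holomorphic
    there.\<close>
  then obtain c where c: "\<And>w. norm (poly A w) < s \<Longrightarrow> poly A (c w) = 0 \<and> w \<in> ?\<Omega> (c w)"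
    by metis
  have c_eq: "c w = a" if "poly A a = 0" "w \<in> ?\<Omega> a" for a w
  proof -
    have "norm (poly A w) < s" using that(2) connected_component_subset by blast
    note cw = c[OF this]
    have "connected_component ?V (c w) a"
      using cw that(2) connected_component_sym connected_component_trans by (metis mem_Collect_eq)
    then show ?thesis using sA cw that(1) by blast
  qed
  define F where "F w = (if R < norm (poly A w) then f w else G (c w) w)" for w
  have F1: "F holomorphic_on {w. R < norm (poly A w)}"
    using hol by (rule holomorphic_transform) (simp add: F_def)
  have F2: "F holomorphic_on ?\<Omega> a" if "poly A a = 0" for a
    using G(1)[OF that] by (rule holomorphic_transform) (simp add: F_def G(2)[OF that] c_eq[OF that])
  have "F holomorphic_on ({w. R < norm (poly A w)} \<union> (\<Union>a\<in>{a. poly A a = 0}. ?\<Omega> a))"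
    using F1 F2 by (intro holomorphic_on_Un holomorphic_on_UN_open)
      (auto intro!: open_connected_component open_Collect_less continuous_intros)
  moreover have "{w. R < norm (poly A w)} \<union> (\<Union>a\<in>{a. poly A a = 0}. ?\<Omega> a) = UNIV"
  proof (intro equalityI subset_UNIV subsetI)
    fix w
    show "w \<in> {w. R < norm (poly A w)} \<union> (\<Union>a\<in>{a. poly A a = 0}. ?\<Omega> a)"
      using c[of w] s by (cases "R < norm (poly A w)") auto
  qed
  ultimately have "(\<lambda>w. F w - w) holomorphic_on UNIV" by (auto intro!: holomorphic_intros)
  moreover have "((\<lambda>w. F w - w) \<longlongrightarrow> 0) at_infinity"
  proof (rule Lim_transform_eventually[OF lim])
    have "eventually (\<lambda>w. w \<notin> {w. norm (poly A w) \<le> R}) at_infinity"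
      using compact_imp_bounded[OF compact_poly_sublevel[OF degA, of R]]
      by (auto simp: eventually_at_infinity bounded_iff not_le) (metis less_add_one linorder_not_less order_trans less_eq_real_def)
    then show "\<forall>\<^sub>F w in at_infinity. f w - w = F w - w" by eventually_elim (simp add: F_def)
  qed
  ultimately have "F w - w = 0" by (rule Liouville_weak_0)
  then show ?thesis using w by (simp add: F_def)
qed

section \<open>Winding numbers of image curves\<close>

text \<open>\<open>\<gamma>\<close> is merely continuous. A nearby polynomial loop
  \<open>\<delta>\<close>, chosen independently of \<open>G\<close>, turns all winding numbers into
  integrals over one contour, so that linear relations between logarithmic derivatives can be
  integrated.\<close>

lemma winding_numbers_via_contour:
  assumes "open D" and \<gamma>: "path \<gamma>" "pathfinish \<gamma> = pathstart \<gamma>" "path_image \<gamma> \<subseteq> D"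
  obtains \<delta> where "valid_path \<delta>" "path_image \<delta> \<subseteq> D"
    "\<forall>G. G holomorphic_on D \<and> (\<forall>z\<in>D. G z \<noteq> 0) \<longrightarrow>
       winding_number (G \<circ> \<gamma>) 0 = 1 / (2 * pi * \<i>) * contour_integral \<delta> (\<lambda>z. deriv G z / G z)"
proof -
  obtain e where e: "0 < e \<and> (\<forall>h. path h \<and> pathfinish h = pathstart h \<and>
      (\<forall>t\<in>{0..1}. norm (h t - \<gamma> t) < e) \<longrightarrow> homotopic_loops D \<gamma> h)"
    using homotopic_nearby_loops[OF \<gamma>(1) \<open>open D\<close> \<gamma>(3,2)] by (rule exE)
  obtain \<delta> where \<delta>: "polynomial_function \<delta>" "pathstart \<delta> = pathstart \<gamma>" "pathfinish \<delta> = pathfinish \<gamma>"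
    "\<And>t. t \<in> {0..1} \<Longrightarrow> norm (\<delta> t - \<gamma> t) < e"
    by (rule path_approx_polynomial_function[OF \<gamma>(1) conjunct1[OF e]]) (rule that)
  have v\<delta>: "valid_path \<delta>" by (rule valid_path_polynomial_function[OF \<delta>(1)])
  have hom: "homotopic_loops D \<gamma> \<delta>"
    using e \<delta> \<gamma>(2) valid_path_imp_path[OF v\<delta>] by auto
  then have im: "path_image \<delta> \<subseteq> D" using homotopic_loops_imp_subset by blast
  show ?thesis
  proof (rule that[OF v\<delta> im], intro allI impI)
    fix G assume "G holomorphic_on D \<and> (\<forall>z\<in>D. G z \<noteq> 0)"
    then have G: "G holomorphic_on D" "\<And>z. z \<in> D \<Longrightarrow> G z \<noteq> 0" by auto
    have "homotopic_loops (- {0}) (G \<circ> \<gamma>) (G \<circ> \<delta>)"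
      by (rule homotopic_loops_continuous_image[OF hom holomorphic_on_imp_continuous_on[OF G(1)]]) (use G in auto)
    then have "winding_number (G \<circ> \<gamma>) 0 = winding_number (G \<circ> \<delta>) 0" by (rule winding_number_homotopic_loops)
    also have "\<dots> = 1 / (2 * pi * \<i>) * contour_integral (G \<circ> \<delta>) (\<lambda>w. 1 / (w - 0))"
    proof (rule winding_number_valid_path)
      show "valid_path (G \<circ> \<delta>)" by (rule valid_path_compose_holomorphic[OF v\<delta> G(1) \<open>open D\<close> im])
      show "0 \<notin> path_image (G \<circ> \<delta>)" using im G(2) by (fastforce simp: path_image_compose)
    qed
    also have "contour_integral (G \<circ> \<delta>) (\<lambda>w. 1 / (w - 0)) = contour_integral \<delta> (\<lambda>z. deriv G z / G z)"
      using contour_integral_comp_analyticW[OF _ v\<delta> im, of G "\<lambda>w. 1 / (w - 0)"] G(1) \<open>open D\<close>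
      by (simp add: analytic_on_open)
    finally show "winding_number (G \<circ> \<gamma>) 0 = 1 / (2 * pi * \<i>) * contour_integral \<delta> (\<lambda>z. deriv G z / G z)" .
  qed
qed

text \<open>On a disc the left side of \<open>const\<close> is the real part of \<open>H\<close>,
  the sum of the holomorphic logarithms with weights \<open>c i\<close>. A constant real part makes
  \<open>exp \<circ> H\<close> constant, so \<open>H\<close> has derivative 0. Local logarithms make
  real coefficients harmless.\<close>

lemma sum_logderiv_eq_0:
  fixes G :: "'i \<Rightarrow> complex \<Rightarrow> complex" and c :: "'i \<Rightarrow> real"
  assumes "open D" and hol: "\<And>i. i \<in> I \<Longrightarrow> G i holomorphic_on D"
    and nz: "\<And>i z. i \<in> I \<Longrightarrow> z \<in> D \<Longrightarrow> G i z \<noteq> 0"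
    and const: "\<And>z. z \<in> D \<Longrightarrow> (\<Sum>i\<in>I. c i * ln (norm (G i z))) = C" and "p \<in> D"
  shows "(\<Sum>i\<in>I. c i * (deriv (G i) p / G i p)) = 0"
proof -
  obtain r where r: "r > 0" "ball p r \<subseteq> D" using \<open>open D\<close> \<open>p \<in> D\<close> openE by blast
  have "\<exists>g. i \<in> I \<longrightarrow> g holomorphic_on ball p r \<and> (\<forall>z\<in>ball p r. exp (g z) = G i z)" for i
  proof (cases "i \<in> I")
    case True
    have "G i holomorphic_on ball p r" using hol[OF True] r(2) holomorphic_on_subset by blast
    moreover have "G i z \<noteq> 0" if "z \<in> ball p r" for z using nz[OF True] that r(2) by blast
    ultimately obtain g where "g holomorphic_on ball p r" "\<And>z. z \<in> ball p r \<Longrightarrow> exp (g z) = G i z"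
      using holomorphic_logarithm_exists[OF convex_ball open_ball, of "G i" p r p] r(1) by auto
    then show ?thesis by blast
  qed simp
  then obtain g where g: "\<And>i. i \<in> I \<Longrightarrow> g i holomorphic_on ball p r"
    "\<And>i z. i \<in> I \<Longrightarrow> z \<in> ball p r \<Longrightarrow> exp (g i z) = G i z" by metis
  define H where "H z = (\<Sum>i\<in>I. c i * g i z)" for z
  have holH: "H holomorphic_on ball p r" unfolding H_def using g(1) by (intro holomorphic_intros)
  have ReH: "Re (H z) = C" if "z \<in> ball p r" for z
  proof -
    have "Re (H z) = (\<Sum>i\<in>I. c i * Re (g i z))" by (simp add: H_def)
    also have "\<dots> = (\<Sum>i\<in>I. c i * ln (norm (G i z)))"
    proof (rule sum.cong)
      fix i assume "i \<in> I"
      then have "ln (norm (G i z)) = ln (norm (exp (g i z)))" using g(2) that by simp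
      then show "c i * Re (g i z) = c i * ln (norm (G i z))" by (simp add: norm_exp_eq_Re)
    qed simp
    finally show ?thesis using const that r(2) by auto
  qed
  have "(\<lambda>z. exp (H z)) constant_on ball p r"
    by (rule maximum_modulus_principle[where U = "ball p r" and \<xi> = p])
       (use holH r ReH in \<open>auto intro!: holomorphic_intros simp: norm_exp_eq_Re\<close>)
  then obtain k where k: "\<And>z. z \<in> ball p r \<Longrightarrow> exp (H z) = k" unfolding constant_on_def by blast
  have pb: "p \<in> ball p r" using r(1) by simp
  have dg: "(g i has_field_derivative deriv (G i) p / G i p) (at p)" if "i \<in> I" for i
  proof -
    have d: "(g i has_field_derivative deriv (g i) p) (at p)"
      using g(1)[OF that] pb by (simp add: holomorphic_derivI)
    then have "((\<lambda>z. exp (g i z)) has_field_derivative exp (g i p) * deriv (g i) p) (at p)"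
      by (auto intro!: derivative_eq_intros)
    then have "(G i has_field_derivative exp (g i p) * deriv (g i) p) (at p)"
      by (rule has_field_derivative_transform_within_open[OF _ open_ball pb]) (use g(2)[OF that] in auto)
    then have "deriv (G i) p = G i p * deriv (g i) p" using g(2)[OF that pb] by (simp add: DERIV_imp_deriv)
    then show ?thesis using d nz[OF that \<open>p \<in> D\<close>] by simp
  qed
  have dH: "(H has_field_derivative (\<Sum>i\<in>I. c i * (deriv (G i) p / G i p))) (at p)"
    unfolding H_def using dg by (intro DERIV_sum DERIV_cmult)
  then have "((\<lambda>z. exp (H z)) has_field_derivative exp (H p) * (\<Sum>i\<in>I. c i * (deriv (G i) p / G i p))) (at p)"
    by (auto intro!: derivative_eq_intros)
  moreover have "((\<lambda>z. exp (H z)) has_field_derivative 0) (at p)"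
    by (rule has_field_derivative_transform_within_open[OF DERIV_const[of k] open_ball pb]) (use k in auto)
  ultimately have "exp (H p) * (\<Sum>i\<in>I. c i * (deriv (G i) p / G i p)) = 0" by (rule DERIV_unique)
  then show ?thesis by simp
qed

text \<open>Takes the place of the argument principle for products with real exponents: the relation
  between logarithmic derivatives is integrated over the common contour.\<close>

lemma sum_winding_number_eq_0:
  fixes G :: "'i \<Rightarrow> complex \<Rightarrow> complex" and c :: "'i \<Rightarrow> real"
  assumes "finite I" "open D" and hol: "\<And>i. i \<in> I \<Longrightarrow> G i holomorphic_on D"
    and nz: "\<And>i z. i \<in> I \<Longrightarrow> z \<in> D \<Longrightarrow> G i z \<noteq> 0"
    and const: "\<And>z. z \<in> D \<Longrightarrow> (\<Sum>i\<in>I. c i * ln (norm (G i z))) = C"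
    and \<gamma>: "path \<gamma>" "pathfinish \<gamma> = pathstart \<gamma>" "path_image \<gamma> \<subseteq> D"
  shows "(\<Sum>i\<in>I. c i * winding_number (G i \<circ> \<gamma>) 0) = 0"
proof -
  obtain \<delta> where \<delta>: "valid_path \<delta>" "path_image \<delta> \<subseteq> D"
    "\<forall>G. G holomorphic_on D \<and> (\<forall>z\<in>D. G z \<noteq> 0) \<longrightarrow>
       winding_number (G \<circ> \<gamma>) 0 = 1 / (2 * pi * \<i>) * contour_integral \<delta> (\<lambda>z. deriv G z / G z)"
    by (rule winding_numbers_via_contour[OF \<open>open D\<close> \<gamma>]) (rule that)
  have int: "(\<lambda>z. deriv (G i) z / G i z) contour_integrable_on \<delta>" if "i \<in> I" for i
    using hol[OF that] nz[OF that] \<open>open D\<close>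
    by (intro contour_integrable_holomorphic_simple[OF _ \<open>open D\<close> \<delta>(1,2)] holomorphic_intros) auto
  have "(\<Sum>i\<in>I. c i * winding_number (G i \<circ> \<gamma>) 0) =
      1 / (2 * pi * \<i>) * (\<Sum>i\<in>I. c i * contour_integral \<delta> (\<lambda>z. deriv (G i) z / G i z))"
    unfolding sum_distrib_left by (rule sum.cong) (simp_all add: \<delta>(3) hol nz)
  also have "(\<Sum>i\<in>I. c i * contour_integral \<delta> (\<lambda>z. deriv (G i) z / G i z)) =
      contour_integral \<delta> (\<lambda>z. \<Sum>i\<in>I. c i * (deriv (G i) z / G i z))"
    by (subst contour_integral_sum[OF \<open>finite I\<close> contour_integrable_lmul[OF int]])
       (simp_all only: contour_integral_lmul[OF int] cong: sum.cong)
  also have "\<dots> = contour_integral \<delta> (\<lambda>z. 0)"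
    using sum_logderiv_eq_0[OF \<open>open D\<close> hol nz const] \<delta>(2) by (intro contour_integral_eq) blast
  finally show ?thesis by (simp add: o_def)
qed

text \<open>Only the diagonal is delicate. There the quotient is within \<open>e / 2\<close> of
  \<open>deriv \<Phi> p\<close> by the mean value inequality for
  \<open>\<Phi> u - deriv \<Phi> p * u\<close>, whose derivative is small near
  \<open>p\<close>.\<close>

lemma continuous_on_difference_quotient:
  assumes hol: "\<Phi> holomorphic_on D" and "open D"
  shows "continuous_on (D \<times> D) (\<lambda>(z, w). if z = w then deriv \<Phi> w else (\<Phi> z - \<Phi> w) / (z - w))"
proof (rule continuous_at_imp_continuous_on, clarify)
  fix p p' assume pD: "p \<in> D" "p' \<in> D"
  let ?q = "\<lambda>(z, w). if z = w then deriv \<Phi> w else (\<Phi> z - \<Phi> w) / (z - w)"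
  show "isCont ?q (p, p')"
  proof (cases "p = p'")
    case False
    let ?W = "{x. fst x \<noteq> snd x} \<inter> (D \<times> D)"
    have "open ?W" using \<open>open D\<close> by (intro open_Int open_Times open_Collect_neq continuous_intros)
    have "continuous_on ?W (\<lambda>x. (\<Phi> (fst x) - \<Phi> (snd x)) / (fst x - snd x))"
      by (intro continuous_intros continuous_on_compose2[OF holomorphic_on_imp_continuous_on[OF hol]]) auto
    then have "continuous_on ?W ?q" by (rule continuous_on_eq) auto
    then show ?thesis using \<open>open ?W\<close> False pD by (simp add: continuous_on_eq_continuous_at)
  next
    case True
    have "continuous_on D (deriv \<Phi>)"
      using holomorphic_deriv[OF hol \<open>open D\<close>] holomorphic_on_imp_continuous_on by blast
    then have cd: "isCont (deriv \<Phi>) p" using \<open>open D\<close> pD by (simp add: continuous_on_eq_continuous_at)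
    show ?thesis
      unfolding continuous_at_eps_delta
    proof (intro allI impI)
      fix e :: real assume "e > 0"
      then obtain d1 where d1: "d1 > 0" "\<And>z. dist z p < d1 \<Longrightarrow> dist (deriv \<Phi> z) (deriv \<Phi> p) < e / 2"
        using cd unfolding continuous_at_eps_delta by (metis half_gt_zero)
      obtain d2 where d2: "d2 > 0" "ball p d2 \<subseteq> D" using \<open>open D\<close> pD openE by blast
      define d where "d = min d1 d2"
      have d: "d > 0" "ball p d \<subseteq> D" "\<And>z. z \<in> ball p d \<Longrightarrow> norm (deriv \<Phi> z - deriv \<Phi> p) \<le> e / 2"
        using d1 d2 by (auto simp: d_def dist_commute dist_norm intro: less_imp_le)
      have "dist (?q x) (?q (p, p')) < e" if "dist x (p, p') < d" for x
      proof -
        obtain z w where x: "x = (z, w)" by fastforce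
        have zw: "z \<in> ball p d" "w \<in> ball p d"
          using that dist_fst_le[of x "(p, p')"] dist_snd_le[of x "(p, p')"] True by (auto simp: x dist_commute)
        have "norm (?q x - deriv \<Phi> p) \<le> e / 2"
        proof (cases "z = w")
          case True
          then show ?thesis using d(3)[OF zw(1)] by (simp add: x)
        next
          case False
          have "norm ((\<Phi> z - deriv \<Phi> p * z) - (\<Phi> w - deriv \<Phi> p * w)) \<le> e / 2 * norm (z - w)"
          proof (rule field_differentiable_bound[OF convex_ball _ _ zw])
            fix u assume u: "u \<in> ball p d"
            have "(\<Phi> has_field_derivative deriv \<Phi> u) (at u)"
              using hol \<open>open D\<close> d(2) u by (intro holomorphic_derivI[of _ D]) auto
            then have "((\<lambda>u. \<Phi> u - deriv \<Phi> p * u) has_field_derivative deriv \<Phi> u - deriv \<Phi> p) (at u)"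
              by (auto intro!: derivative_eq_intros)
            then show "((\<lambda>u. \<Phi> u - deriv \<Phi> p * u) has_field_derivative deriv \<Phi> u - deriv \<Phi> p) (at u within ball p d)"
              by (rule has_field_derivative_at_within)
            show "norm (deriv \<Phi> u - deriv \<Phi> p) \<le> e / 2" by (rule d(3)[OF u])
          qed
          moreover have "?q x - deriv \<Phi> p = ((\<Phi> z - deriv \<Phi> p * z) - (\<Phi> w - deriv \<Phi> p * w)) / (z - w)"
          proof -
            have eq: "(\<Phi> z - deriv \<Phi> p * z) - (\<Phi> w - deriv \<Phi> p * w) = (\<Phi> z - \<Phi> w) - deriv \<Phi> p * (z - w)"
              by (simp add: algebra_simps)
            show ?thesis unfolding eq using False by (simp add: x diff_divide_distrib)
          qed
          ultimately show ?thesis using False by (simp add: norm_divide divide_le_eq)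
        qed
        then show ?thesis using True \<open>e > 0\<close> by (simp add: dist_norm)
      qed
      then show "\<exists>d>0. \<forall>x'. dist x' (p, p') < d \<longrightarrow> dist (?q x') (?q (p, p')) < e" using d(1) by blast
    qed
  qed
qed

text \<open>
  The quotient \<open>(\<Phi> z - \<Phi> z\<^sub>0) / (z - z\<^sub>0)\<close> does not vanish, also on the diagonal; moving \<open>z\<^sub>0\<close> to
  infinity shows that it does not wind around \<open>0\<close> along \<open>\<gamma>\<close>.
\<close>

lemma winding_number_comp_near_identity:
  assumes D: "open D" "connected D" "bounded (- D)"
    and hol: "\<Phi> holomorphic_on D" and inj: "inj_on \<Phi> D"
    and lim: "((\<lambda>z. \<Phi> z - z) \<longlongrightarrow> 0) at_infinity"
    and \<gamma>: "path \<gamma>" "pathfinish \<gamma> = pathstart \<gamma>" "path_image \<gamma> \<subseteq> D"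
    and z0: "z0 \<in> D" "z0 \<notin> path_image \<gamma>"
  shows "winding_number (\<Phi> \<circ> \<gamma>) (\<Phi> z0) = winding_number \<gamma> z0"
proof -
  define q where "q = (\<lambda>(z, w). if z = w then deriv \<Phi> w else (\<Phi> z - \<Phi> w) / (z - w))"
  have contq: "continuous_on (D \<times> D) q"
    unfolding q_def by (rule continuous_on_difference_quotient[OF hol D(1)])
  have qnz: "q (z, w) \<noteq> 0" if "z \<in> D" "w \<in> D" for z w
    using holomorphic_injective_imp_regular[OF hol D(1) inj that(2)] inj_onD[OF inj _ that]
    by (auto simp: q_def)
  have qeq: "\<Phi> z - \<Phi> w = (z - w) * q (z, w)" for z w by (simp add: q_def)
  have cp: "compact (path_image \<gamma>)" by (rule compact_path_image[OF \<gamma>(1)])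
  have "continuous_on (path_image \<gamma>) (\<lambda>z. \<Phi> z - z)"
    using holomorphic_on_imp_continuous_on[OF hol] \<gamma>(3) by (intro continuous_intros) (auto intro: continuous_on_subset)
  then have "bounded ((\<lambda>z. \<Phi> z - z) ` path_image \<gamma>)"
    using cp by (intro compact_imp_bounded compact_continuous_image)
  then obtain M where M: "\<And>z. z \<in> path_image \<gamma> \<Longrightarrow> norm (\<Phi> z - z) \<le> M" by (auto simp: bounded_iff)
  obtain N where N: "\<And>z. z \<in> path_image \<gamma> \<Longrightarrow> norm z \<le> N"
    using compact_imp_bounded[OF cp] by (auto simp: bounded_iff)
  obtain B1 where B1: "\<And>z. B1 \<le> norm z \<Longrightarrow> norm (\<Phi> z - z) < 1"
    using lim[unfolded tendsto_iff, rule_format, of 1] by (auto simp: eventually_at_infinity dist_norm)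
  obtain B2 where B2: "\<And>z. z \<notin> D \<Longrightarrow> norm z \<le> B2" using D(3) by (auto simp: bounded_iff)
  \<comment> \<open>So far out that \<open>z1\<close> lies in \<open>D\<close>, that
    \<open>\<Phi> z1 - z1\<close> has norm below 1, and that every point of \<open>\<gamma>\<close>
    is farther than \<open>M + 1\<close> away. Then \<open>q (z, z1) - 1\<close> has norm below 1
    along \<open>\<gamma>\<close>.\<close>
  define z1 :: complex where "z1 = of_real (\<bar>M\<bar> + \<bar>N\<bar> + \<bar>B1\<bar> + \<bar>B2\<bar> + 2)"
  have nz1: "norm z1 = \<bar>M\<bar> + \<bar>N\<bar> + \<bar>B1\<bar> + \<bar>B2\<bar> + 2" unfolding z1_def norm_of_real by simp
  have z1D: "z1 \<in> D" using B2[of z1] nz1 by linarith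
  have q1: "q (z, z1) \<in> ball 1 1" if "z \<in> path_image \<gamma>" for z
  proof -
    have "norm z1 \<le> norm (z - z1) + norm z" using norm_triangle_sub[of z1 z] by (simp add: norm_minus_commute)
    then have far: "norm (z - z1) > M + 1" using N[OF that] nz1 by linarith
    moreover have "0 \<le> M" using M[OF that] norm_ge_zero order_trans by blast
    ultimately have ne: "z \<noteq> z1" by auto
    then have "q (z, z1) - 1 = ((\<Phi> z - z) - (\<Phi> z1 - z1)) / (z - z1)" by (simp add: q_def field_simps)
    moreover have "norm ((\<Phi> z - z) - (\<Phi> z1 - z1)) < norm (z - z1)"
      using M[OF that] B1[of z1] nz1 far norm_triangle_ineq4[of "\<Phi> z - z" "\<Phi> z1 - z1"] by linarith
    ultimately have "norm (q (z, z1) - 1) < 1" using ne by (simp add: norm_divide)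
    then show ?thesis by (simp add: dist_norm norm_minus_commute)
  qed
  obtain \<sigma> where \<sigma>: "path \<sigma>" "path_image \<sigma> \<subseteq> D" "pathstart \<sigma> = z0" "pathfinish \<sigma> = z1"
    using D z0(1) z1D connected_open_path_connected[OF D(1,2)] unfolding path_connected_def by blast
  have \<gamma>D: "\<gamma> t \<in> D" if "t \<in> {0..1}" for t using that \<gamma>(3) by (auto simp: path_image_def)
  have \<sigma>D: "\<sigma> t \<in> D" if "t \<in> {0..1}" for t using that \<sigma>(2) by (auto simp: path_image_def)
  \<comment> \<open>The second argument moves along \<open>\<sigma>\<close> from \<open>z0\<close>
    to \<open>z1\<close>. The path \<open>\<sigma>\<close> may cross \<open>\<gamma>\<close>, which
    is why the values of \<open>q\<close> on the diagonal matter.\<close>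
  have "homotopic_loops (- {0}) (\<lambda>t. q (\<gamma> t, z0)) (\<lambda>t. q (\<gamma> t, z1))"
    unfolding homotopic_loops
  proof (intro exI[of _ "\<lambda>x. q (\<gamma> (snd x), \<sigma> (fst x))"] conjI ballI)
    show "continuous_on ({0..1} \<times> {0..1}) (\<lambda>x. q (\<gamma> (snd x), \<sigma> (fst x)))"
    proof (rule continuous_on_compose2[OF contq])
      show "continuous_on ({0..1} \<times> {0..1}) (\<lambda>x. (\<gamma> (snd x), \<sigma> (fst x)))"
        by (intro continuous_on_Pair continuous_on_compose2[OF \<gamma>(1)[unfolded path_def]]
            continuous_on_compose2[OF \<sigma>(1)[unfolded path_def]] continuous_intros) auto
    qed (use \<gamma>D \<sigma>D in auto)
    show "(\<lambda>x. q (\<gamma> (snd x), \<sigma> (fst x))) \<in> {0..1} \<times> {0..1} \<rightarrow> - {0}" using qnz \<gamma>D \<sigma>D by auto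
    show "pathfinish ((\<lambda>x. q (\<gamma> (snd x), \<sigma> (fst x))) \<circ> Pair t) = pathstart ((\<lambda>x. q (\<gamma> (snd x), \<sigma> (fst x))) \<circ> Pair t)" for t
      using \<gamma>(2) by (simp add: pathfinish_def pathstart_def)
  qed (use \<sigma> in \<open>auto simp: pathstart_def pathfinish_def\<close>)
  then have hom: "winding_number (\<lambda>t. q (\<gamma> t, z0)) 0 = winding_number (\<lambda>t. q (\<gamma> t, z1)) 0"
    and pq: "path (\<lambda>t. q (\<gamma> t, z1))"
    using winding_number_homotopic_loops homotopic_loops_imp_path by blast+
  have "winding_number (\<lambda>t. q (\<gamma> t, z1)) 0 = 0"
    by (rule winding_number_zero_outside[OF pq convex_ball[of 1 1]])
       (use \<gamma>(2) q1 in \<open>auto simp: pathstart_def pathfinish_def path_image_def\<close>)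
  with hom have w0: "winding_number (\<lambda>t. q (\<gamma> t, z0)) 0 = 0" by simp
  \<comment> \<open>With the coefficients 1, -1, -1 these encode
    \<open>\<Phi> z - \<Phi> z0 = (z - z0) * q (z, z0)\<close> as a relation between logarithms of
    moduli.\<close>
  define G :: "nat \<Rightarrow> complex \<Rightarrow> complex" where
    "G i z = (if i = 0 then \<Phi> z - \<Phi> z0 else if i = 1 then z - z0 else q (z, z0))" for i z
  define c :: "nat \<Rightarrow> real" where "c i = (if i = 0 then 1 else - 1)" for i
  have "(\<Sum>i\<in>{0,1,2}. c i * winding_number (G i \<circ> \<gamma>) 0) = 0"
  proof (rule sum_winding_number_eq_0[where D = "D - {z0}" and C = 0])
    show "open (D - {z0})" using D(1) by (simp add: open_delete)
    have "(\<lambda>z. (\<Phi> z - \<Phi> z0) / (z - z0)) holomorphic_on D - {z0}"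
      using holomorphic_on_subset[OF hol, of "D - {z0}"] by (intro holomorphic_intros) auto
    then have "(\<lambda>z. q (z, z0)) holomorphic_on D - {z0}"
      by (rule holomorphic_transform) (simp add: q_def)
    then show "G i holomorphic_on D - {z0}" for i
      using holomorphic_on_subset[OF hol, of "D - {z0}"]
      by (cases "i = 0"; cases "i = 1") (auto simp: G_def[abs_def] intro!: holomorphic_intros)
    show "G i z \<noteq> 0" if "z \<in> D - {z0}" for i z
      using that qnz[of z z0] z0(1) inj_onD[OF inj, of z z0] by (auto simp: G_def)
    show "(\<Sum>i\<in>{0,1,2}. c i * ln (norm (G i z))) = 0" if "z \<in> D - {z0}" for z
      using that qnz[of z z0] z0(1) by (simp add: G_def c_def qeq norm_mult ln_mult)
  qed (use \<gamma> z0 in auto)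
  then have "winding_number (\<lambda>t. \<Phi> (\<gamma> t) - \<Phi> z0) 0 = winding_number (\<lambda>t. \<gamma> t - z0) 0"
    using w0 by (simp add: c_def G_def[abs_def] o_def)
  then show ?thesis
    using winding_number_offset[of "\<Phi> \<circ> \<gamma>" "\<Phi> z0"] winding_number_offset[of \<gamma> z0] by (simp add: o_def)
qed

section \<open>The Green function of the preimage of an interval\<close>

lemma closed_preimage_interval: "closed (preimage_interval P)"
proof -
  have "closed (complex_of_real ` {-1..1})"
    by (intro compact_imp_closed compact_continuous_image continuous_intros) auto
  then have "closed (poly P -` (complex_of_real ` {-1..1}))"
    by (rule continuous_closed_vimage) (intro continuous_intros)
  then show ?thesis by (simp add: preimage_interval_def vimage_def)
qed

lemma norm_le_1_preimage_interval: "z \<in> preimage_interval P \<Longrightarrow> norm (poly P z) \<le> 1"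
  by (auto simp: preimage_interval_def abs_le_iff)

lemma bounded_preimage_interval:
  assumes "degree P > 0"
  shows "bounded (preimage_interval P)"
proof -
  have "filterlim (\<lambda>z. norm (poly P z)) at_top at_infinity"
    using filterlim_poly_at_infinity[OF assms] by (simp add: filterlim_at_infinity_conv_norm_at_top)
  then have "\<forall>\<^sub>F z in at_infinity. 1 < norm (poly P z)" by (rule filterlim_at_top_dense[THEN iffD1, rule_format])
  then obtain b where b: "\<And>z. b \<le> norm z \<Longrightarrow> 1 < norm (poly P z)" unfolding eventually_at_infinity by blast
  have "norm z \<le> b" if "z \<in> preimage_interval P" for z
    using b[of z] norm_le_1_preimage_interval[OF that] by linarith
  then show ?thesis unfolding bounded_iff by blast
qed

text \<open>The interval is the degenerate ellipse with foci -1 and 1: equality in the triangle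
  inequality characterises the segment between the foci. In this form \<open>E\<close> can be
  compared with level sets of \<open>norm (J z)\<close>.\<close>

lemma mem_preimage_interval_iff:
  "z \<in> preimage_interval P \<longleftrightarrow> norm (poly P z - 1) + norm (poly P z + 1) \<le> 2"
proof
  assume "z \<in> preimage_interval P"
  then obtain x :: real where x: "-1 \<le> x" "x \<le> 1" "poly P z = of_real x" by (auto simp: preimage_interval_def)
  have "complex_of_real x - 1 = of_real (x - 1)" "complex_of_real x + 1 = of_real (x + 1)" by simp_all
  then have "norm (complex_of_real x - 1) = 1 - x" "norm (complex_of_real x + 1) = 1 + x"
    using x by (simp_all only: norm_of_real)
  then show "norm (poly P z - 1) + norm (poly P z + 1) \<le> 2" using x by simp
next
  assume le: "norm (poly P z - 1) + norm (poly P z + 1) \<le> 2"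
  define w where "w = poly P z"
  have "dist (-1) (1::complex) = dist (-1) w + dist w 1"
  proof (rule antisym)
    show "dist (-1) w + dist w 1 \<le> dist (-1) (1::complex)"
      using le norm_minus_commute[of "-1" w] by (simp add: dist_norm w_def)
  qed (rule dist_triangle)
  then have "between (-1, 1) w" by (simp add: between)
  then have "w \<in> closed_segment (-1) 1" by (simp add: between_mem_segment)
  then obtain u where u: "0 \<le> u" "u \<le> 1" "w = (1 - u) *\<^sub>R (-1) + u *\<^sub>R 1" by (auto simp: in_segment)
  then have "w = of_real (2 * u - 1)" by (simp add: scaleR_conv_of_real algebra_simps)
  moreover have "2 * u - 1 \<in> {-1..1}" using u by auto
  ultimately show "z \<in> preimage_interval P" unfolding preimage_interval_def w_def by blast
qed

text \<open>On the frontier of a bounded component of the complement \<open>P\<close> is real. The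
  maximum principle for \<open>exp (\<i> * P)\<close> and \<open>exp (- \<i> * P)\<close> makes
  \<open>P\<close> real on the component, so by the open mapping theorem it is constant
  there.\<close>

lemma connected_Compl_preimage_interval:
  assumes deg: "degree P > 0"
  shows "connected (- preimage_interval P)"
proof (rule ccontr)
  let ?E = "preimage_interval P"
  assume nc: "\<not> connected (- ?E)"
  have "bounded (- (- ?E))" using bounded_preimage_interval[OF deg] by simp
  from cobounded_has_bounded_component[OF this nc] obtain C where C: "C \<in> components (- ?E)" "bounded C"
    by auto
  have op: "open C" using C(1) closed_preimage_interval open_components by blast
  have con: "connected C" and ne: "C \<noteq> {}" using C(1) in_components_connected in_components_nonempty by auto
  have fr: "frontier C \<subseteq> ?E"
    using frontier_of_components_subset[OF C(1)] frontier_subset_closed[OF closed_preimage_interval]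
    by (auto simp: frontier_complement)
  have frI: "norm (exp (\<i> * poly P z)) = 1" "norm (exp (- \<i> * poly P z)) = 1" if "z \<in> frontier C" for z
    using fr that by (auto simp: preimage_interval_def norm_exp_eq_Re)
  have le: "norm (exp (\<i> * poly P z)) \<le> 1" if "z \<in> C" for z
    by (rule maximum_modulus_frontier[OF _ _ C(2) _ that])
       (use frI in \<open>auto intro!: holomorphic_intros continuous_intros\<close>)
  have ge: "norm (exp (- \<i> * poly P z)) \<le> 1" if "z \<in> C" for z
    by (rule maximum_modulus_frontier[OF _ _ C(2) _ that])
       (use frI in \<open>auto intro!: holomorphic_intros continuous_intros\<close>)
  have real: "Im (poly P z) = 0" if "z \<in> C" for z
    using le[OF that] ge[OF that] by (simp add: norm_exp_eq_Re)
  have "poly P constant_on C"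
  proof (rule ccontr)
    assume "\<not> ?thesis"
    then have "open (poly P ` C)"
      by (intro open_mapping_thm[OF _ op con op subset_refl]) (auto intro!: holomorphic_intros)
    moreover obtain z where "z \<in> C" using ne by blast
    ultimately obtain e where e: "e > 0" "ball (poly P z) e \<subseteq> poly P ` C"
      by (meson imageI openE)
    have "poly P z + \<i> * of_real (e / 2) \<in> ball (poly P z) e" using e(1) by (simp add: dist_norm norm_mult)
    then obtain y where y: "y \<in> C" "poly P y = poly P z + \<i> * of_real (e / 2)" using e(2) by fastforce
    then have "Im (poly P y) = e / 2" using real[OF \<open>z \<in> C\<close>] by simp
    then show False using real[OF y(1)] e(1) by simp
  qed
  then obtain k where k: "\<And>z. z \<in> C \<Longrightarrow> poly P z = k" unfolding constant_on_def by blast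
  have "C \<subseteq> {z. poly (P - [:k:]) z = 0}" using k by auto
  moreover have "P - [:k:] \<noteq> 0" using deg by auto
  then have "finite {z. poly (P - [:k:]) z = 0}" by (rule poly_roots_finite)
  ultimately have "finite C" by (rule finite_subset)
  then show False using op ne by (meson finite_imp_not_open)
qed

locale preimage_interval_branch =
  fixes P :: "complex poly" and S :: "complex \<Rightarrow> complex"
  assumes deg: "degree P > 0" and branch: "sqrt_branch P S"
begin

abbreviation "E \<equiv> preimage_interval P"

text \<open>The exterior inverse branch of the Joukowski map applied to \<open>P\<close>:
  \<open>J + 1 / J = 2 * P\<close> with \<open>norm (J z) > 1\<close>.\<close>

definition "J z = poly P z + S z"

lemma open_Compl_E: "open (- E)" using closed_preimage_interval by (simp add: open_Compl)

lemma holomorphic_J: "J holomorphic_on - E"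
  unfolding J_def[abs_def] using branch by (auto simp: sqrt_branch_def intro!: holomorphic_intros)

lemma J_times: "z \<notin> E \<Longrightarrow> J z * (poly P z - S z) = 1"
  using branch by (auto simp: sqrt_branch_def J_def algebra_simps power2_eq_square)

lemma J_nz: "z \<notin> E \<Longrightarrow> J z \<noteq> 0" using J_times by fastforce

lemma J_inverse: "z \<notin> E \<Longrightarrow> J z + inverse (J z) = 2 * poly P z"
  using J_times[of z] inverse_unique[of "J z" "poly P z - S z"] by (simp add: J_def)

text \<open>The Joukowski map sends circles around 0 to ellipses with foci -1 and 1. Algebraically,
  \<open>P - 1\<close> and \<open>P + 1\<close> are \<open>(J - 1)\<^sup>2 / (2 * J)\<close> and
  \<open>(J + 1)\<^sup>2 / (2 * J)\<close>, and the parallelogram law adds their norms.\<close>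

lemma norm_J_sum:
  assumes "z \<notin> E"
  shows "norm (J z) + 1 / norm (J z) = norm (poly P z - 1) + norm (poly P z + 1)"
proof -
  have nz: "J z \<noteq> 0" by (rule J_nz[OF assms])
  have P: "poly P z = (J z + inverse (J z)) / 2" using J_inverse[OF assms] by simp
  have "poly P z - 1 = (J z - 1)\<^sup>2 / (2 * J z)" "poly P z + 1 = (J z + 1)\<^sup>2 / (2 * J z)"
    unfolding P using nz by (simp_all add: field_simps power2_eq_square)
  then have "norm (poly P z - 1) + norm (poly P z + 1) = ((norm (J z - 1))\<^sup>2 + (norm (J z + 1))\<^sup>2) / (2 * norm (J z))"
    by (simp add: norm_divide norm_power norm_mult add_divide_distrib)
  also have "(norm (J z - 1))\<^sup>2 + (norm (J z + 1))\<^sup>2 = 2 * (norm (J z))\<^sup>2 + 2"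
    by (simp only: cmod_power2 minus_complex.simps plus_complex.simps one_complex.simps)
       (simp add: power2_eq_square algebra_simps)
  finally show ?thesis using nz by (simp add: field_simps power2_eq_square)
qed

lemma tendsto_J: "((\<lambda>z. J z / z ^ degree P) \<longlongrightarrow> 2 * lead_coeff P) at_infinity"
proof -
  have "((\<lambda>z. (1 + S z / poly P z) * (poly P z / z ^ degree P)) \<longlongrightarrow> (1 + 1) * lead_coeff P) at_infinity"
    using branch by (intro tendsto_intros poly_divide_tendsto_aux) (simp add: sqrt_branch_def)
  moreover have "\<forall>\<^sub>F z in at_infinity. (1 + S z / poly P z) * (poly P z / z ^ degree P) = J z / z ^ degree P"
  proof -
    have "\<forall>\<^sub>F z in at_infinity. poly P z \<noteq> 0"
      using filterlim_at_infinity_imp_eventually_ne[OF filterlim_poly_at_infinity[OF deg], of 0] .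
    then show ?thesis by eventually_elim (simp add: J_def add_divide_distrib distrib_right)
  qed
  ultimately show ?thesis using Lim_transform_eventually by fastforce
qed

text \<open>Norm 1 would give focal sum 2 and so a point of \<open>E\<close>. On the connected
  complement \<open>norm (J z)\<close> therefore stays on one side of 1, and it is large near
  infinity.\<close>

lemma norm_J_gt_1:
  assumes "z \<notin> E"
  shows "norm (J z) > 1"
proof -
  have ne: "norm (J w) \<noteq> 1" if "w \<notin> E" for w
    using norm_J_sum[OF that] that mem_preimage_interval_iff[of w P] by auto
  have "filterlim (\<lambda>z. J z / z ^ degree P * z ^ degree P) at_infinity at_infinity"
    using deg by (intro tendsto_mult_filterlim_at_infinity[OF tendsto_J] filterlim_power_at_infinity filterlim_ident) auto
  then have "filterlim J at_infinity at_infinity"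
  proof (rule filterlim_cong[OF refl refl, THEN iffD1, rotated])
    show "\<forall>\<^sub>F z in at_infinity. J z / z ^ degree P * z ^ degree P = J z"
      using eventually_not_equal_at_infinity[of 0] by eventually_elim simp
  qed
  then have "filterlim (\<lambda>z. norm (J z)) at_top at_infinity"
    by (simp add: filterlim_at_infinity_conv_norm_at_top)
  then have "\<forall>\<^sub>F z in at_infinity. 1 < norm (J z)" by (rule filterlim_at_top_dense[THEN iffD1, rule_format])
  then obtain b where b: "\<And>z. b \<le> norm z \<Longrightarrow> 1 < norm (J z)" unfolding eventually_at_infinity by blast
  obtain B where B: "\<And>z. z \<in> E \<Longrightarrow> norm z \<le> B" using bounded_preimage_interval[OF deg] by (auto simp: bounded_iff)
  define w :: complex where "w = of_real (\<bar>b\<bar> + \<bar>B\<bar> + 1)"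
  have nw: "norm w = \<bar>b\<bar> + \<bar>B\<bar> + 1" unfolding w_def norm_of_real by simp
  have w: "w \<notin> E" "1 < norm (J w)" using B[of w] b[of w] nw by linarith+
  have con: "connected ((\<lambda>z. norm (J z)) ` (- E))"
    by (intro connected_continuous_image connected_Compl_preimage_interval deg continuous_intros
        holomorphic_on_imp_continuous_on holomorphic_J)
  show ?thesis
  proof (rule ccontr)
    assume "\<not> ?thesis"
    then have "1 \<in> (\<lambda>z. norm (J z)) ` (- E)"
      using connectedD_interval[OF con, of "norm (J z)" "norm (J w)" 1] assms w by auto
    then show False using ne by auto
  qed
qed

text \<open>Differentiating \<open>J\<^sup>2 - 2 * P * J = -1\<close> gives
  \<open>S * J' = P' * J\<close>, and neither \<open>S\<close> nor \<open>J\<close> vanishes off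
  \<open>E\<close>.\<close>

lemma deriv_J_eq_0_iff:
  assumes "z \<notin> E"
  shows "deriv J z = 0 \<longleftrightarrow> poly (pderiv P) z = 0"
proof -
  have dJ: "(J has_field_derivative deriv J z) (at z)"
    using assms by (intro holomorphic_derivI[OF holomorphic_J open_Compl_E]) simp
  have "((\<lambda>w. J w * J w - 2 * poly P w * J w) has_field_derivative
      2 * J z * deriv J z - (2 * poly (pderiv P) z * J z + 2 * poly P z * deriv J z)) (at z)"
    by (rule derivative_eq_intros dJ poly_DERIV refl | simp)+
  moreover have "((\<lambda>w. J w * J w - 2 * poly P w * J w) has_field_derivative 0) (at z)"
  proof (rule has_field_derivative_transform_within_open[OF DERIV_const[of "-1"] open_Compl_E])
    show "- 1 = J w * J w - 2 * poly P w * J w" if "w \<in> - E" for w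
      using J_times[of w] that by (simp add: J_def algebra_simps)
  qed (use assms in simp)
  ultimately have "2 * J z * deriv J z - (2 * poly (pderiv P) z * J z + 2 * poly P z * deriv J z) = 0"
    by (rule DERIV_unique)
  then have "2 * (S z * deriv J z - poly (pderiv P) z * J z) = 0" by (simp add: J_def algebra_simps)
  then have "S z * deriv J z = poly (pderiv P) z * J z" by simp
  moreover have "S z \<noteq> 0"
  proof
    assume "S z = 0"
    then have "(poly P z)\<^sup>2 = 1" using branch assms by (auto simp: sqrt_branch_def)
    then have "poly P z = of_real 1 \<or> poly P z = of_real (- 1)" by (simp add: power2_eq_1_iff)
    then show False using assms by (force simp: preimage_interval_def)
  qed
  ultimately show ?thesis using J_nz[OF assms] by auto
qed

end

lemma holomorphic_inverse_exists:
  assumes "f holomorphic_on S" "open S" "inj_on f S"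
  shows "\<exists>g. g holomorphic_on f ` S \<and> (\<forall>z\<in>S. g (f z) = z)"
  by (rule holomorphic_has_inverse[OF assms]) blast

section \<open>Inversion: infinity as a finite point\<close>

lemma compact_inversion_image:
  fixes e :: complex
  assumes "closed C" "e \<notin> C"
  shows "compact {\<zeta>. \<zeta> = 0 \<or> e + 1 / \<zeta> \<in> C}"
proof -
  have "open (- C)" "e \<in> - C" using assms by auto
  then obtain r where r: "r > 0" "ball e r \<subseteq> - C" using openE by blast
  have "norm \<zeta> \<le> 1 / r" if "\<zeta> = 0 \<or> e + 1 / \<zeta> \<in> C" for \<zeta>
  proof (cases "\<zeta> = 0")
    case False
    then have "e + 1 / \<zeta> \<notin> ball e r" using that r(2) by auto
    then have "r \<le> 1 / norm \<zeta>" by (simp add: dist_norm norm_divide)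
    then show ?thesis using False r(1) by (simp add: field_simps)
  qed (use r in simp)
  then have "bounded {\<zeta>. \<zeta> = 0 \<or> e + 1 / \<zeta> \<in> C}" unfolding bounded_iff by blast
  moreover have "open ((- {0}) \<inter> (\<lambda>\<zeta>. e + 1 / \<zeta>) -` (- C))"
    using assms by (intro continuous_open_preimage continuous_intros) auto
  then have "closed (- ((- {0}) \<inter> (\<lambda>\<zeta>. e + 1 / \<zeta>) -` (- C)))" by (rule closed_Compl)
  moreover have "- ((- {0}) \<inter> (\<lambda>\<zeta>. e + 1 / \<zeta>) -` (- C)) = {\<zeta>. \<zeta> = 0 \<or> e + 1 / \<zeta> \<in> C}" by auto
  ultimately show ?thesis by (simp add: compact_eq_bounded_closed)
qed

text \<open>The disjunct \<open>\<zeta> = 0\<close> adds the point at infinity; without it,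
  \<open>1 / 0 = 0\<close> would make 0 stand for \<open>e\<close>. It is an interior point because
  \<open>K\<close> is bounded.\<close>

lemma open_inversion_image:
  fixes e :: complex
  assumes "compact K"
  shows "open {\<zeta>. \<zeta> = 0 \<or> e + 1 / \<zeta> \<notin> K}"
proof -
  obtain B where B: "\<And>z. z \<in> K \<Longrightarrow> norm z \<le> B" using compact_imp_bounded[OF assms] by (auto simp: bounded_iff)
  define r where "r = 1 / (\<bar>B\<bar> + norm e + 1)"
  have pos: "\<bar>B\<bar> + norm e + 1 > 0" by (smt (verit) norm_ge_zero)
  then have r: "r > 0" by (simp add: r_def)
  have "e + 1 / \<zeta> \<notin> K" if "\<zeta> \<noteq> 0" "norm \<zeta> < r" for \<zeta>
  proof
    assume "e + 1 / \<zeta> \<in> K"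
    then have "norm (e + 1 / \<zeta>) \<le> B" by (rule B)
    moreover have "norm (1 / \<zeta>) \<le> norm (e + 1 / \<zeta>) + norm e"
      using norm_triangle_ineq4[of "e + 1 / \<zeta>" e] by simp
    moreover have "norm (1 / \<zeta>) > \<bar>B\<bar> + norm e + 1"
      using that pos by (simp add: norm_divide r_def field_simps)
    ultimately show False by linarith
  qed
  then have "{\<zeta>. \<zeta> = 0 \<or> e + 1 / \<zeta> \<notin> K} = ((- {0}) \<inter> (\<lambda>\<zeta>. e + 1 / \<zeta>) -` (- K)) \<union> ball 0 r"
    using r by auto
  moreover have "open ((- {0}) \<inter> (\<lambda>\<zeta>. e + 1 / \<zeta>) -` (- K))"
    using compact_imp_closed[OF assms] by (intro continuous_open_preimage continuous_intros) auto
  ultimately show ?thesis by (metis open_Un open_ball)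
qed

text \<open>The finite part is a continuous image of the connected set \<open>- K\<close>, and the
  added point 0 lies in its closure.\<close>

lemma connected_inversion_image:
  fixes e :: complex
  assumes "compact K" "connected (- K)" "e \<in> K"
  shows "connected {\<zeta>. \<zeta> = 0 \<or> e + 1 / \<zeta> \<notin> K}" (is "connected ?D")
proof -
  let ?I = "(\<lambda>z. 1 / (z - e)) ` (- K)"
  have con: "connected ?I"
    using assms by (intro connected_continuous_image continuous_intros) auto
  have D: "?D = insert 0 ?I"
  proof (intro equalityI subsetI)
    fix \<zeta> assume \<zeta>: "\<zeta> \<in> ?D"
    show "\<zeta> \<in> insert 0 ?I"
    proof (cases "\<zeta> = 0")
      case False
      then have "\<zeta> = 1 / ((e + 1 / \<zeta>) - e)" "e + 1 / \<zeta> \<in> - K" using \<zeta> by auto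
      then show ?thesis by blast
    qed simp
  qed (use assms(3) in auto)
  have "?D \<subseteq> closure ?I"
  proof
    fix \<zeta> assume \<zeta>: "\<zeta> \<in> ?D"
    have op: "open ?D" by (rule open_inversion_image[OF assms(1)])
    show "\<zeta> \<in> closure ?I"
      unfolding closure_approachable
    proof (intro allI impI)
      fix d :: real assume "d > 0"
      obtain r where r: "r > 0" "ball \<zeta> r \<subseteq> ?D" using op \<zeta> openE by blast
      define \<eta> where "\<eta> = (if \<zeta> = 0 then complex_of_real (min r d / 2) else \<zeta>)"
      have "0 < min r d" using r(1) \<open>d > 0\<close> by simp
      then have "norm (\<eta> - \<zeta>) < min r d" by (auto simp: \<eta>_def norm_of_real simp del: of_real_divide min_less_iff_conj)
      then have "\<eta> \<in> ?D" "dist \<eta> \<zeta> < d" using r(2) by (auto simp: dist_norm norm_minus_commute subset_iff)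
      moreover have "\<eta> \<noteq> 0" using r(1) \<open>d > 0\<close> by (simp add: \<eta>_def min_def)
      ultimately show "\<exists>y\<in>?I. dist y \<zeta> < d" using D by blast
    qed
  qed
  then show ?thesis by (intro connected_intermediate_closure[OF con]) (use D in auto)
qed

text \<open>The factor \<open>\<zeta> ^ k\<close> cancels growth of order \<open>k\<close> at
  infinity, so 0 is a removable singularity with value \<open>L\<close>.\<close>

lemma holomorphic_inversion:
  fixes e :: complex
  assumes "compact K" and F: "F holomorphic_on - K" and lim: "((\<lambda>z. F z / z ^ k) \<longlongrightarrow> L) at_infinity"
  shows "(\<lambda>\<zeta>. if \<zeta> = 0 then L else F (e + 1 / \<zeta>) * \<zeta> ^ k) holomorphic_on {\<zeta>. \<zeta> = 0 \<or> e + 1 / \<zeta> \<notin> K}"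
    (is "?G holomorphic_on ?D")
proof (rule no_isolated_singularity[where K = "{0}"])
  have op: "open ?D" by (rule open_inversion_image[OF assms(1)])
  have "(\<lambda>\<zeta>. F (e + 1 / \<zeta>)) holomorphic_on (?D - {0})"
    by (rule holomorphic_on_compose_gen[OF _ F, unfolded o_def]) (auto intro!: holomorphic_intros)
  then have "(\<lambda>\<zeta>. F (e + 1 / \<zeta>) * \<zeta> ^ k) holomorphic_on (?D - {0})" by (intro holomorphic_intros)
  then show hol: "?G holomorphic_on (?D - {0})" by (rule holomorphic_transform) simp
  have inf: "filterlim (\<lambda>\<zeta>. e + 1 / \<zeta>) at_infinity (at (0::complex))"
  proof -
    have "(\<lambda>\<zeta>. 1 / \<zeta>) = (inverse :: complex \<Rightarrow> complex)" by (simp add: fun_eq_iff inverse_eq_divide)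
    then have "filterlim (\<lambda>\<zeta>. 1 / \<zeta>) at_infinity (at (0::complex))"
      using filterlim_inverse_at_infinity by metis
    then show ?thesis by (intro tendsto_add_filterlim_at_infinity[OF tendsto_const])
  qed
  \<comment> \<open>Since \<open>e * \<zeta> + 1 = (e + 1 / \<zeta>) * \<zeta>\<close>, this is
    \<open>F (e + 1 / \<zeta>) * \<zeta> ^ k\<close>; the off-centre inversion contributes only a
    factor tending to 1.\<close>
  have "((\<lambda>\<zeta>. F (e + 1 / \<zeta>) / (e + 1 / \<zeta>) ^ k * (e * \<zeta> + 1) ^ k) \<longlongrightarrow> L * (e * 0 + 1) ^ k) (at 0)"
    by (intro tendsto_intros filterlim_compose[OF lim inf])
  moreover have "\<forall>\<^sub>F \<zeta> in at 0. F (e + 1 / \<zeta>) / (e + 1 / \<zeta>) ^ k * (e * \<zeta> + 1) ^ k = ?G \<zeta>"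
    using filterlim_at_infinity_imp_eventually_ne[OF inf, of 0] eventually_neq_at_within[of 0]
  proof eventually_elim
    case (elim \<zeta>)
    have "e * \<zeta> + 1 = (e + 1 / \<zeta>) * \<zeta>" using elim by (simp add: field_simps)
    then show ?case using elim by (simp add: power_mult_distrib)
  qed
  ultimately have "(?G \<longlongrightarrow> ?G 0) (at 0)" using Lim_transform_eventually by fastforce
  then have c0: "isCont ?G 0" by (simp add: isCont_def)
  have c1: "\<forall>\<zeta>\<in>?D - {0}. isCont ?G \<zeta>"
    using holomorphic_on_imp_continuous_on[OF hol] continuous_on_eq_continuous_at[OF open_delete[OF op]] by blast
  show "continuous_on ?D ?G"
  proof (intro continuous_at_imp_continuous_on ballI)
    fix \<zeta> assume "\<zeta> \<in> ?D"
    then show "isCont ?G \<zeta>" using c0 c1 by (cases "\<zeta> = 0") blast+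
  qed
qed (use open_inversion_image[OF assms(1)] in auto)

lemma add_inverse_mono:
  fixes a x :: real
  assumes "1 \<le> a" "a \<le> x"
  shows "a + 1 / a \<le> x + 1 / x"
proof -
  have "1 * 1 \<le> x * a" using assms by (intro mult_mono) auto
  then have "0 \<le> (x - a) * (x * a - 1) / (x * a)" using assms by simp
  also have "\<dots> = (x + 1 / x) - (a + 1 / a)" using assms by (simp add: field_simps)
  finally show ?thesis by simp
qed

lemma lemniscate_norm_gt:
  assumes "w \<notin> lemniscate l a m c"
  shows "(\<Prod>j=1..l. norm (w - a j) powr m j) > c"
  using assms by (simp add: lemniscate_def)

lemma continuous_on_prod_norm_powr:
  assumes "\<And>j. j \<in> {1..l} \<Longrightarrow> m j > 0"
  shows "continuous_on X (\<lambda>w. \<Prod>j=1..l. norm (w - a j :: complex) powr m j)"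
  using assms by (intro continuous_on_prod continuous_on_powr' continuous_intros) (auto intro: less_imp_le)

context preimage_interval_branch
begin

lemma compact_E: "compact E"
  using closed_preimage_interval bounded_preimage_interval[OF deg] by (simp add: compact_eq_bounded_closed)

lemma E_nonempty: "\<exists>e. e \<in> E"
proof -
  obtain z where "poly P z = 0" using component_poly_sublevel_has_root[OF deg, of 0 "norm (poly P 0) + 1"] by auto
  then show ?thesis unfolding preimage_interval_def by (intro exI[of _ z]) (auto intro!: image_eqI[of _ _ 0])
qed

text \<open>The function \<open>h\<close>, which is
  \<open>ln (norm (J z)) - n * ln (U (\<Phi> z))\<close> in the inverted coordinate, is harmonic
  also at infinity. Near the boundary it is bounded below because \<open>ln (norm (J z)) > 0\<close>
  and \<open>U (\<Phi> z)\<close> approaches \<open>c\<close>, and above because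
  \<open>norm (J z)\<close> approaches 1 and \<open>U (\<Phi> z) > c\<close>. Both bounds are
  \<open>- n * ln c\<close>, so \<open>h\<close> is constant.\<close>

theorem norm_J_eq_lemniscate:
  assumes hol: "\<Phi> holomorphic_on - E" and bij: "bij_betw \<Phi> (- E) (- lemniscate l a m c)"
    and m: "\<And>j. j \<in> {1..l} \<Longrightarrow> m j > 0" "(\<Sum>j=1..l. m j) = 1" and "c \<ge> 0"
    and lim: "((\<lambda>z. \<Phi> z - z) \<longlongrightarrow> 0) at_infinity"
  shows "c > 0"
    and "\<And>z. z \<notin> E \<Longrightarrow> norm (J z) = 2 * norm (lead_coeff P) * (\<Prod>j=1..l. norm (\<Phi> z - a j) powr m j) ^ degree P"
proof -
  define n where "n = degree P"
  define U where "U w = (\<Prod>j=1..l. norm (w - a j) powr m j)" for w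
  have "n > 0" using deg by (simp add: n_def)
  have Ugt: "U (\<Phi> z) > c" if "z \<notin> E" for z
    using lemniscate_norm_gt[of "\<Phi> z" l a m c] bij_betwE[OF bij] that unfolding U_def by blast
  have contU: "continuous_on X U" for X unfolding U_def[abs_def] by (rule continuous_on_prod_norm_powr[OF m(1)])
  have Ua: "U (a j) = 0" if "j \<in> {1..l}" for j
    unfolding U_def by (rule prod_zero) (use that in auto)
  have \<Phi>a: "\<Phi> z \<noteq> a j" if "z \<notin> E" "j \<in> {1..l}" for z j
    using Ugt[OF that(1)] Ua[OF that(2)] \<open>c \<ge> 0\<close> by auto
  have lnU: "ln (U (\<Phi> z)) = (\<Sum>j=1..l. m j * ln (norm (\<Phi> z - a j)))" if "z \<notin> E" for z
    unfolding U_def using \<Phi>a[OF that] by (subst ln_prod) (auto simp: ln_powr)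
  have "l \<ge> 1" using m(2) by (cases "l = 0") auto
  then have 1: "1 \<in> {1..l}" by simp
  obtain e where "e \<in> E" using E_nonempty by blast
  let ?D = "{\<zeta>. \<zeta> = 0 \<or> e + 1 / \<zeta> \<notin> E}"
  have opD: "open ?D" by (rule open_inversion_image[OF compact_E])
  have conD: "connected ?D"
    by (rule connected_inversion_image[OF compact_E connected_Compl_preimage_interval[OF deg] \<open>e \<in> E\<close>])
  define G0 where "G0 \<zeta> = (if \<zeta> = 0 then 2 * lead_coeff P else J (e + 1 / \<zeta>) * \<zeta> ^ n)" for \<zeta>
  define G where "G j \<zeta> = (if \<zeta> = 0 then 1 else (\<Phi> (e + 1 / \<zeta>) - a j) * \<zeta> ^ 1)" for j \<zeta>
  have holG0: "G0 holomorphic_on ?D"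
    unfolding G0_def n_def by (rule holomorphic_inversion[OF compact_E holomorphic_J tendsto_J])
  have holG: "G j holomorphic_on ?D" for j
    unfolding G_def
  proof (rule holomorphic_inversion[OF compact_E])
    show "(\<lambda>z. \<Phi> z - a j) holomorphic_on - E" using hol by (intro holomorphic_intros)
    have "((\<lambda>z. (\<Phi> z - z) * inverse z + 1 - a j * inverse z) \<longlongrightarrow> 0 * 0 + 1 - a j * 0) at_infinity"
      by (intro tendsto_intros lim tendsto_inverse_0)
    moreover have "\<forall>\<^sub>F z in at_infinity. (\<Phi> z - z) * inverse z + 1 - a j * inverse z = (\<Phi> z - a j) / z ^ 1"
      using eventually_not_equal_at_infinity[of 0] by eventually_elim (simp add: field_simps)
    ultimately show "((\<lambda>z. (\<Phi> z - a j) / z ^ 1) \<longlongrightarrow> 1) at_infinity" using Lim_transform_eventually by fastforce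
  qed
  have lc: "lead_coeff P \<noteq> 0" using deg by auto
  have nzG0: "G0 \<zeta> \<noteq> 0" if "\<zeta> \<in> ?D" for \<zeta> using that J_nz lc by (auto simp: G0_def)
  have nzG: "G j \<zeta> \<noteq> 0" if "\<zeta> \<in> ?D" "j \<in> {1..l}" for j \<zeta> using that \<Phi>a by (auto simp: G_def)
  \<comment> \<open>The powers of \<open>\<zeta>\<close> inside \<open>G0\<close> and the
    \<open>G j\<close> cancel because the exponents sum to 1.\<close>
  define h where "h \<zeta> = ln (norm (G0 \<zeta>)) + (\<Sum>j=1..l. (- (n * m j)) * ln (norm (G j \<zeta>)))" for \<zeta>
  have hh: "locally_Re_holomorphic h ?D"
    unfolding h_def[abs_def]
    by (intro locally_Re_holomorphic_add locally_Re_holomorphic_sum locally_Re_holomorphic_cmult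
        locally_Re_holomorphic_ln_norm opD holG0 holG nzG0 nzG) auto
  have h_eq: "h \<zeta> = ln (norm (J (e + 1 / \<zeta>))) - n * ln (U (\<Phi> (e + 1 / \<zeta>)))" if "\<zeta> \<noteq> 0" "\<zeta> \<in> ?D" for \<zeta>
  proof -
    let ?z = "e + 1 / \<zeta>"
    have z: "?z \<notin> E" using that by simp
    have "ln (norm (G0 \<zeta>)) = ln (norm (J ?z)) + n * ln (norm \<zeta>)"
      using that J_nz[OF z] by (simp add: G0_def norm_mult norm_power ln_mult ln_realpow)
    moreover have "ln (norm (G j \<zeta>)) = ln (norm (\<Phi> ?z - a j)) + ln (norm \<zeta>)" if "j \<in> {1..l}" for j
      using \<open>\<zeta> \<noteq> 0\<close> \<Phi>a[OF z that] by (simp add: G_def norm_mult ln_mult)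
    then have "(\<Sum>j=1..l. (- (n * m j)) * ln (norm (G j \<zeta>))) =
        (\<Sum>j=1..l. (- n) * (m j * ln (norm (\<Phi> ?z - a j))) + (- (n * ln (norm \<zeta>))) * m j)"
      by (intro sum.cong refl) (simp add: algebra_simps)
    moreover have "\<dots> = - n * ln (U (\<Phi> ?z)) - n * ln (norm \<zeta>)"
      by (simp only: sum.distrib sum_distrib_left[symmetric] lnU[OF z] m(2) mult_1_right)
    ultimately show ?thesis by (simp add: h_def)
  qed
  have h0: "h 0 = ln (2 * norm (lead_coeff P))" by (simp add: h_def G0_def G_def norm_mult)
  have inj: "inj_on \<Phi> (- E)" using bij by (simp add: bij_betw_def)
  have lower: "\<exists>K. compact K \<and> K \<subseteq> ?D \<and> (\<forall>\<zeta>\<in>?D - K. h \<zeta> > - n * ln t)" if "t > c" for t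
  proof -
    \<comment> \<open>This is \<open>\<Phi>\<close> with both sides inverted, around
      \<open>e\<close> in the domain and around \<open>a 1\<close> in the image, where
      \<open>U\<close> vanishes. The set \<open>U w \<ge> t\<close> together with infinity is
      compact in the image coordinate, and the inverse of \<open>\<Phi>'\<close> carries it back to
      a compact subset of the domain.\<close>
    define \<Phi>' where "\<Phi>' \<zeta> = \<zeta> / G 1 \<zeta>" for \<zeta>
    have \<Phi>'0: "\<Phi>' 0 = 0" by (simp add: \<Phi>'_def)
    have \<Phi>'eq: "a 1 + 1 / \<Phi>' \<zeta> = \<Phi> (e + 1 / \<zeta>)" "\<Phi>' \<zeta> \<noteq> 0" if "\<zeta> \<noteq> 0" "\<zeta> \<in> ?D" for \<zeta>
      using that \<Phi>a[of "e + 1 / \<zeta>" 1] 1 by (auto simp: \<Phi>'_def G_def)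
    have hol': "\<Phi>' holomorphic_on ?D" unfolding \<Phi>'_def using holG nzG 1 by (intro holomorphic_intros) auto
    have inj': "inj_on \<Phi>' ?D"
    proof (rule inj_onI)
      fix x y assume xy: "x \<in> ?D" "y \<in> ?D" "\<Phi>' x = \<Phi>' y"
      show "x = y"
      proof (cases "x = 0 \<or> y = 0")
        case True
        then show ?thesis using xy \<Phi>'0 \<Phi>'eq(2)[of x] \<Phi>'eq(2)[of y] by metis
      next
        case False
        then have "\<Phi> (e + 1 / x) = \<Phi> (e + 1 / y)"
          using \<Phi>'eq(1)[OF _ xy(1)] \<Phi>'eq(1)[OF _ xy(2)] xy(3) by simp
        moreover have "e + 1 / x \<in> - E" "e + 1 / y \<in> - E" using xy False by auto
        ultimately have "e + 1 / x = e + 1 / y" by (rule inj_onD[OF inj])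
        then show ?thesis by simp
      qed
    qed
    obtain g where g: "g holomorphic_on (\<Phi>' ` ?D)" "\<forall>\<zeta>\<in>?D. g (\<Phi>' \<zeta>) = \<zeta>"
      using holomorphic_inverse_exists[OF hol' opD inj'] by (elim exE conjE)
    let ?C = "{w. t \<le> U w}"
    have clC: "closed ?C" using contU[of UNIV] by (intro closed_Collect_le continuous_intros)
    have "a 1 \<notin> ?C" using Ua[OF 1] that \<open>c \<ge> 0\<close> by auto
    then have K': "compact {\<eta>. \<eta> = 0 \<or> a 1 + 1 / \<eta> \<in> ?C}" (is "compact ?K'") by (rule compact_inversion_image[OF clC])
    have K'D: "?K' \<subseteq> \<Phi>' ` ?D"
    proof
      fix \<eta> assume \<eta>: "\<eta> \<in> ?K'"
      show "\<eta> \<in> \<Phi>' ` ?D"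
      proof (cases "\<eta> = 0")
        case True
        then show ?thesis using \<Phi>'0 by (intro image_eqI[of _ _ 0]) auto
      next
        case False
        then have "c < U (a 1 + 1 / \<eta>)" using \<eta> that by auto
        then have "a 1 + 1 / \<eta> \<in> - lemniscate l a m c" by (simp add: lemniscate_def U_def)
        then obtain z where z: "z \<in> - E" "\<Phi> z = a 1 + 1 / \<eta>"
          using bij unfolding bij_betw_def by (metis imageE)
        define \<zeta> where "\<zeta> = 1 / (z - e)"
        have "z \<noteq> e" using z(1) \<open>e \<in> E\<close> by auto
        then have \<zeta>: "\<zeta> \<noteq> 0" "e + 1 / \<zeta> = z" by (auto simp: \<zeta>_def)
        then have "\<zeta> \<in> ?D" using z(1) by simp
        then have "a 1 + 1 / \<Phi>' \<zeta> = a 1 + 1 / \<eta>" using \<Phi>'eq(1)[of \<zeta>] \<zeta> z(2) by simp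
        then have "\<Phi>' \<zeta> = \<eta>" by simp
        then show ?thesis using \<open>\<zeta> \<in> ?D\<close> by blast
      qed
    qed
    have "compact (g ` ?K')"
      by (rule compact_continuous_image[OF continuous_on_subset[OF holomorphic_on_imp_continuous_on[OF g(1)] K'D] K'])
    moreover have "g ` ?K' \<subseteq> ?D"
    proof
      fix x assume "x \<in> g ` ?K'"
      then obtain \<eta> where \<eta>: "x = g \<eta>" "\<eta> \<in> ?K'" by (rule imageE)
      obtain \<zeta> where "\<eta> = \<Phi>' \<zeta>" "\<zeta> \<in> ?D" using subsetD[OF K'D \<eta>(2)] by (rule imageE)
      have "x = \<zeta>" using bspec[OF g(2) \<open>\<zeta> \<in> ?D\<close>] \<eta>(1) \<open>\<eta> = \<Phi>' \<zeta>\<close> by (simp only:)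
      then show "x \<in> ?D" using \<open>\<zeta> \<in> ?D\<close> by (simp only:)
    qed
    moreover have "h \<zeta> > - n * ln t" if \<zeta>: "\<zeta> \<in> ?D - g ` ?K'" for \<zeta>
    proof -
      have "\<zeta> = g (\<Phi>' \<zeta>)" using bspec[OF g(2) DiffD1[OF \<zeta>]] by (rule sym)
      have nK: "\<Phi>' \<zeta> \<notin> ?K'"
      proof
        assume "\<Phi>' \<zeta> \<in> ?K'"
        with \<open>\<zeta> = g (\<Phi>' \<zeta>)\<close> have "\<zeta> \<in> g ` ?K'" by (rule image_eqI)
        then show False by (rule DiffD2[OF \<zeta>])
      qed
      then have "\<zeta> \<noteq> 0" using \<Phi>'0 by auto
      then have "U (\<Phi> (e + 1 / \<zeta>)) < t" using nK \<Phi>'eq(1)[of \<zeta>] \<zeta> by auto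
      moreover have z: "e + 1 / \<zeta> \<notin> E" using \<zeta> \<open>\<zeta> \<noteq> 0\<close> by auto
      then have "U (\<Phi> (e + 1 / \<zeta>)) > 0" using Ugt[OF z] \<open>c \<ge> 0\<close> by linarith
      ultimately have "n * ln (U (\<Phi> (e + 1 / \<zeta>))) < n * ln t" using \<open>n > 0\<close> by simp
      moreover have "ln (norm (J (e + 1 / \<zeta>))) > 0" using norm_J_gt_1[OF z] by (rule ln_gt_zero)
      ultimately show ?thesis using h_eq[of \<zeta>] \<zeta> \<open>\<zeta> \<noteq> 0\<close> by simp
    qed
    ultimately show ?thesis by blast
  qed
  show "c > 0"
  proof (rule ccontr)
    assume "\<not> c > 0"
    then have "c = 0" using \<open>c \<ge> 0\<close> by simp
    have "h 0 + 1 \<le> h 0"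
    proof (rule locally_Re_holomorphic_lower_bound[OF hh opD conD])
      fix \<epsilon> :: real assume "\<epsilon> > 0"
      \<comment> \<open>For \<open>c = 0\<close> every positive \<open>t\<close> is admissible in
        \<open>lower\<close>, so \<open>h\<close> would have arbitrarily large lower bounds; this
        \<open>t\<close> gives the bound \<open>h 0 + 1\<close>.\<close>
      define t where "t = exp (- (h 0 + 1) / n)"
      have "- n * ln t = h 0 + 1" using \<open>n > 0\<close> by (simp add: t_def)
      moreover have "t > c" using \<open>c = 0\<close> by (simp add: t_def)
      ultimately show "\<exists>K. compact K \<and> K \<subseteq> ?D \<and> (\<forall>\<zeta>\<in>?D - K. h 0 + 1 - \<epsilon> < h \<zeta>)"
        using lower[of t] \<open>\<epsilon> > 0\<close> by (smt (verit))
    qed simp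
    then show False by simp
  qed
  have ge: "- n * ln c \<le> h \<zeta>" if "\<zeta> \<in> ?D" for \<zeta>
  proof (rule locally_Re_holomorphic_lower_bound[OF hh opD conD _ that])
    fix \<epsilon> :: real assume "\<epsilon> > 0"
    define t where "t = c * exp (\<epsilon> / n)"
    have "- n * ln t = - n * ln c - \<epsilon>" using \<open>n > 0\<close> \<open>c > 0\<close> by (simp add: t_def ln_mult field_simps)
    moreover have "t > c" using \<open>c > 0\<close> \<open>\<epsilon> > 0\<close> \<open>n > 0\<close> by (simp add: t_def)
    ultimately show "\<exists>K. compact K \<and> K \<subseteq> ?D \<and> (\<forall>\<zeta>\<in>?D - K. - n * ln c - \<epsilon> < h \<zeta>)"
      using lower[of t] by simp
  qed
  have le: "n * ln c \<le> (- 1) * h \<zeta>" if "\<zeta> \<in> ?D" for \<zeta>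
  proof (rule locally_Re_holomorphic_lower_bound[OF locally_Re_holomorphic_cmult[OF hh] opD conD _ that])
    fix \<epsilon> :: real assume "\<epsilon> > 0"
    \<comment> \<open>By \<open>norm_J_sum\<close> this is the set where
      \<open>norm (J z) \<ge> exp \<epsilon>\<close>, written through \<open>P\<close> so that it is
      visibly closed in the whole plane.\<close>
    let ?C = "{z. exp \<epsilon> + exp (- \<epsilon>) \<le> norm (poly P z - 1) + norm (poly P z + 1)}"
    have "closed ?C" by (intro closed_Collect_le continuous_intros)
    have two: "exp \<epsilon> + exp (- \<epsilon>) > 2"
    proof -
      have "0 < (exp \<epsilon> - 1)\<^sup>2 / exp \<epsilon>" using \<open>\<epsilon> > 0\<close> by simp
      also have "(exp \<epsilon> - 1)\<^sup>2 / exp \<epsilon> = exp \<epsilon> + exp (- \<epsilon>) - 2"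
        by (simp add: exp_minus field_simps power2_eq_square)
      finally show ?thesis by simp
    qed
    then have CE: "z \<notin> E" if "z \<in> ?C" for z using that by (auto simp: mem_preimage_interval_iff)
    then have "e \<notin> ?C" using \<open>e \<in> E\<close> by blast
    let ?K = "{\<zeta>. \<zeta> = 0 \<or> e + 1 / \<zeta> \<in> ?C}"
    have "compact ?K" by (rule compact_inversion_image[OF \<open>closed ?C\<close> \<open>e \<notin> ?C\<close>])
    moreover have "?K \<subseteq> ?D" using CE by blast
    moreover have "n * ln c - \<epsilon> < (- 1) * h \<zeta>" if \<zeta>: "\<zeta> \<in> ?D - ?K" for \<zeta>
    proof -
      have z: "\<zeta> \<noteq> 0" "e + 1 / \<zeta> \<notin> E" "e + 1 / \<zeta> \<notin> ?C" using \<zeta> by auto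
      let ?x = "norm (J (e + 1 / \<zeta>))"
      have "?x < exp \<epsilon>"
      proof (rule ccontr)
        assume "\<not> ?x < exp \<epsilon>"
        then have "exp \<epsilon> \<le> ?x" by simp
        have x1: "?x > 1" by (rule norm_J_gt_1[OF z(2)])
        have "1 \<le> exp \<epsilon>" using \<open>\<epsilon> > 0\<close> by simp
        have "exp \<epsilon> + 1 / exp \<epsilon> \<le> ?x + 1 / ?x"
          by (rule add_inverse_mono[OF \<open>1 \<le> exp \<epsilon>\<close> \<open>exp \<epsilon> \<le> ?x\<close>])
        then have "exp \<epsilon> + exp (- \<epsilon>) \<le> ?x + 1 / ?x" by (simp add: exp_minus inverse_eq_divide)
        then show False using z(3) norm_J_sum[OF z(2)] by simp
      qed
      then have "ln ?x < \<epsilon>" using norm_J_gt_1[OF z(2)] by (metis exp_gt_zero ln_exp ln_less_cancel_iff less_trans zero_less_one)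
      moreover have "n * ln c < n * ln (U (\<Phi> (e + 1 / \<zeta>)))" using Ugt[OF z(2)] \<open>c > 0\<close> \<open>n > 0\<close> by simp
      ultimately show ?thesis using h_eq[OF z(1) DiffD1[OF \<zeta>]] by linarith
    qed
    ultimately show "\<exists>K. compact K \<and> K \<subseteq> ?D \<and> (\<forall>\<zeta>\<in>?D - K. n * ln c - \<epsilon> < (- 1) * h \<zeta>)" by blast
  qed
  have heq: "h \<zeta> = - n * ln c" if "\<zeta> \<in> ?D" for \<zeta> using ge[OF that] le[OF that] by simp
  \<comment> \<open>Evaluation at infinity yields the capacity in the form
    \<open>2 * norm (lead_coeff P) * c ^ n = 1\<close>.\<close>
  have lncap: "ln (2 * norm (lead_coeff P)) + n * ln c = 0" using heq[of 0] h0 by simp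
  show "norm (J z) = 2 * norm (lead_coeff P) * (\<Prod>j=1..l. norm (\<Phi> z - a j) powr m j) ^ degree P" if "z \<notin> E" for z
  proof -
    define \<zeta> where "\<zeta> = 1 / (z - e)"
    have "z \<noteq> e" using that \<open>e \<in> E\<close> by auto
    then have \<zeta>: "\<zeta> \<noteq> 0" "e + 1 / \<zeta> = z" by (auto simp: \<zeta>_def)
    have "U (\<Phi> z) > 0" using Ugt[OF that] \<open>c > 0\<close> by linarith
    have "ln (norm (J z)) = ln (2 * norm (lead_coeff P)) + n * ln (U (\<Phi> z))"
      using h_eq[of \<zeta>] heq[of \<zeta>] \<zeta> that lncap by simp
    also have "\<dots> = ln (2 * norm (lead_coeff P) * U (\<Phi> z) ^ n)"
      using \<open>U (\<Phi> z) > 0\<close> lc by (simp add: ln_mult ln_realpow)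
    finally show ?thesis
      using \<open>U (\<Phi> z) > 0\<close> lc J_nz[OF that] by (subst (asm) ln_inj_iff) (auto simp: U_def n_def)
  qed
qed

end

section \<open>Exponents, labels and critical points\<close>

text \<open>The labelling curves carry no prescribed orientation; the sign \<open>s\<close> records
  it.\<close>

lemma simple_closed_path_winding_sign:
  assumes "simple_path \<gamma>"
  shows "\<exists>s::real. (s = 1 \<or> s = -1) \<and> (\<forall>z\<in>inside (path_image \<gamma>). winding_number \<gamma> z = of_real s)"
proof (rule simple_closed_path_winding_number_inside[OF assms])
  assume "\<And>z. z \<in> inside (path_image \<gamma>) \<Longrightarrow> winding_number \<gamma> z = 1"
  then show ?thesis by (intro exI[of _ 1]) simp
next
  assume "\<And>z. z \<in> inside (path_image \<gamma>) \<Longrightarrow> winding_number \<gamma> z = - 1"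
  then show ?thesis by (intro exI[of _ "- 1"]) simp
qed

text \<open>By symmetry \<open>\<Phi>\<close> is real on the real axis and maps the ray beyond
  \<open>x0\<close>, the last real point off \<open>D\<close> in direction \<open>\<sigma>\<close>,
  onto the ray beyond \<open>y\<close>. Points of the second ray close to \<open>y\<close> come from
  points close to \<open>x0\<close>, hence inside \<open>\<gamma>\<close>, so
  \<open>\<Phi> \<circ> \<gamma>\<close> winds around them. That is impossible if \<open>y\<close>
  lies outside the image curve.\<close>

lemma surrounded_component_extreme_real:
  fixes \<sigma> x0 y :: real
  assumes D: "open D" "connected D" "bounded (- D)"
    and hol: "\<Phi> holomorphic_on D" and inj: "inj_on \<Phi> D"
    and lim: "((\<lambda>z. \<Phi> z - z) \<longlongrightarrow> 0) at_infinity"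
    and cnj: "\<And>z. z \<in> D \<Longrightarrow> cnj z \<in> D" "\<And>z. z \<in> D \<Longrightarrow> \<Phi> (cnj z) = cnj (\<Phi> z)"
    and \<gamma>: "simple_path \<gamma>" "pathfinish \<gamma> = pathstart \<gamma>" "path_image \<gamma> \<subseteq> D"
    and \<sigma>: "\<sigma> = 1 \<or> \<sigma> = -1"
    and x0: "of_real x0 \<in> inside (path_image \<gamma>)" "of_real x0 \<notin> D" "\<And>t. t > 0 \<Longrightarrow> of_real (x0 + \<sigma> * t) \<in> D"
    and y: "of_real y \<notin> \<Phi> ` D" "\<And>t. t > 0 \<Longrightarrow> of_real (y + \<sigma> * t) \<in> \<Phi> ` D"
  shows "of_real y \<in> inside (path_image (\<Phi> \<circ> \<gamma>))"
proof (rule ccontr)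
  assume nin: "\<not> ?thesis"
  have out: "of_real y \<in> outside (path_image (\<Phi> \<circ> \<gamma>))" 
  proof -
    have "of_real y \<notin> path_image (\<Phi> \<circ> \<gamma>)" using y(1) \<gamma>(3) by (auto simp: path_image_compose)
    then show ?thesis using nin inside_Un_outside by blast
  qed
  have \<sigma>2: "\<sigma> * \<sigma> = 1" "\<bar>\<sigma>\<bar> = 1" using \<sigma> by auto
  have p\<gamma>: "path \<gamma>" by (rule simple_path_imp_path[OF \<gamma>(1)])
  have p\<Phi>: "path (\<Phi> \<circ> \<gamma>)"
    by (rule path_continuous_image[OF p\<gamma> continuous_on_subset[OF holomorphic_on_imp_continuous_on[OF hol] \<gamma>(3)]])
  have l\<Phi>: "pathfinish (\<Phi> \<circ> \<gamma>) = pathstart (\<Phi> \<circ> \<gamma>)" using \<gamma>(2) by (simp add: pathfinish_compose pathstart_compose)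
  have realD: "Im (\<Phi> (of_real x)) = 0" if "complex_of_real x \<in> D" for x
  proof -
    have "cnj (\<Phi> (of_real x)) = \<Phi> (of_real x)" using cnj(2)[OF that] by simp
    then show ?thesis by (metis Reals_cnj_iff complex_is_Real_iff)
  qed
  \<comment> \<open>\<open>\<Phi>\<close> in the ray parameters: distance beyond \<open>x0\<close>
    in the domain, signed distance beyond \<open>y\<close> in the image. It is continuous, injective
    and large for large \<open>t\<close>.\<close>
  define \<phi> where "\<phi> t = \<sigma> * (Re (\<Phi> (of_real (x0 + \<sigma> * t))) - y)" for t
  have \<Phi>\<phi>: "\<Phi> (of_real (x0 + \<sigma> * t)) = of_real (y + \<sigma> * \<phi> t)" if "t > 0" for t
  proof -
    have "y + \<sigma> * \<phi> t = y + (\<sigma> * \<sigma>) * (Re (\<Phi> (of_real (x0 + \<sigma> * t))) - y)" by (simp add: \<phi>_def mult.assoc)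
    also have "\<dots> = Re (\<Phi> (of_real (x0 + \<sigma> * t)))" by (simp add: \<sigma>2)
    finally show ?thesis using realD[OF x0(3)[OF that]] by (simp add: complex_eq_iff)
  qed
  have cont\<phi>: "continuous_on {0<..} \<phi>"
    unfolding \<phi>_def
    by (intro continuous_intros continuous_on_compose2[OF holomorphic_on_imp_continuous_on[OF hol]])
       (use x0(3) in auto)
  have \<phi>inj: "t = t'" if "t > 0" "t' > 0" "\<phi> t = \<phi> t'" for t t'
  proof -
    have "\<Phi> (of_real (x0 + \<sigma> * t)) = \<Phi> (of_real (x0 + \<sigma> * t'))" using \<Phi>\<phi> that by simp
    from inj_onD[OF inj this] show ?thesis using x0(3) that \<sigma> by auto
  qed
  obtain B where B: "\<And>z. B \<le> norm z \<Longrightarrow> norm (\<Phi> z - z) < 1"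
    using lim[unfolded tendsto_iff, rule_format, of 1] by (auto simp: eventually_at_infinity dist_norm)
  have \<phi>_large: "\<phi> t > N" if "t > \<bar>B\<bar> + \<bar>x0\<bar> + \<bar>y\<bar> + \<bar>N\<bar> + 1" for t N
  proof -
    have "\<bar>\<sigma> * t\<bar> = t" using that \<sigma> by auto
    then have "B \<le> \<bar>x0 + \<sigma> * t\<bar>" using that by linarith
    then have "norm (\<Phi> (of_real (x0 + \<sigma> * t)) - of_real (x0 + \<sigma> * t)) < 1" by (intro B) (simp only: norm_of_real)
    then have "\<bar>Re (\<Phi> (of_real (x0 + \<sigma> * t))) - (x0 + \<sigma> * t)\<bar> < 1"
      using abs_Re_le_cmod[of "\<Phi> (of_real (x0 + \<sigma> * t)) - of_real (x0 + \<sigma> * t)"] by simp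
    then show ?thesis using \<sigma> that unfolding \<phi>_def by auto
  qed
  have \<phi>_ivt: "\<exists>s\<ge>t. \<phi> s = v" if "t > 0" "\<phi> t \<le> v" for t v
  proof -
    define T where "T = max t (\<bar>B\<bar> + \<bar>x0\<bar> + \<bar>y\<bar> + \<bar>v\<bar> + 2)"
    have "T > \<bar>B\<bar> + \<bar>x0\<bar> + \<bar>y\<bar> + \<bar>v\<bar> + 1" unfolding T_def by linarith
    then have "v \<le> \<phi> T" using \<phi>_large by (simp add: less_imp_le)
    moreover have "t \<le> T" unfolding T_def by simp
    moreover have "continuous_on {t..T} \<phi>" by (rule continuous_on_subset[OF cont\<phi>]) (use that in auto)
    ultimately show ?thesis using IVT'[of \<phi> t v T] that(2) by blast
  qed
  have \<phi>pos: "\<phi> t > 0" if t: "t > 0" for t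
  proof (rule ccontr)
    assume "\<not> \<phi> t > 0"
    then obtain s where s: "s \<ge> t" "\<phi> s = 0" using \<phi>_ivt[OF t, of 0] by auto
    then have "of_real y = \<Phi> (of_real (x0 + \<sigma> * s))" using \<Phi>\<phi>[of s] t by simp
    then show False using y(1) x0(3)[of s] s(1) t by auto
  qed
  obtain g where g: "g holomorphic_on (\<Phi> ` D)" "\<forall>z\<in>D. g (\<Phi> z) = z"
    using holomorphic_inverse_exists[OF hol D(1) inj] by blast
  have g\<phi>: "g (of_real (y + \<sigma> * \<phi> t)) = of_real (x0 + \<sigma> * t)" if "t > 0" for t
    using g(2) x0(3)[OF that] \<Phi>\<phi>[OF that] by metis
  \<comment> \<open>The inverse of \<open>\<Phi>\<close> in the same parameters.\<close>
  define \<theta> where "\<theta> s = \<sigma> * (Re (g (of_real (y + \<sigma> * s))) - x0)" for s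
  have gD: "g (of_real (y + \<sigma> * s)) = of_real (x0 + \<sigma> * \<theta> s) \<and> \<Phi> (of_real (x0 + \<sigma> * \<theta> s)) = of_real (y + \<sigma> * s)
      \<and> complex_of_real (x0 + \<sigma> * \<theta> s) \<in> D" if s: "s > 0" for s
  proof -
    obtain z where z: "\<Phi> z = of_real (y + \<sigma> * s)" "z \<in> D" using y(2)[OF s] by (metis imageE)
    have "\<Phi> (cnj z) = \<Phi> z" using cnj(2)[OF z(2)] z(1) by simp
    then have "cnj z = z" by (rule inj_onD[OF inj]) (use z cnj(1) in auto)
    then have zr: "z = of_real (Re z)" by (metis Reals_cnj_iff of_real_Re)
    have gz: "g (of_real (y + \<sigma> * s)) = z" using g(2) z by metis
    have "x0 + \<sigma> * \<theta> s = x0 + (\<sigma> * \<sigma>) * (Re z - x0)" unfolding \<theta>_def gz by (simp add: mult.assoc)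
    then have "x0 + \<sigma> * \<theta> s = Re z" by (simp add: \<sigma>2)
    then have "z = of_real (x0 + \<sigma> * \<theta> s)" using zr by simp
    then show ?thesis using gz z by simp
  qed
  have cont\<theta>: "continuous_on {0<..} \<theta>"
    unfolding \<theta>_def
    by (intro continuous_intros continuous_on_compose2[OF holomorphic_on_imp_continuous_on[OF g(1)]])
       (use y(2) in auto)
  have \<theta>nz: "\<theta> s \<noteq> 0" if "s > 0" for s using gD[OF that] x0(2) by auto
  have \<theta>pos: "\<theta> s > 0" if s: "s > 0" for s
  proof (rule ccontr)
    assume "\<not> \<theta> s > 0"
    then have neg: "\<theta> s < 0" using \<theta>nz[OF s] by simp
    \<comment> \<open>A parameter beyond \<open>s\<close> at which \<open>\<theta>\<close> is known
      to be positive, so that a negative value at \<open>s\<close> would force a zero in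
      between.\<close>
    obtain t where t: "t \<ge> 1" "\<phi> t = max s (\<phi> 1)" using \<phi>_ivt[of 1 "max s (\<phi> 1)"] by auto
    have "\<theta> (\<phi> t) = (\<sigma> * \<sigma>) * t" using g\<phi>[of t] t(1) by (simp add: \<theta>_def)
    then have "\<theta> (\<phi> t) > 0" using \<sigma>2 t(1) by simp
    moreover have "continuous_on {s..\<phi> t} \<theta>" by (rule continuous_on_subset[OF cont\<theta>]) (use s in auto)
    moreover have "s \<le> \<phi> t" using t(2) by simp
    ultimately obtain u where "s \<le> u" "\<theta> u = 0"
      using IVT'[of \<theta> s 0 "\<phi> t"] neg by (meson less_imp_le)
    then show False using \<theta>nz[of u] s by simp
  qed
  have \<theta>\<phi>: "\<phi> (\<theta> s) = s" if "s > 0" for s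
  proof -
    have "\<phi> (\<theta> s) = (\<sigma> * \<sigma>) * s" using gD[OF that] by (simp add: \<phi>_def)
    then show ?thesis by (simp add: \<sigma>2)
  qed
  have "open (outside (path_image (\<Phi> \<circ> \<gamma>)))" using p\<Phi> by (simp add: closed_path_image open_outside)
  then obtain d where d: "d > 0" "ball (of_real y) d \<subseteq> outside (path_image (\<Phi> \<circ> \<gamma>))" using out openE by blast
  have "open (inside (path_image \<gamma>))" using p\<gamma> by (simp add: closed_path_image open_inside)
  then obtain d' where d': "d' > 0" "ball (of_real x0) d' \<subseteq> inside (path_image \<gamma>)" using x0(1) openE by blast
  define t1 where "t1 = d' / 2"
  have "t1 > 0" using d'(1) by (simp add: t1_def)
  \<comment> \<open>Below \<open>d\<close>, to keep the image point in the outside disc around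
    \<open>y\<close>; below \<open>\<phi> t1\<close>, so that its preimage is no farther than
    \<open>t1\<close> from \<open>x0\<close>, because values beyond \<open>t1\<close> cannot drop
    below \<open>\<phi> t1\<close> without repeating it.\<close>
  define s where "s = min (d / 2) (\<phi> t1 / 2)"
  have s: "s > 0" "s < d" "s < \<phi> t1" using d(1) \<phi>pos[OF \<open>t1 > 0\<close>] by (auto simp: s_def min_def)
  have "\<theta> s < d'"
  proof (rule ccontr)
    assume "\<not> \<theta> s < d'"
    then have lt: "t1 < \<theta> s" using d'(1) by (simp add: t1_def)
    obtain u where "u \<ge> \<theta> s" "\<phi> u = \<phi> t1" using \<phi>_ivt[OF \<theta>pos[OF s(1)], of "\<phi> t1"] \<theta>\<phi>[OF s(1)] s(3) by auto
    then show False using \<phi>inj[of u t1] lt \<open>t1 > 0\<close> by simp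
  qed
  define z where "z = complex_of_real (x0 + \<sigma> * \<theta> s)"
  have z: "z \<in> D" "\<Phi> z = of_real (y + \<sigma> * s)" using gD[OF s(1)] by (simp_all add: z_def)
  have "z - of_real x0 = of_real (\<sigma> * \<theta> s)" by (simp add: z_def)
  then have "norm (z - of_real x0) = \<bar>\<sigma>\<bar> * \<bar>\<theta> s\<bar>" by (simp only: norm_of_real abs_mult)
  then have "norm (z - of_real x0) = \<theta> s" using \<sigma>2(2) \<theta>pos[OF s(1)] by (simp only: mult_1_left abs_of_pos)
  then have "z \<in> inside (path_image \<gamma>)"
    using d'(2) \<open>\<theta> s < d'\<close> by (auto simp: dist_norm norm_minus_commute subset_iff)
  then have "z \<notin> path_image \<gamma>" "winding_number \<gamma> z \<noteq> 0"
    using simple_closed_path_winding_sign[OF \<gamma>(1)] inside_no_overlap by (blast, force)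
  moreover have "winding_number (\<Phi> \<circ> \<gamma>) (\<Phi> z) = winding_number \<gamma> z"
    by (rule winding_number_comp_near_identity[OF D hol inj lim p\<gamma> \<gamma>(2,3) z(1) calculation(1)])
  moreover have "\<Phi> z - of_real y = of_real (\<sigma> * s)" using z(2) by simp
  then have "norm (\<Phi> z - of_real y) = \<bar>\<sigma>\<bar> * \<bar>s\<bar>" by (simp only: norm_of_real abs_mult)
  then have "norm (\<Phi> z - of_real y) = s" using \<sigma>2(2) s(1) by (simp only: mult_1_left abs_of_pos)
  then have "\<Phi> z \<in> outside (path_image (\<Phi> \<circ> \<gamma>))"
    using d(2) s(2) by (auto simp: dist_norm norm_minus_commute subset_iff)
  then have "winding_number (\<Phi> \<circ> \<gamma>) (\<Phi> z) = 0" by (rule winding_number_zero_in_outside[OF p\<Phi> l\<Phi>])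
  ultimately show False by simp
qed

text \<open>On a disc in \<open>X\<close> free of roots of \<open>A\<close> the quotient
  \<open>B / A\<close> has constant modulus, hence is constant, and infinitely many points determine
  a polynomial.\<close>

lemma norm_poly_eq_imp_smult:
  fixes A B :: "complex poly"
  assumes "open X" "X \<noteq> {}" and eq: "\<And>w. w \<in> X \<Longrightarrow> norm (poly B w) = norm (poly A w)" and "A \<noteq> 0"
  shows "\<exists>\<kappa>. \<kappa> \<noteq> 0 \<and> B = smult \<kappa> A"
proof -
  have fin: "finite {w. poly A w = 0}" by (rule poly_roots_finite[OF \<open>A \<noteq> 0\<close>])
  then have "open (X - {w. poly A w = 0})" using \<open>open X\<close> by (intro open_Diff finite_imp_closed)
  moreover have "X - {w. poly A w = 0} \<noteq> {}"
    using finite_subset[OF _ fin, of X] finite_imp_not_open[of X] assms(1,2) by blast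
  ultimately obtain w0 r where r: "r > 0" "ball w0 r \<subseteq> X - {w. poly A w = 0}" by (meson all_not_in_conv openE)
  have "(\<lambda>w. poly B w / poly A w) constant_on ball w0 r"
    by (rule maximum_modulus_principle[where U = "ball w0 r" and \<xi> = w0])
       (use r eq in \<open>auto intro!: holomorphic_intros simp: norm_divide subset_iff\<close>)
  then obtain \<kappa> where \<kappa>: "\<And>w. w \<in> ball w0 r \<Longrightarrow> poly B w / poly A w = \<kappa>" unfolding constant_on_def by blast
  have "poly (B - smult \<kappa> A) w = 0" if "w \<in> ball w0 r" for w
    using \<kappa>[OF that] that r(2) by (auto simp: field_simps subset_iff)
  then have "ball w0 r \<subseteq> {w. poly (B - smult \<kappa> A) w = 0}" by blast
  moreover have "infinite (ball w0 r)" using r(1) finite_imp_not_open[of "ball w0 r"] by auto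
  ultimately have "B - smult \<kappa> A = 0" using poly_roots_finite finite_subset by blast
  then have "B = smult \<kappa> A" by simp
  moreover have "\<kappa> \<noteq> 0"
  proof
    assume "\<kappa> = 0"
    then have "poly B w0 = 0" using \<open>B = smult \<kappa> A\<close> by simp
    moreover have "w0 \<in> ball w0 r" using r(1) by simp
    then have "w0 \<in> X" "poly A w0 \<noteq> 0" using subsetD[OF r(2)] by auto
    ultimately show False using eq[of w0] by simp
  qed
  ultimately show ?thesis by blast
qed

section \<open>Consequences of the modulus identity\<close>

locale lemniscatic_map = preimage_interval_branch +
  fixes \<Phi> :: "complex \<Rightarrow> complex" and l :: nat and a :: "nat \<Rightarrow> complex" and m :: "nat \<Rightarrow> real" and c :: real
  assumes hol: "\<Phi> holomorphic_on - E" and bij: "bij_betw \<Phi> (- E) (- lemniscate l a m c)"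
    and inj_a: "inj_on a {1..l}" and m_pos: "\<And>j. j \<in> {1..l} \<Longrightarrow> m j > 0" and m_sum: "(\<Sum>j=1..l. m j) = 1"
    and c_nonneg: "c \<ge> 0" and lim: "((\<lambda>z. \<Phi> z - z) \<longlongrightarrow> 0) at_infinity"
begin

abbreviation "L \<equiv> lemniscate l a m c"

lemma c_pos: "c > 0"
  by (rule norm_J_eq_lemniscate(1)[OF hol bij _ m_sum c_nonneg lim]) (rule m_pos)

lemma norm_J_eq:
  "z \<notin> E \<Longrightarrow> norm (J z) = 2 * norm (lead_coeff P) * (\<Prod>j=1..l. norm (\<Phi> z - a j) powr m j) ^ degree P"
  by (rule norm_J_eq_lemniscate(2)[OF hol bij _ m_sum c_nonneg lim]) (rule m_pos)

lemma inj_\<Phi>: "inj_on \<Phi> (- E)" using bij by (simp add: bij_betw_def)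

lemma image_\<Phi>: "\<Phi> ` (- E) = - L" using bij by (simp add: bij_betw_def)

lemma \<Phi>_notin_L: "z \<notin> E \<Longrightarrow> \<Phi> z \<notin> L" using image_\<Phi> by blast

lemma a_in_L: "j \<in> {1..l} \<Longrightarrow> a j \<in> L"
proof -
  assume j: "j \<in> {1..l}"
  have "(\<Prod>k=1..l. norm (a j - a k) powr m k) = 0" by (rule prod_zero) (use j in auto)
  then show ?thesis using c_nonneg unfolding lemniscate_def by (simp only: mem_Collect_eq)
qed

lemma \<Phi>_ne_a: "z \<notin> E \<Longrightarrow> j \<in> {1..l} \<Longrightarrow> \<Phi> z \<noteq> a j" using \<Phi>_notin_L a_in_L by metis

lemma ln_norm_J:
  assumes "z \<notin> E"
  shows "ln (norm (J z)) = ln (2 * norm (lead_coeff P)) + (\<Sum>j=1..l. degree P * m j * ln (norm (\<Phi> z - a j)))"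
proof -
  have lc: "lead_coeff P \<noteq> 0" using deg by auto
  have pos: "norm (\<Phi> z - a j) powr m j > 0" if "j \<in> {1..l}" for j using \<Phi>_ne_a[OF assms that] by simp
  define U where "U = (\<Prod>j=1..l. norm (\<Phi> z - a j) powr m j)"
  have pos': "U > 0" unfolding U_def using pos by (intro prod_pos) blast
  have lnU: "ln U = (\<Sum>j=1..l. m j * ln (norm (\<Phi> z - a j)))"
    unfolding U_def using \<Phi>_ne_a[OF assms] by (subst ln_prod) (auto simp: ln_powr)
  have "norm (J z) = (2 * norm (lead_coeff P)) * U ^ degree P" using norm_J_eq[OF assms] by (simp add: U_def)
  then have "ln (norm (J z)) = ln (2 * norm (lead_coeff P)) + degree P * ln U"
    using lc pos' by (simp add: ln_mult ln_realpow)
  then show ?thesis by (simp add: lnU sum_distrib_left mult.assoc)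
qed

text \<open>Factoring \<open>2 * P = J * (1 + 1 / J\<^sup>2)\<close> turns the modulus identity into
  a relation between the factors \<open>z - \<zeta>\<close> of \<open>P\<close>, the second factor,
  and the functions \<open>\<Phi> z - a k\<close>. Along \<open>\<gamma>\<close> the second factor
  does not wind around 0; the others count the zeros in \<open>A\<close> and the single center
  \<open>a j\<close>.\<close>

lemma exponent_eq_zero_count:
  assumes \<gamma>: "simple_path \<gamma>" "pathfinish \<gamma> = pathstart \<gamma>" "path_image \<gamma> \<subseteq> - E"
    and A: "A \<subseteq> inside (path_image \<gamma>)" "E - A \<subseteq> outside (path_image \<gamma>)"
    and \<gamma>': "simple_path (\<Phi> \<circ> \<gamma>)" and j: "j \<in> {1..l}" "a j \<in> inside (path_image (\<Phi> \<circ> \<gamma>))"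
    and k: "\<And>k. k \<in> {1..l} \<Longrightarrow> k \<noteq> j \<Longrightarrow> a k \<in> outside (path_image (\<Phi> \<circ> \<gamma>))"
  shows "real (zero_count P A) = degree P * m j"
proof -
  define n where "n = degree P"
  define Z where "Z = {z. poly P z = 0}"
  have "P \<noteq> 0" using deg by auto
  then have finZ: "finite Z" unfolding Z_def by (rule poly_roots_finite)
  have lc: "lead_coeff P \<noteq> 0" using \<open>P \<noteq> 0\<close> by simp
  have ZE: "z \<in> E" if "z \<in> Z" for z
    using that by (auto simp: Z_def preimage_interval_def intro!: image_eqI[of _ _ 0])
  have p\<gamma>: "path \<gamma>" by (rule simple_path_imp_path[OF \<gamma>(1)])
  have p\<Phi>: "path (\<Phi> \<circ> \<gamma>)" by (rule simple_path_imp_path[OF \<gamma>'])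
  have l\<Phi>: "pathfinish (\<Phi> \<circ> \<gamma>) = pathstart (\<Phi> \<circ> \<gamma>)" using \<gamma>(2) by (simp add: pathfinish_compose pathstart_compose)
  obtain s where s: "s = 1 \<or> s = -1" "\<And>z. z \<in> inside (path_image \<gamma>) \<Longrightarrow> winding_number \<gamma> z = of_real s"
    using simple_closed_path_winding_sign[OF \<gamma>(1)] by blast
  obtain s' where s': "s' = 1 \<or> s' = -1" "\<And>z. z \<in> inside (path_image (\<Phi> \<circ> \<gamma>)) \<Longrightarrow> winding_number (\<Phi> \<circ> \<gamma>) z = of_real s'"
    using simple_closed_path_winding_sign[OF \<gamma>'] by blast
  \<comment> \<open>Since \<open>norm (J z) > 1\<close>, this stays in the disc of radius 1 around
    1.\<close>
  define w :: "complex \<Rightarrow> complex" where "w z = 1 + inverse (J z) ^ 2" for z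
  have Jinv: "norm (inverse (J z) ^ 2) < 1" if "z \<notin> E" for z
    using norm_J_gt_1[OF that] by (simp add: norm_power norm_inverse power_less_one_iff inverse_less_1_iff)
  have wball: "w z \<in> ball 1 1" if "z \<notin> E" for z using Jinv[OF that] by (simp add: w_def dist_norm)
  have wnz: "w z \<noteq> 0" if "z \<notin> E" for z using wball[OF that] by auto
  have holw: "w holomorphic_on - E" unfolding w_def[abs_def]
    using J_nz by (intro holomorphic_intros holomorphic_J) auto
  have Pw: "2 * poly P z = J z * w z" if "z \<notin> E" for z
    using J_inverse[OF that] J_nz[OF that] by (simp add: w_def field_simps power2_eq_square)
  \<comment> \<open>\<open>Inl\<close> indexes the zeros of \<open>P\<close>, \<open>Inr 0\<close>
    the factor \<open>w\<close>, and \<open>Inr k\<close> with positive \<open>k\<close> the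
    centers.\<close>
  define G :: "complex + nat \<Rightarrow> complex \<Rightarrow> complex" where
    "G i = (case i of Inl \<zeta> \<Rightarrow> (\<lambda>z. z - \<zeta>) | Inr k \<Rightarrow> if k = 0 then w else (\<lambda>z. \<Phi> z - a k))" for i
  define co :: "complex + nat \<Rightarrow> real" where
    "co i = (case i of Inl \<zeta> \<Rightarrow> order \<zeta> P | Inr k \<Rightarrow> if k = 0 then -1 else - (n * m k))" for i
  let ?I = "Z <+> insert 0 {1..l}"
  have sumI: "(\<Sum>i\<in>?I. f i) = (\<Sum>\<zeta>\<in>Z. f (Inl \<zeta>)) + (f (Inr 0) + (\<Sum>k=1..l. f (Inr k)))" for f :: "complex + nat \<Rightarrow> 'z::comm_monoid_add"
    using finZ by (simp add: sum.Plus)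
  have lnP: "(\<Sum>\<zeta>\<in>Z. order \<zeta> P * ln (norm (z - \<zeta>))) = ln (norm (poly P z)) - ln (norm (lead_coeff P))" if "z \<notin> E" for z
  proof -
    have nz: "norm (z - \<zeta>) ^ order \<zeta> P > 0" if "\<zeta> \<in> Z" for \<zeta> 
    proof -
      have "z \<noteq> \<zeta>" using ZE[OF that] \<open>z \<notin> E\<close> by auto
      then show ?thesis by (intro zero_less_power) simp
    qed
    have nz': "norm (z - \<zeta>) > 0" if "\<zeta> \<in> Z" for \<zeta> using ZE[OF that] \<open>z \<notin> E\<close> by auto
    have "poly P z = poly (smult (lead_coeff P) (\<Prod>\<zeta>\<in>Z. [:-\<zeta>, 1:] ^ order \<zeta> P)) z"
      unfolding Z_def by (subst complex_poly_decompose) (rule refl)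
    also have "\<dots> = lead_coeff P * (\<Prod>\<zeta>\<in>Z. (z - \<zeta>) ^ order \<zeta> P)" by (simp add: poly_prod)
    finally have "norm (poly P z) = norm (lead_coeff P) * (\<Prod>\<zeta>\<in>Z. norm (z - \<zeta>) ^ order \<zeta> P)"
      by (simp add: norm_mult prod_norm[symmetric] norm_power)
    moreover have "(\<Prod>\<zeta>\<in>Z. norm (z - \<zeta>) ^ order \<zeta> P) > 0" using nz by (intro prod_pos) blast
    ultimately have "ln (norm (poly P z)) = ln (norm (lead_coeff P)) + ln (\<Prod>\<zeta>\<in>Z. norm (z - \<zeta>) ^ order \<zeta> P)"
      using lc by (simp add: ln_mult)
    also have "ln (\<Prod>\<zeta>\<in>Z. norm (z - \<zeta>) ^ order \<zeta> P) = (\<Sum>\<zeta>\<in>Z. ln (norm (z - \<zeta>) ^ order \<zeta> P))"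
      using nz' finZ by (intro ln_prod) auto
    also have "\<dots> = (\<Sum>\<zeta>\<in>Z. order \<zeta> P * ln (norm (z - \<zeta>)))"
    proof (rule sum.cong)
      fix \<zeta> assume "\<zeta> \<in> Z"
      then have "norm (z - \<zeta>) > 0" using nz' by blast
      then show "ln (norm (z - \<zeta>) ^ order \<zeta> P) = order \<zeta> P * ln (norm (z - \<zeta>))" by (simp add: ln_realpow)
    qed simp
    finally show ?thesis by simp
  qed
  have "(\<Sum>i\<in>?I. co i * winding_number (G i \<circ> \<gamma>) 0) = 0"
  proof (rule sum_winding_number_eq_0[OF _ open_Compl_E _ _ _ p\<gamma> \<gamma>(2,3)])
    show "finite ?I" using finZ by simp
    show "G i holomorphic_on - E" if "i \<in> ?I" for i
      using holw hol by (cases i) (auto simp: G_def intro!: holomorphic_intros)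
    show "G i z \<noteq> 0" if "i \<in> ?I" "z \<in> - E" for i z
      using that ZE wnz \<Phi>_ne_a by (cases i) (auto simp: G_def)
    show "(\<Sum>i\<in>?I. co i * ln (norm (G i z))) = 0" if "z \<in> - E" for z
    proof -
      have z: "z \<notin> E" using that by simp
      have Pnz: "poly P z \<noteq> 0" using ZE[of z] z by (auto simp: Z_def)
      have "norm (2 * poly P z) = norm (J z) * norm (w z)" by (simp add: Pw[OF z] norm_mult)
      then have "ln (2 * norm (poly P z)) = ln (norm (J z)) + ln (norm (w z))"
        using J_nz[OF z] wnz[OF z] by (simp add: norm_mult ln_mult)
      then have "ln 2 + ln (norm (poly P z)) = ln (norm (J z)) + ln (norm (w z))"
        using Pnz by (simp add: ln_mult)
      moreover have "ln (2 * norm (lead_coeff P)) = ln 2 + ln (norm (lead_coeff P))" using lc by (simp add: ln_mult)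
      moreover have "(\<Sum>k=1..l. co (Inr k) * ln (norm (G (Inr k) z))) = - (\<Sum>k=1..l. n * m k * ln (norm (\<Phi> z - a k)))"
        by (simp add: co_def G_def sum_negf)
      ultimately show ?thesis
        unfolding sumI using lnP[OF z] ln_norm_J[OF z] by (simp add: co_def G_def n_def)
    qed
  qed
  moreover have "winding_number (w \<circ> \<gamma>) 0 = 0"
  proof (rule winding_number_zero_outside[OF _ convex_ball[of 1 1]])
    show "path (w \<circ> \<gamma>)"
      by (rule path_continuous_image[OF p\<gamma> continuous_on_subset[OF holomorphic_on_imp_continuous_on[OF holw] \<gamma>(3)]])
    show "path_image (w \<circ> \<gamma>) \<subseteq> ball 1 1" using wball \<gamma>(3) by (auto simp: path_image_compose)
    show "pathfinish (w \<circ> \<gamma>) = pathstart (w \<circ> \<gamma>)" using \<gamma>(2) by (simp add: pathfinish_compose pathstart_compose)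
  qed simp
  moreover have "winding_number ((\<lambda>z. z - \<zeta>) \<circ> \<gamma>) 0 = (if \<zeta> \<in> A then of_real s else 0)" if "\<zeta> \<in> Z" for \<zeta>
  proof -
    have "winding_number ((\<lambda>z. z - \<zeta>) \<circ> \<gamma>) 0 = winding_number \<gamma> \<zeta>"
      using winding_number_offset[of \<gamma> \<zeta>] by (simp add: o_def)
    then show ?thesis using s(2)[of \<zeta>] A ZE[OF that] winding_number_zero_in_outside[OF p\<gamma> \<gamma>(2), of \<zeta>] by auto
  qed
  moreover have "winding_number ((\<lambda>z. \<Phi> z - a k) \<circ> \<gamma>) 0 = (if k = j then of_real s' else 0)" if "k \<in> {1..l}" for k
  proof -
    have "winding_number ((\<lambda>z. \<Phi> z - a k) \<circ> \<gamma>) 0 = winding_number (\<Phi> \<circ> \<gamma>) (a k)"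
      using winding_number_offset[of "\<Phi> \<circ> \<gamma>" "a k"] by (simp add: o_def)
    then show ?thesis using s'(2) j(2) k[OF that] winding_number_zero_in_outside[OF p\<Phi> l\<Phi>, of "a k"] by auto
  qed
  ultimately have "(\<Sum>\<zeta>\<in>Z. of_nat (order \<zeta> P) * (if \<zeta> \<in> A then of_real s else 0)) +
      (\<Sum>k=1..l. of_real (- (n * m k)) * (if k = j then of_real s' else (0::complex))) = 0"
    unfolding sumI by (simp add: co_def G_def)
  moreover have "(\<Sum>\<zeta>\<in>Z. of_nat (order \<zeta> P) * (if \<zeta> \<in> A then of_real s else 0)) = complex_of_real (real (zero_count P A) * s)"
  proof -
    have "(\<Sum>\<zeta>\<in>Z. of_nat (order \<zeta> P) * (if \<zeta> \<in> A then of_real s else (0::complex))) = (\<Sum>\<zeta>\<in>Z \<inter> A. of_nat (order \<zeta> P) * of_real s)"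
      by (simp add: sum.inter_restrict[OF finZ] if_distrib cong: if_cong)
    also have "Z \<inter> A = {z. poly P z = 0 \<and> z \<in> A}" by (auto simp: Z_def)
    finally show ?thesis by (simp add: zero_count_def sum_distrib_right)
  qed
  moreover have "(\<Sum>k=1..l. of_real (- (n * m k)) * (if k = j then of_real s' else (0::complex))) = of_real (- (n * m j) * s')"
    using j(1) by (simp add: if_distrib sum.delta cong: if_cong)
  ultimately have "complex_of_real (real (zero_count P A) * s - n * m j * s') = 0" by simp
  then have eq: "real (zero_count P A) * s = n * m j * s'" by (simp only: of_real_eq_0_iff right_minus_eq)
  \<comment> \<open>A zero count is nonnegative, so positivity here forces the two orientations to
    agree.\<close>
  have "n * m j > 0" using m_pos[OF j(1)] deg by (simp add: n_def)
  then show ?thesis using eq s(1) s'(1) by (auto simp: n_def)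
qed

text \<open>Taking logarithmic derivatives in the modulus identity gives \<open>J' / J = n * \<Phi>'
  * (\<Sum>j=1..l. m j / (\<Phi> z - a j))\<close>; \<open>\<Phi>'\<close> does not vanish because
  \<open>\<Phi>\<close> is injective.\<close>

lemma critical_point_iff:
  assumes "z \<notin> E"
  shows "poly (pderiv P) z = 0 \<longleftrightarrow> (\<Sum>j=1..l. of_real (m j) / (\<Phi> z - a j)) = 0"
proof -
  define G where "G k = (if k = 0 then J else (\<lambda>z. \<Phi> z - a k))" for k
  define co :: "nat \<Rightarrow> real" where "co k = (if k = 0 then 1 else - (degree P * m k))" for k
  have dG: "deriv (\<lambda>z. \<Phi> z - a k) z = deriv \<Phi> z" for k
    using hol open_Compl_E assms by (subst deriv_diff) (auto intro: holomorphic_on_imp_differentiable_at)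
  have "(\<Sum>k\<in>insert 0 {1..l}. co k * (deriv (G k) z / G k z)) = 0"
  proof (rule sum_logderiv_eq_0[OF open_Compl_E])
    show "G k holomorphic_on - E" for k using holomorphic_J hol by (auto simp: G_def intro!: holomorphic_intros)
    show "G k z \<noteq> 0" if "k \<in> insert 0 {1..l}" "z \<in> - E" for k z using that J_nz \<Phi>_ne_a by (auto simp: G_def)
    show "(\<Sum>k\<in>insert 0 {1..l}. co k * ln (norm (G k z))) = ln (2 * norm (lead_coeff P))" if "z \<in> - E" for z
      using ln_norm_J[of z] that by (simp add: co_def G_def sum_negf)
  qed (use assms in simp)
  then have "deriv J z / J z = (\<Sum>k=1..l. of_real (degree P * m k) * (deriv \<Phi> z / (\<Phi> z - a k)))"
    by (simp add: co_def G_def dG sum_negf)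
  also have "\<dots> = degree P * deriv \<Phi> z * (\<Sum>k=1..l. of_real (m k) / (\<Phi> z - a k))"
    by (simp add: sum_distrib_left mult_ac)
  finally have "deriv J z / J z = degree P * deriv \<Phi> z * (\<Sum>k=1..l. of_real (m k) / (\<Phi> z - a k))" .
  moreover have "deriv \<Phi> z \<noteq> 0"
    by (rule holomorphic_injective_imp_regular[OF hol open_Compl_E inj_\<Phi>]) (use assms in simp)
  ultimately show ?thesis using deriv_J_eq_0_iff[OF assms] J_nz[OF assms] deg by (auto simp: divide_eq_0_iff)
qed

end

section \<open>Symmetry of the lemniscatic map\<close>

lemma order_prod_linear_powers:
  fixes b :: "nat \<Rightarrow> complex"
  assumes "finite I"
  shows "order x (\<Prod>j\<in>I. [:- b j, 1:] ^ k j) = (\<Sum>j\<in>I. if b j = x then k j else 0)"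
  using assms
proof (induction I)
  case (insert i I)
  have "(\<Prod>j\<in>insert i I. [:- b j, 1:] ^ k j) \<noteq> 0" using insert(1) by (subst prod_zero_iff) auto
  then have "order x (\<Prod>j\<in>insert i I. [:- b j, 1:] ^ k j) = order x ([:- b i, 1:] ^ k i) + order x (\<Prod>j\<in>I. [:- b j, 1:] ^ k j)"
    using insert(1,2) by (simp add: order_mult)
  moreover have "order x ([:- b i, 1:] ^ k i) = (if b i = x then k i else 0)"
  proof (cases "b i = x")
    case True
    then show ?thesis using order_power_n_n by auto
  next
    case False
    then have "order x ([:- b i, 1:] ^ k i) = 0" by (intro order_0I) auto
    then show ?thesis using False by simp
  qed
  ultimately show ?case using insert by simp
qed simp

section \<open>Lemniscates of polynomials and uniqueness of Walsh's map\<close>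

locale integral_lemniscatic_map = lemniscatic_map +
  fixes nj :: "nat \<Rightarrow> nat"
  assumes nj: "\<And>j. j \<in> {1..l} \<Longrightarrow> real (nj j) = degree P * m j"
    and sep: "\<And>j k. j \<in> {1..l} \<Longrightarrow> k \<in> {1..l} \<Longrightarrow> j \<noteq> k \<Longrightarrow> \<not> connected_component L (a j) (a k)"
begin

definition "A = (\<Prod>j=1..l. [:- a j, 1:] ^ nj j)"

lemma nj_pos: "j \<in> {1..l} \<Longrightarrow> nj j > 0"
  using nj[of j] m_pos[of j] deg by (metis mult_pos_pos of_nat_0_less_iff)

lemma poly_A: "poly A w = (\<Prod>j=1..l. (w - a j) ^ nj j)" by (simp add: A_def poly_prod)

lemma A_nz: "A \<noteq> 0" unfolding A_def by (subst prod_zero_iff) auto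

lemma poly_A_eq_0_iff: "poly A w = 0 \<longleftrightarrow> (\<exists>j\<in>{1..l}. w = a j)"
  using nj_pos by (auto simp: poly_A prod_zero_iff)

lemma l_pos: "1 \<in> {1..l}" using m_sum by (cases "l = 0") auto

lemma degree_A: "degree A > 0"
proof (rule ccontr)
  assume "\<not> degree A > 0"
  then obtain k where k: "A = [:k:]" using degree_eq_zeroE by blast
  have "poly A (a 1) = 0" using poly_A_eq_0_iff l_pos by blast
  then show False using k A_nz by simp
qed

lemma order_A: "j \<in> {1..l} \<Longrightarrow> order (a j) A = nj j"
proof -
  assume j: "j \<in> {1..l}"
  have "(\<Sum>k=1..l. if a k = a j then nj k else 0) = (\<Sum>k=1..l. if k = j then nj k else 0)"
    using inj_onD[OF inj_a _ _ j] by (intro sum.cong) auto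
  then show ?thesis using j by (simp add: A_def order_prod_linear_powers)
qed

lemma norm_A: "norm (poly A w) = (\<Prod>j=1..l. norm (w - a j) powr m j) ^ degree P"
proof -
  have "(norm (w - a j) powr m j) ^ degree P = norm (w - a j) ^ nj j" if "j \<in> {1..l}" for j
  proof (cases "w = a j")
    case False
    then have "(norm (w - a j) powr m j) ^ degree P = norm (w - a j) powr real (nj j)"
      by (simp add: powr_power nj[OF that] mult.commute)
    then show ?thesis using False by (simp add: powr_realpow)
  qed (use deg nj_pos[OF that] in \<open>simp add: zero_power\<close>)
  then show ?thesis by (simp add: poly_A prod_norm[symmetric] norm_power prod_power_distrib)
qed

lemma L_eq: "L = {w. norm (poly A w) \<le> c ^ degree P}"
proof -
  have "(\<Prod>j=1..l. norm (w - a j) powr m j) \<le> c \<longleftrightarrow> (\<Prod>j=1..l. norm (w - a j) powr m j) ^ degree P \<le> c ^ degree P" for w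
    using deg c_pos by (intro power_mono_iff[symmetric] prod_nonneg) auto
  then show ?thesis by (simp add: lemniscate_def norm_A)
qed

lemma Compl_L_eq: "- L = {w. c ^ degree P < norm (poly A w)}" by (auto simp: L_eq)

lemma compact_L: "compact L" unfolding L_eq by (rule compact_poly_sublevel[OF degree_A])

lemma norm_J_A: "z \<notin> E \<Longrightarrow> norm (J z) = 2 * norm (lead_coeff P) * norm (poly A (\<Phi> z))"
  by (simp add: norm_J_eq norm_A)

lemma sep_A:
  "poly A x = 0 \<Longrightarrow> poly A y = 0 \<Longrightarrow> x \<noteq> y \<Longrightarrow> \<not> connected_component {w. norm (poly A w) \<le> c ^ degree P} x y"
  using sep unfolding poly_A_eq_0_iff L_eq[symmetric] by blast

text \<open>If \<open>z\<close> stays bounded, so do \<open>P z\<close> and \<open>J z\<close>, and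
  the modulus identity keeps \<open>\<Phi> z\<close> in a bounded sublevel set of
  \<open>A\<close>.\<close>

lemma filterlim_inverse_at_infinity_lemniscate:
  assumes g: "\<And>z. z \<notin> E \<Longrightarrow> g (\<Phi> z) = z"
  shows "filterlim g at_infinity at_infinity"
  unfolding filterlim_at_infinity[OF order_refl]
proof (intro allI impI)
  fix M :: real assume "M > 0"
  have "compact (poly P ` cball 0 M)" by (intro compact_continuous_image continuous_intros compact_cball)
  then obtain N where N: "\<And>z. z \<in> cball 0 M \<Longrightarrow> norm (poly P z) \<le> N"
    using compact_imp_bounded by (metis bounded_iff imageI)
  have lc: "lead_coeff P \<noteq> 0" using deg by auto
  \<comment> \<open>\<open>norm (J z)\<close> is at most the focal sum, hence at most
    \<open>2 * N + 2\<close>; division by the constant of the modulus identity bounds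
    \<open>norm (poly A (\<Phi> z))\<close>.\<close>
  define K where "K = (2 * N + 2) / (2 * norm (lead_coeff P))"
  have "bounded ({w. norm (poly A w) \<le> K} \<union> L)"
    using compact_poly_sublevel[OF degree_A] compact_L by (intro bounded_Un[THEN iffD2] conjI compact_imp_bounded)
  then obtain B where B: "\<And>w. norm (poly A w) \<le> K \<or> w \<in> L \<Longrightarrow> norm w \<le> B" by (auto simp: bounded_iff)
  have "M \<le> norm (g w)" if "norm w \<ge> B + 1" for w
  proof (rule ccontr)
    assume "\<not> M \<le> norm (g w)"
    then have gM: "g w \<in> cball 0 M" by simp
    have "w \<notin> L" "norm (poly A w) > K" using B[of w] that by linarith+
    then obtain z where z: "z \<notin> E" "w = \<Phi> z" using image_\<Phi> by blast
    have Pz: "norm (poly P z) \<le> N" using N gM g[OF z(1)] z(2) by simp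
    have "2 * N + 2 = K * (2 * norm (lead_coeff P))" using lc by (simp add: K_def)
    also have "\<dots> < norm (poly A w) * (2 * norm (lead_coeff P))"
      using \<open>norm (poly A w) > K\<close> lc by (intro mult_strict_right_mono) auto
    also have "\<dots> = norm (J z)" using norm_J_A[OF z(1)] z(2) by simp
    also have "\<dots> \<le> norm (poly P z - 1) + norm (poly P z + 1)"
      unfolding norm_J_sum[OF z(1), symmetric] by simp
    also have "\<dots> \<le> 2 * norm (poly P z) + 2"
      using norm_triangle_ineq4[of "poly P z" 1] norm_triangle_ineq[of "poly P z" 1] by simp
    finally show False using Pz by simp
  qed
  then show "\<forall>\<^sub>F w in at_infinity. M \<le> norm (g w)" unfolding eventually_at_infinity by blast
qed

text \<open>The conjugate \<open>\<Psi>\<close> of \<open>\<Phi>\<close> by \<open>\<tau>\<close> is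
  again a lemniscatic map for \<open>E\<close>, with centers \<open>\<tau> (a j)\<close> and the
  same exponents, so \<open>\<Psi> \<circ> \<Phi>\<inverse>\<close> is a map between lemniscate
  exteriors to which the uniqueness theorem applies. Holomorphy of the conjugate is assumed directly
  because \<open>\<tau>\<close> may be complex conjugation. The centers then match because both
  polynomials have equal modulus on an open set.\<close>

theorem symmetry:
  assumes \<tau>\<tau>: "\<And>z. \<tau> (\<tau> z) = z" and norm_\<tau>: "\<And>z w. norm (\<tau> z - \<tau> w) = norm (z - w)" "\<And>z. norm (\<tau> z) = norm z"
    and \<tau>E: "\<And>z. \<tau> z \<in> E \<longleftrightarrow> z \<in> E"
    and hol\<tau>: "(\<lambda>z. \<tau> (\<Phi> (\<tau> z))) holomorphic_on - E"
  shows "\<And>z. z \<notin> E \<Longrightarrow> \<tau> (\<Phi> (\<tau> z)) = \<Phi> z"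
    and "\<And>j. j \<in> {1..l} \<Longrightarrow> \<exists>k\<in>{1..l}. a k = \<tau> (a j) \<and> nj k = nj j"
proof -
  define \<Psi> where "\<Psi> z = \<tau> (\<Phi> (\<tau> z))" for z
  define b where "b j = \<tau> (a j)" for j
  have norm_b: "norm (\<tau> w - a j) = norm (w - b j)" for w j
    using norm_\<tau>(1)[of w "b j"] by (simp add: b_def \<tau>\<tau>)
  have L': "w \<in> lemniscate l b m c \<longleftrightarrow> \<tau> w \<in> L" for w by (simp add: lemniscate_def norm_b)
  have bij': "bij_betw \<Psi> (- E) (- lemniscate l b m c)"
    unfolding bij_betw_def
  proof
    show "inj_on \<Psi> (- E)"
    proof (rule inj_onI)
      fix x y assume xy: "x \<in> - E" "y \<in> - E" "\<Psi> x = \<Psi> y"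
      then have "\<Phi> (\<tau> x) = \<Phi> (\<tau> y)" unfolding \<Psi>_def by (metis \<tau>\<tau>)
      then have "\<tau> x = \<tau> y" using inj_onD[OF inj_\<Phi>] xy \<tau>E by (metis ComplD ComplI)
      then show "x = y" by (metis \<tau>\<tau>)
    qed
    show "\<Psi> ` (- E) = - lemniscate l b m c"
    proof (intro equalityI subsetI)
      fix w assume "w \<in> \<Psi> ` (- E)"
      then show "w \<in> - lemniscate l b m c" using \<Phi>_notin_L \<tau>E by (auto simp: L' \<Psi>_def \<tau>\<tau>)
    next
      fix w assume "w \<in> - lemniscate l b m c"
      then have "\<tau> w \<in> \<Phi> ` (- E)" by (simp add: L' image_\<Phi>)
      then obtain z where z: "z \<notin> E" "\<tau> w = \<Phi> z" by blast
      then have "w = \<Psi> (\<tau> z)" by (metis \<Psi>_def \<tau>\<tau>)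
      then show "w \<in> \<Psi> ` (- E)" using z \<tau>E by blast
    qed
  qed
  have lim': "((\<lambda>z. \<Psi> z - z) \<longlongrightarrow> 0) at_infinity"
    unfolding tendsto_iff
  proof (intro allI impI)
    fix e :: real assume "e > 0"
    then obtain B where B: "\<And>z. B \<le> norm z \<Longrightarrow> norm (\<Phi> z - z) < e"
      using lim unfolding tendsto_iff eventually_at_infinity by (auto simp: dist_norm)
    have "norm (\<Psi> z - z) < e" if "B \<le> norm z" for z
      using B[of "\<tau> z"] that norm_\<tau>(1)[of "\<Phi> (\<tau> z)" "\<tau> z"] norm_\<tau>(2)[of z] by (simp add: \<Psi>_def \<tau>\<tau>)
    then show "\<forall>\<^sub>F z in at_infinity. dist (\<Psi> z - z) 0 < e" unfolding eventually_at_infinity by (auto simp: dist_norm)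
  qed
  have cont\<tau>: "continuous_on X \<tau>" for X
    unfolding continuous_on_iff dist_norm using norm_\<tau>(1) by metis
  interpret sym: integral_lemniscatic_map P S \<Psi> l b m c nj
  proof unfold_locales
    show "\<Psi> holomorphic_on - E" using hol\<tau> by (simp add: \<Psi>_def[abs_def])
    show "inj_on b {1..l}" using inj_a unfolding inj_on_def b_def by (metis \<tau>\<tau>)
    show "\<not> connected_component (lemniscate l b m c) (b j) (b k)" if jk: "j \<in> {1..l}" "k \<in> {1..l}" "j \<noteq> k" for j k
    proof
      assume "connected_component (lemniscate l b m c) (b j) (b k)"
      then obtain T where T: "connected T" "T \<subseteq> lemniscate l b m c" "b j \<in> T" "b k \<in> T"
        unfolding connected_component_def by blast
      have "connected (\<tau> ` T)" by (rule connected_continuous_image[OF cont\<tau> T(1)])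
      moreover have "\<tau> ` T \<subseteq> L" using T(2) L' by blast
      moreover have "a j \<in> \<tau> ` T" "a k \<in> \<tau> ` T" using T(3,4) \<tau>\<tau> unfolding b_def by (metis imageI)+
      ultimately have "connected_component L (a j) (a k)" unfolding connected_component_def by blast
      then show False using sep[OF jk] by blast
    qed
  qed (use bij' lim' m_pos m_sum c_nonneg nj in auto)
  obtain g where g: "g holomorphic_on (\<Phi> ` (- E))" "\<forall>z\<in>- E. g (\<Phi> z) = z"
    using holomorphic_inverse_exists[OF hol open_Compl_E inj_\<Phi>] by blast
  have g': "g w \<in> - E \<and> \<Phi> (g w) = w" if "c ^ degree P < norm (poly A w)" for w
  proof -
    have "w \<in> \<Phi> ` (- E)" using that unfolding image_\<Phi> Compl_L_eq by simp
    then show ?thesis using g(2) by auto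
  qed
  have f_eq: "\<Psi> (g w) = w" if w: "c ^ degree P < norm (poly A w)" for w
  proof (rule lemniscate_exterior_map_eq_ident[OF degree_A sym.degree_A _ sep_A sym.sep_A _ _ _ _ w])
    show "c ^ degree P > 0" using c_pos by simp
    show "(\<lambda>w. \<Psi> (g w)) holomorphic_on {w. c ^ degree P < norm (poly A w)}"
      using holomorphic_on_compose_gen[OF g(1) sym.hol] g' unfolding image_\<Phi> Compl_L_eq o_def by blast
    show "inj_on (\<lambda>w. \<Psi> (g w)) {w. c ^ degree P < norm (poly A w)}"
    proof (rule inj_onI)
      fix x y assume xy: "x \<in> {w. c ^ degree P < norm (poly A w)}" "y \<in> {w. c ^ degree P < norm (poly A w)}" "\<Psi> (g x) = \<Psi> (g y)"
      then have "g x = g y" using inj_onD[OF sym.inj_\<Phi> xy(3)] g' by blast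
      then show "x = y" using g' xy by (metis mem_Collect_eq)
    qed
    show "norm (poly sym.A (\<Psi> (g w))) = norm (poly A w)" if "c ^ degree P < norm (poly A w)" for w
    proof -
      have lc: "lead_coeff P \<noteq> 0" using deg by auto
      have "g w \<notin> E" "\<Phi> (g w) = w" using g'[OF that] by auto
      then have "2 * norm (lead_coeff P) * norm (poly sym.A (\<Psi> (g w))) = 2 * norm (lead_coeff P) * norm (poly A w)"
        using sym.norm_J_A[of "g w"] norm_J_A[of "g w"] by auto
      then show ?thesis using lc by auto
    qed
    have "filterlim g at_infinity at_infinity" using g(2) by (intro filterlim_inverse_at_infinity_lemniscate) auto
    \<comment> \<open>Both maps are asymptotic to the identity at \<open>g w\<close>, and
      \<open>\<Phi> (g w) = w\<close>, so subtraction leaves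
      \<open>\<Psi> (g w) - w\<close>.\<close>
    from filterlim_compose[OF lim' this] filterlim_compose[OF lim this]
    have "((\<lambda>w. (\<Psi> (g w) - g w) - (\<Phi> (g w) - g w)) \<longlongrightarrow> 0 - 0) at_infinity" by (rule tendsto_diff)
    moreover have "\<forall>\<^sub>F w in at_infinity. (\<Psi> (g w) - g w) - (\<Phi> (g w) - g w) = \<Psi> (g w) - w"
    proof -
      obtain B where B: "\<And>w. w \<in> L \<Longrightarrow> norm w \<le> B" using compact_imp_bounded[OF compact_L] by (auto simp: bounded_iff)
      have "c ^ degree P < norm (poly A w)" if "B + 1 \<le> norm w" for w
      proof -
        have "w \<in> - L" using B[of w] that by auto
        then show ?thesis unfolding Compl_L_eq by simp
      qed
      then show ?thesis unfolding eventually_at_infinity using g' by (intro exI[of _ "B + 1"]) auto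
    qed
    ultimately show "((\<lambda>w. \<Psi> (g w) - w) \<longlongrightarrow> 0) at_infinity" using Lim_transform_eventually by fastforce
  qed
  have \<Psi>\<Phi>: "\<Psi> z = \<Phi> z" if "z \<notin> E" for z
  proof -
    have "c ^ degree P < norm (poly A (\<Phi> z))" using \<Phi>_notin_L[OF that] Compl_L_eq by blast
    then show ?thesis using f_eq g(2) that by force
  qed
  then show "\<tau> (\<Phi> (\<tau> z)) = \<Phi> z" if "z \<notin> E" for z using that by (simp add: \<Psi>_def)
  have opL: "open (- L)" using compact_L by (simp add: compact_imp_closed open_Compl)
  have neL: "- L \<noteq> {}"
  proof
    assume "- L = {}"
    then have "L = UNIV" by blast
    then show False using compact_L not_compact_UNIV by metis
  qed
  have eqL: "norm (poly sym.A w) = norm (poly A w)" if w: "w \<in> - L" for w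
  proof -
    have "w \<in> \<Phi> ` (- E)" using w unfolding image_\<Phi> .
    then obtain z where z: "z \<notin> E" "w = \<Phi> z" by blast
    have lc: "lead_coeff P \<noteq> 0" using deg by auto
    have "2 * norm (lead_coeff P) * norm (poly sym.A w) = 2 * norm (lead_coeff P) * norm (poly A w)"
      using sym.norm_J_A[OF z(1)] norm_J_A[OF z(1)] \<Psi>\<Phi>[OF z(1)] z(2) by auto
    then show ?thesis using lc by auto
  qed
  obtain \<kappa> where \<kappa>: "\<kappa> \<noteq> 0" "sym.A = smult \<kappa> A"
    using norm_poly_eq_imp_smult[OF opL neL eqL A_nz] by blast
  show "\<exists>k\<in>{1..l}. a k = \<tau> (a j) \<and> nj k = nj j" if j: "j \<in> {1..l}" for j
  proof -
    have ord: "order (b j) A = nj j" using sym.order_A[OF j] \<kappa> by (simp add: order_smult)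
    then have "poly A (b j) = 0" using nj_pos[OF j] A_nz order_root[of A "b j"] by simp
    then obtain k where k: "k \<in> {1..l}" "b j = a k" using poly_A_eq_0_iff by blast
    then have "nj k = nj j" using order_A[OF k(1)] ord by simp
    then show ?thesis using k by (intro bexI[of _ k]) (auto simp: b_def)
  qed
qed

text \<open>Moving outward along the real axis from the outermost center increases the distance to
  every center. So the ray meets \<open>L\<close> in one segment, and its endpoint \<open>y\<close>
  belongs to the component of \<open>a i\<close> and is the last real point of \<open>L\<close> in
  that direction.\<close>

lemma extreme_center_surrounded:
  fixes \<sigma> x0 :: real
  assumes cnjE: "\<And>z. z \<notin> E \<Longrightarrow> cnj z \<notin> E" and cnj\<Phi>: "\<And>z. z \<notin> E \<Longrightarrow> \<Phi> (cnj z) = cnj (\<Phi> z)"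
    and real: "\<And>k. k \<in> {1..l} \<Longrightarrow> a k \<in> \<real>" and \<sigma>: "\<sigma> = 1 \<or> \<sigma> = -1"
    and i: "i \<in> {1..l}" "\<And>k. k \<in> {1..l} \<Longrightarrow> \<sigma> * Re (a k) \<le> \<sigma> * Re (a i)"
    and \<gamma>: "simple_path \<gamma>" "pathfinish \<gamma> = pathstart \<gamma>" "path_image \<gamma> \<subseteq> - E"
    and x0: "of_real x0 \<in> inside (path_image \<gamma>)" "of_real x0 \<in> E" "\<And>t. t > 0 \<Longrightarrow> of_real (x0 + \<sigma> * t) \<notin> E"
  obtains y where "y \<in> inside (path_image (\<Phi> \<circ> \<gamma>))" "connected_component L (a i) y"
proof -
  define r where "r t = complex_of_real (Re (a i) + \<sigma> * t)" for t
  have ai: "a i = r 0" using real[OF i(1)] by (simp add: r_def)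
  have contr: "continuous_on X r" for X unfolding r_def by (intro continuous_intros)
  have nr: "norm (r t - a k) = t + (\<sigma> * Re (a i) - \<sigma> * Re (a k))" if "t \<ge> 0" "k \<in> {1..l}" for t k
  proof -
    have "r t - a k = complex_of_real (Re (a i) + \<sigma> * t - Re (a k))"
      using real[OF that(2)] by (simp add: r_def)
    then have "norm (r t - a k) = \<bar>Re (a i) + \<sigma> * t - Re (a k)\<bar>" by (simp only: norm_of_real)
    then show ?thesis using \<sigma> i(2)[OF that(2)] that(1) by auto
  qed
  have mono: "r s \<in> L" if "0 \<le> s" "s \<le> t" "r t \<in> L" for s t
  proof -
    have "(\<Prod>k=1..l. norm (r s - a k) powr m k) \<le> (\<Prod>k=1..l. norm (r t - a k) powr m k)"
    proof (intro prod_mono conjI powr_mono2)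
      fix k assume k: "k \<in> {1..l}"
      show "norm (r s - a k) \<le> norm (r t - a k)" using nr[OF _ k] that by simp
      show "0 \<le> m k" using m_pos[OF k] by simp
    qed auto
    then show ?thesis using that(3) by (simp add: lemniscate_def)
  qed
  \<comment> \<open>The ray parameters that lie in \<open>L\<close>; the largest one gives the
    endpoint of the segment.\<close>
  define Y where "Y = {0..} \<inter> r -` L"
  have "closed Y" unfolding Y_def
    using continuous_closed_preimage[OF contr closed_atLeast compact_imp_closed[OF compact_L]] .
  moreover have "bounded Y"
  proof -
    obtain B where B: "\<And>w. w \<in> L \<Longrightarrow> norm w \<le> B" using compact_imp_bounded[OF compact_L] by (auto simp: bounded_iff)
    have "norm t \<le> B + norm (a i)" if "t \<in> Y" for t
    proof -
      have "norm (r t - a i) = t" "t \<ge> 0" using nr[OF _ i(1), of t] that by (auto simp: Y_def)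
      then show ?thesis using B[of "r t"] norm_triangle_ineq4[of "r t" "a i"] that by (auto simp: Y_def)
    qed
    then show ?thesis unfolding bounded_iff by blast
  qed
  moreover have "0 \<in> Y" using a_in_L[OF i(1)] by (simp add: Y_def ai[symmetric])
  ultimately have "compact Y" "Y \<noteq> {}" by (auto simp: compact_eq_bounded_closed)
  then obtain t' where t': "t' \<in> Y" "\<And>t. t \<in> Y \<Longrightarrow> t \<le> t'" by (meson compact_attains_sup)
  have tL: "r t' \<in> L" "t' \<ge> 0" using t'(1) by (auto simp: Y_def)
  show ?thesis
  proof (rule that)
    have "connected (r ` {0..t'})" by (rule connected_continuous_image[OF contr]) simp
    moreover have "r ` {0..t'} \<subseteq> L" using mono[OF _ _ tL(1)] by auto
    moreover have "a i \<in> r ` {0..t'}" "r t' \<in> r ` {0..t'}" using ai tL(2) by auto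
    ultimately show "connected_component L (a i) (r t')" unfolding connected_component_def by blast
    have "of_real (Re (a i) + \<sigma> * t') \<in> inside (path_image (\<Phi> \<circ> \<gamma>))"
    proof (rule surrounded_component_extreme_real[OF open_Compl_E connected_Compl_preimage_interval[OF deg] _ hol inj_\<Phi> lim _ _ \<gamma> \<sigma> x0(1)])
      show "bounded (- (- E))" using bounded_preimage_interval[OF deg] by simp
      show "of_real (Re (a i) + \<sigma> * t') \<notin> \<Phi> ` (- E)" using tL(1) by (simp add: image_\<Phi> r_def)
      show "of_real (Re (a i) + \<sigma> * t' + \<sigma> * t) \<in> \<Phi> ` (- E)" if "t > 0" for t
      proof -
        have "t' + t \<notin> Y" using t'(2)[of "t' + t"] that by auto
        then have "r (t' + t) \<notin> L" using tL(2) that by (simp add: Y_def)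
        then show ?thesis by (simp add: image_\<Phi> r_def algebra_simps)
      qed
    qed (use cnjE cnj\<Phi> x0 in auto)
    then show "r t' \<in> inside (path_image (\<Phi> \<circ> \<gamma>))" by (simp add: r_def)
  qed
qed

end

section \<open>The centers in the symmetric three-component case\<close>

text \<open>Solves the value of \<open>norm (J z)\<close> at a critical point for
  \<open>\<beta>\<close>: because \<open>n = n2 + 2 * n3\<close>, the numerical factors rescale it
  to \<open>(\<beta> / sqrt n) ^ n\<close>.\<close>

lemma center_formula:
  fixes \<beta> K :: real and n n2 n3 :: nat
  assumes n: "n2 + 2 * n3 = n" and "n2 > 0" "n3 > 0" "\<beta> > 0" "K > 0"
  shows "\<beta> = sqrt (real n) * root n (2 * K * ((sqrt (real n2 / real n) * \<beta>) ^ n2 * (2 * real n3 / real n * \<beta>\<^sup>2) ^ n3) /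
    (2 * K * real n2 powr (real n2 / 2) * (2 * real n3) ^ n3))"
proof -
  have "n > 0" using assms by simp
  have sq: "sqrt (real n) * sqrt (real n) = real n" by simp
  have p2: "real n2 powr (real n2 / 2) = sqrt (real n2) ^ n2"
    using \<open>n2 > 0\<close> by (simp add: powr_half_sqrt_powr powr_realpow real_sqrt_power)
  have "(\<beta> / sqrt (real n)) ^ n = (\<beta> / sqrt (real n)) ^ n2 * ((\<beta> / sqrt (real n)) ^ 2) ^ n3"
    unfolding n[symmetric] by (simp only: power_add power_mult)
  also have "(\<beta> / sqrt (real n)) ^ 2 = \<beta>\<^sup>2 / real n" by (simp add: power_divide)
  also have "(\<beta> / sqrt (real n)) ^ n2 * (\<beta>\<^sup>2 / real n) ^ n3 =
     2 * K * ((sqrt (real n2 / real n) * \<beta>) ^ n2 * (2 * real n3 / real n * \<beta>\<^sup>2) ^ n3) /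
    (2 * K * real n2 powr (real n2 / 2) * (2 * real n3) ^ n3)"
    unfolding p2 using assms(2,3,5) \<open>n > 0\<close>
    by (simp add: real_sqrt_divide power_mult_distrib power_divide)
  finally have "root n (2 * K * ((sqrt (real n2 / real n) * \<beta>) ^ n2 * (2 * real n3 / real n * \<beta>\<^sup>2) ^ n3) /
    (2 * K * real n2 powr (real n2 / 2) * (2 * real n3) ^ n3)) = root n ((\<beta> / sqrt (real n)) ^ n)" by simp
  also have "\<dots> = \<beta> / sqrt (real n)" using \<open>n > 0\<close> \<open>\<beta> > 0\<close> by (simp add: real_root_power_cancel)
  finally show ?thesis using \<open>n > 0\<close> by simp
qed

text \<open>Negation acts as an involution on three points, so it fixes one, which must be 0, and
  exchanges the other two.\<close>

lemma three_points_symmetric: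
  fixes a :: "nat \<Rightarrow> complex" and k :: "nat \<Rightarrow> nat"
  assumes inj: "inj_on a {1..3}" and sym: "\<And>i. i \<in> {1..3} \<Longrightarrow> \<exists>j\<in>{1..3}. a j = - a i \<and> k j = k i"
  obtains p q r where "{1..3} = {p, q, r}" "p \<noteq> q" "p \<noteq> r" "q \<noteq> r" "a p = 0" "a r = - a q" "k r = k q" "a q \<noteq> 0"
proof -
  have s3: "{1..3} = {1, 2, 3::nat}" by auto
  have ne: "a 1 \<noteq> a 2" "a 1 \<noteq> a 3" "a 2 \<noteq> a 3" using inj unfolding s3 by (auto simp: inj_on_def)
  have neg: "x = 0" if "x = - x" for x :: complex using that by (simp add: complex_eq_iff)
  from sym[unfolded s3, of 1] consider "a 1 = - a 1" | "a 2 = - a 1" "k 2 = k 1" | "a 3 = - a 1" "k 3 = k 1"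
    by auto
  then show ?thesis
  proof cases
    case 1
    then have a1: "a 1 = 0" by (rule neg)
    from sym[unfolded s3, of 2] consider "a 2 = - a 2" | "a 1 = - a 2" | "a 3 = - a 2" "k 3 = k 2" by auto
    then show ?thesis
    proof cases
      case 1
      then show ?thesis using neg ne a1 by metis
    next
      case 2
      then show ?thesis using ne a1 by simp
    next
      case 3
      show ?thesis by (rule that[of 1 2 3]) (use 3 a1 ne s3 in auto)
    qed
  next
    case 2
    from sym[unfolded s3, of 3] consider "a 3 = - a 3" | "a 1 = - a 3" | "a 2 = - a 3" by auto
    then show ?thesis
    proof cases
      case 1
      then have "a 3 = 0" by (rule neg)
      show ?thesis by (rule that[of 3 1 2]) (use 2 \<open>a 3 = 0\<close> ne s3 in auto)
    qed (use 2 ne in auto)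
  next
    case 3
    from sym[unfolded s3, of 2] consider "a 2 = - a 2" | "a 1 = - a 2" | "a 3 = - a 2" by auto
    then show ?thesis
    proof cases
      case 1
      then have "a 2 = 0" by (rule neg)
      show ?thesis by (rule that[of 2 1 3]) (use 3 \<open>a 2 = 0\<close> ne s3 in auto)
    qed (use 3 ne in auto)
  qed
qed

lemma connected_cnj_invariant_meets_real:
  assumes "connected C" "C \<noteq> {}" "cnj ` C = C"
  obtains x where "complex_of_real x \<in> C"
proof -
  obtain z where z: "z \<in> C" using assms(2) by blast
  then have cz: "cnj z \<in> C" using assms(3) by blast
  have con: "connected (Im ` C)" by (intro connected_continuous_image[OF _ assms(1)] continuous_intros)
  have im: "Im z \<in> Im ` C" "Im (cnj z) \<in> Im ` C" using z cz by (blast intro: imageI)+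
  have "0 \<in> Im ` C"
  proof (cases "Im z \<le> 0")
    case True
    then show ?thesis using connectedD_interval[OF con im(1,2), of 0] by simp
  next
    case False
    then show ?thesis using connectedD_interval[OF con im(2,1), of 0] by simp
  qed
  then obtain w where "w \<in> C" "Im w = 0" by auto
  then have "complex_of_real (Re w) \<in> C" by (simp add: complex_eq_iff complex_is_Real_iff)
  then show ?thesis by (rule that)
qed

lemma compact_real_trace_extreme:
  fixes K :: "complex set" and \<sigma> :: real
  assumes "compact K" "complex_of_real x \<in> K" "\<sigma> = 1 \<or> \<sigma> = -1"
  obtains x0 where "complex_of_real x0 \<in> K" "\<And>y. complex_of_real y \<in> K \<Longrightarrow> \<sigma> * y \<le> \<sigma> * x0"
proof -
  define X where "X = complex_of_real -` K"
  have "closed X" unfolding X_def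
    by (rule continuous_closed_vimage[OF compact_imp_closed[OF assms(1)]]) (intro continuous_intros)
  moreover obtain B where B: "\<And>w. w \<in> K \<Longrightarrow> norm w \<le> B" using compact_imp_bounded[OF assms(1)] by (auto simp: bounded_iff)
  have "norm t \<le> B" if "t \<in> X" for t using B[of "of_real t"] that by (simp add: X_def)
  then have "bounded X" unfolding bounded_iff by blast
  ultimately have "compact X" by (simp add: compact_eq_bounded_closed)
  moreover have "X \<noteq> {}" using assms(2) by (auto simp: X_def)
  moreover have "continuous_on X (\<lambda>t. \<sigma> * t)" by (intro continuous_intros)
  ultimately obtain x0 where "x0 \<in> X" "\<forall>y\<in>X. \<sigma> * y \<le> \<sigma> * x0" using continuous_attains_sup by metis
  then show ?thesis by (intro that[of x0]) (auto simp: X_def)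
qed

section \<open>Critical points and critical values for centers symmetric about 0\<close>

context integral_lemniscatic_map
begin

text \<open>With weights \<open>m p, m q, m q\<close> at \<open>0, b, -b\<close> the sum in
  \<open>critical_point_iff\<close> has numerator
  \<open>w\<^sup>2 - (1 - 2 * m q) * b\<^sup>2\<close>, and
  \<open>1 - 2 * m q = m p\<close>.\<close>

lemma critical_point_iff_symmetric:
  assumes I: "{1..l} = {p, q, r}" "p \<noteq> q" "p \<noteq> r" "q \<noteq> r"
    and a: "a p = 0" "a r = - a q" "nj r = nj q" and z: "z \<notin> E"
  shows "poly (pderiv P) z = 0 \<longleftrightarrow> (\<Phi> z)\<^sup>2 = of_real (m p) * (a q)\<^sup>2"
proof -
  have mem: "p \<in> {1..l}" "q \<in> {1..l}" "r \<in> {1..l}" using I(1) by auto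
  have "m r = m q" using nj[OF mem(2)] nj[OF mem(3)] a(3) deg by simp
  moreover have sum: "(\<Sum>j=1..l. f j) = f p + (f q + f r)" for f :: "nat \<Rightarrow> 'z::comm_monoid_add"
    unfolding I(1) using I(2-4) by simp
  moreover have "m p + (m q + m r) = 1" using m_sum unfolding sum .
  ultimately have m2: "m p = 1 - 2 * m q" by simp
  let ?w = "\<Phi> z" and ?b = "a q" and ?mq = "complex_of_real (m q)"
  have ne: "?w \<noteq> 0" "?w - ?b \<noteq> 0" "?w + ?b \<noteq> 0"
    using \<Phi>_ne_a[OF z] mem a by (metis, metis right_minus_eq, metis add.inverse_inverse add_eq_0_iff minus_minus)
  have "(\<Sum>j=1..l. of_real (m j) / (?w - a j)) = (1 - 2 * ?mq) / ?w + (?mq / (?w - ?b) + ?mq / (?w + ?b))"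
    unfolding sum using \<open>m r = m q\<close> a m2 by simp
  also have "\<dots> = (?w\<^sup>2 - (1 - 2 * ?mq) * ?b\<^sup>2) / (?w * (?w - ?b) * (?w + ?b))"
    using ne by (simp add: divide_simps) (simp add: algebra_simps power2_eq_square)
  finally show ?thesis unfolding critical_point_iff[OF z] using ne m2 by simp
qed

text \<open>At such a point \<open>w = \<Phi> z\<close> has norm
  \<open>sqrt (m p) * \<beta>\<close>, and the distances to the outer centers have product
  \<open>norm (w\<^sup>2 - \<beta>\<^sup>2) = (1 - m p) * \<beta>\<^sup>2 = 2 * m r *
  \<beta>\<^sup>2\<close>. The modulus identity needs only these two numbers.\<close>

lemma norm_J_critical:
  assumes I: "{1..l} = {p, q, r}" "p \<noteq> q" "p \<noteq> r" "q \<noteq> r"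
    and a: "a p = 0" "a r = of_real \<beta>" "a q = - of_real \<beta>" "nj r = nj q" "\<beta> > 0"
    and z: "z \<notin> E" "(\<Phi> z)\<^sup>2 = of_real (m p * \<beta>\<^sup>2)"
  shows "norm (J z) = 2 * norm (lead_coeff P) *
      ((sqrt (real (nj p) / real (degree P)) * \<beta>) ^ nj p * (2 * real (nj r) / real (degree P) * \<beta>\<^sup>2) ^ nj r)"
    and "nj p + 2 * nj r = degree P"
proof -
  have mem: "p \<in> {1..l}" "q \<in> {1..l}" "r \<in> {1..l}" using I(1) by auto
  let ?n = "degree P"
  have "?n > 0" using deg .
  have mj: "m j = real (nj j) / real ?n" if "j \<in> {1..l}" for j using nj[OF that] \<open>?n > 0\<close> by simp
  have "m p + (m q + m r) = 1" using m_sum unfolding I(1) using I(2-4) by simp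
  then have "real ?n * m p + (real ?n * m q + real ?n * m r) = real ?n"
    by (metis mult.right_neutral ring_distribs(1))
  then have "real (nj p) + (real (nj q) + real (nj r)) = real ?n"
    by (simp only: nj[OF mem(1)] nj[OF mem(2)] nj[OF mem(3)])
  then have "real (nj p + 2 * nj r) = real ?n" using a(4) by simp
  then show sum: "nj p + 2 * nj r = ?n" by (simp only: of_nat_eq_iff)
  have mp: "m p \<ge> 0" using m_pos[OF mem(1)] by simp
  have "norm (\<Phi> z) ^ 2 = m p * \<beta>\<^sup>2" using z(2) mp by (simp only: norm_power[symmetric] norm_of_real) simp
  then have "norm (\<Phi> z) = sqrt (m p * \<beta>\<^sup>2)" by (simp add: real_sqrt_unique)
  then have n1: "norm (\<Phi> z) = sqrt (m p) * \<beta>" using a(5) by (simp add: real_sqrt_mult)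
  have "norm (\<Phi> z - a q) * norm (\<Phi> z - a r) = norm ((\<Phi> z)\<^sup>2 - of_real (\<beta>\<^sup>2))"
    unfolding a by (simp add: norm_mult[symmetric] power2_eq_square algebra_simps)
  also have "(\<Phi> z)\<^sup>2 - of_real (\<beta>\<^sup>2) = of_real (- ((1 - m p) * \<beta>\<^sup>2))" unfolding z(2) by (simp add: algebra_simps)
  also have "norm (complex_of_real (- ((1 - m p) * \<beta>\<^sup>2))) = (1 - m p) * \<beta>\<^sup>2"
    unfolding norm_of_real using \<open>m p + (m q + m r) = 1\<close> m_pos[OF mem(2)] m_pos[OF mem(3)] by simp
  also have "1 - m p = 2 * real (nj r) / real ?n"
    using \<open>m p + (m q + m r) = 1\<close> mj[OF mem(2)] mj[OF mem(3)] a(4) by simp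
  finally have n2: "norm (\<Phi> z - a q) * norm (\<Phi> z - a r) = 2 * real (nj r) / real ?n * \<beta>\<^sup>2" .
  have "norm (poly A (\<Phi> z)) = norm (\<Phi> z) ^ nj p * (norm (\<Phi> z - a q) * norm (\<Phi> z - a r)) ^ nj r"
    unfolding poly_A I(1) using I(2-4) a(1,4) by (simp add: norm_mult norm_power power_mult_distrib)
  then show "norm (J z) = 2 * norm (lead_coeff P) *
      ((sqrt (real (nj p) / real (degree P)) * \<beta>) ^ nj p * (2 * real (nj r) / real (degree P) * \<beta>\<^sup>2) ^ nj r)"
    unfolding norm_J_A[OF z(1)] by (simp only: n1 n2 mj[OF mem(1)])
qed

end

theorem theorem4p2:
  fixes P :: "complex poly" and n :: nat and p\<^sub>n :: complex
    and E :: "complex set" and Ej :: "nat \<Rightarrow> complex set"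
    and nj :: "nat \<Rightarrow> nat" and z\<^sub>1 z\<^sub>2 :: real
    and a :: "nat \<Rightarrow> complex" and S :: "complex \<Rightarrow> complex"
  assumes "degree P = n" and "n \<ge> 1" and "lead_coeff P = p\<^sub>n"
    and "E = preimage_interval P"
    and "bij_betw Ej {1..3} (components E)"
    and "\<And>j x y. j \<in> {1, 2} \<Longrightarrow> complex_of_real x \<in> Ej j \<Longrightarrow> complex_of_real y \<in> Ej (j + 1) \<Longrightarrow> x < y"
    and "uminus ` E = E"
    and "\<And>j. j \<in> {1..3} \<Longrightarrow> cnj ` Ej j = Ej j"
    and "\<And>j. j \<in> {1..3} \<Longrightarrow> nj j = zero_count P (Ej j)"
    and "z\<^sub>1 < z\<^sub>2"
    and "{x :: real. complex_of_real x \<notin> E \<and> poly (pderiv P) (complex_of_real x) = 0} = {z\<^sub>1, z\<^sub>2}"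
    and "walsh_centers 3 Ej a"
    and "sqrt_branch P S"
  shows "z\<^sub>2 = - z\<^sub>1 \<and> nj 1 = nj 3 \<and>
    a 1 \<in> \<real> \<and> a 3 \<in> \<real> \<and> Re (a 1) < 0 \<and> a 2 = 0 \<and> 0 < Re (a 3) \<and> a 1 = - a 3 \<and>
    (\<forall>z\<in>{z\<^sub>1, z\<^sub>2}.
       a 3 = complex_of_real (sqrt (real n) *
         root n (norm (poly P (complex_of_real z) + S (complex_of_real z)) /
           (2 * norm p\<^sub>n * real (nj 2) powr (real (nj 2) / 2) * (2 * real (nj 3)) ^ nj 3))))"
proof -
  note E = assms(4) and Ej = assms(5) and order = assms(6) and negE = assms(7) and cnjEj = assms(8)
    and nj = assms(9) and z12 = assms(10) and crit = assms(11)
  have deg: "degree P > 0" using assms(1,2) by simp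
  have UE: "(\<Union>j\<in>{1..3}. Ej j) = E" using Ej Union_components[of E] by (simp add: bij_betw_def)
  obtain m \<Phi> where W: "walsh_map 3 Ej a m \<Phi>" using assms(12) unfolding walsh_centers_def by blast
  define c where "c = log_capacity E"
  define L where "L = lemniscate 3 a m c"
  have W': "inj_on a {1..3}" "\<forall>j\<in>{1..3}. m j > 0" "(\<Sum>j=1..3. m j) = 1"
    "\<Phi> holomorphic_on (- E)" "bij_betw \<Phi> (- E) (- L)"
    "(\<lambda>z. \<Phi> z - z) \<in> O[at_infinity](\<lambda>z. 1 / z)"
    "\<exists>Lj. bij_betw Lj {1..3} (components L) \<and> (\<forall>j\<in>{1..3}. a j \<in> Lj j \<and>
       (\<exists>\<gamma>. path_image \<gamma> \<subseteq> - E \<and> jordan_surrounds \<gamma> (Ej j) E \<and> jordan_surrounds (\<Phi> \<circ> \<gamma>) (Lj j) L))"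
    using W unfolding walsh_map_def UE Let_def c_def L_def by auto
  have lim: "((\<lambda>z. \<Phi> z - z) \<longlongrightarrow> 0) at_infinity"
  proof -
    obtain k where k: "\<forall>\<^sub>F z in at_infinity. norm (\<Phi> z - z) \<le> k * norm (1 / z)"
      using W'(6) by (auto elim!: landau_o.bigE)
    have "((\<lambda>z::complex. k * norm (inverse z)) \<longlongrightarrow> k * norm (0::complex)) at_infinity"
      by (intro tendsto_intros tendsto_inverse_0)
    then have "((\<lambda>z. k * norm (1 / z)) \<longlongrightarrow> 0) (at_infinity :: complex filter)" by (simp add: inverse_eq_divide)
    then show ?thesis by (rule Lim_null_comparison[OF k])
  qed
  obtain Lj where Lj: "bij_betw Lj {1..3} (components L)" "\<And>j. j \<in> {1..3} \<Longrightarrow> a j \<in> Lj j"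
    and ex\<gamma>: "\<And>j. j \<in> {1..3} \<Longrightarrow> \<exists>\<gamma>. path_image \<gamma> \<subseteq> - E \<and> jordan_surrounds \<gamma> (Ej j) E \<and> jordan_surrounds (\<Phi> \<circ> \<gamma>) (Lj j) L"
    using W'(7) by blast
  have Lj_comp: "Lj j = connected_component_set L (a j)" if "j \<in> {1..3}" for j
  proof -
    have "Lj j \<in> components L" using bij_betwE[OF Lj(1)] that by blast
    then obtain x where "Lj j = connected_component_set L x" unfolding components_iff by blast
    then show ?thesis using Lj(2)[OF that] connected_component_eq by metis
  qed
  \<comment> \<open>Each component of \<open>L\<close> contains exactly one center; this is the
    separation required for the uniqueness argument.\<close>
  have in_Lj: "k = j" if "j \<in> {1..3}" "k \<in> {1..3}" "a k \<in> Lj j" for j k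
  proof -
    have "Lj j = Lj k" using connected_component_eq[of "a k" L "a j"] that(3) Lj_comp[OF that(1)] Lj_comp[OF that(2)] by simp
    then show ?thesis using Lj(1) that(1,2) unfolding bij_betw_def inj_on_def by blast
  qed
  interpret M: lemniscatic_map P S \<Phi> 3 a m c
  proof unfold_locales
    show "c \<ge> 0" by (simp add: c_def log_capacity_def)
  qed (use deg assms(13) W' lim in \<open>auto simp: E L_def\<close>)
  have \<gamma>nj: "real (nj j) = degree P * m j" if j: "j \<in> {1..3}" for j
  proof -
    obtain \<gamma> where \<gamma>: "path_image \<gamma> \<subseteq> - E" "jordan_surrounds \<gamma> (Ej j) E" "jordan_surrounds (\<Phi> \<circ> \<gamma>) (Lj j) L"
      using ex\<gamma>[OF j] by blast
    have "real (zero_count P (Ej j)) = degree P * m j"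
    proof (rule M.exponent_eq_zero_count[OF _ _ _ _ _ _ j])
      show "a k \<in> outside (path_image (\<Phi> \<circ> \<gamma>))" if "k \<in> {1..3}" "k \<noteq> j" for k
      proof -
        have "a k \<in> L - Lj j" using M.a_in_L[OF that(1)] in_Lj[OF j that(1)] that(2) by (auto simp: L_def)
        then show ?thesis using \<gamma>(3) unfolding jordan_surrounds_def by blast
      qed
      show "a j \<in> inside (path_image (\<Phi> \<circ> \<gamma>))" using \<gamma>(3) Lj(2)[OF j] unfolding jordan_surrounds_def by blast
    qed (use \<gamma> in \<open>auto simp: jordan_surrounds_def E\<close>)
    then show ?thesis using nj[OF j] by simp
  qed
  interpret I: integral_lemniscatic_map P S \<Phi> 3 a m c nj
  proof unfold_locales
    show "\<not> connected_component (lemniscate 3 a m c) (a j) (a k)" if jk: "j \<in> {1..3}" "k \<in> {1..3}" "j \<noteq> k" for j k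
      using in_Lj[OF jk(1,2)] Lj_comp[OF jk(1)] jk(3) by (auto simp: L_def)
  qed (rule \<gamma>nj)
  have E_neg: "- z \<in> E \<longleftrightarrow> z \<in> E" for z using negE by (metis imageI minus_minus)
  have E_cnj: "cnj z \<in> E" if z: "z \<in> E" for z
  proof -
    obtain j where j: "j \<in> {1..3}" "z \<in> Ej j" using z UE by blast
    then have "cnj z \<in> Ej j" using cnjEj[OF j(1)] by blast
    then show ?thesis using UE j(1) by blast
  qed
  have E_cnj': "cnj z \<in> E \<longleftrightarrow> z \<in> E" for z using E_cnj[of z] E_cnj[of "cnj z"] by auto
  have hol_neg: "(\<lambda>z. - \<Phi> (- z)) holomorphic_on - E"
    using E_neg by (intro holomorphic_intros holomorphic_on_compose_gen[OF _ W'(4), unfolded o_def]) auto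
  have "cnj ` (- E) = - E"
  proof (intro equalityI subsetI)
    fix z assume "z \<in> - E"
    then have "cnj (cnj z) \<in> cnj ` (- E)" using E_cnj'[of z] by (intro imageI) simp
    then show "z \<in> cnj ` (- E)" by simp
  qed (use E_cnj' in auto)
  then have hol_cnj: "(\<lambda>z. cnj (\<Phi> (cnj z))) holomorphic_on - E"
    using holomorphic_on_compose_cnj_cnj[of \<Phi> "- E"] W'(4) M.open_Compl_E by (simp add: o_def E)
  have neg: "- \<Phi> (- z) = \<Phi> z" if "z \<notin> E" for z
    by (rule I.symmetry(1)[of uminus]) (use that hol_neg E_neg in \<open>auto simp: E norm_minus_commute\<close>)
  have neg_a: "\<exists>k\<in>{1..3}. a k = - a j \<and> nj k = nj j" if "j \<in> {1..3}" for j
    by (rule I.symmetry(2)[of uminus]) (use that hol_neg E_neg in \<open>auto simp: E norm_minus_commute\<close>)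
  have cnj: "cnj (\<Phi> (cnj z)) = \<Phi> z" if "z \<notin> E" for z
    by (rule I.symmetry(1)[of cnj]) (use that hol_cnj E_cnj' in \<open>auto simp: E simp flip: complex_cnj_diff\<close>)
  have cnj': "\<Phi> (cnj z) = cnj (\<Phi> z)" if "z \<notin> E" for z using cnj[OF that] by (metis complex_cnj_cnj)
  \<comment> \<open>\<open>p\<close> is the index of the center 0. Which labels the indices carry is
    still open.\<close>
  obtain p q0 r0 where I0: "{1..3} = {p, q0, r0}" "p \<noteq> q0" "p \<noteq> r0" "q0 \<noteq> r0"
    "a p = 0" "a r0 = - a q0" "nj r0 = nj q0" "a q0 \<noteq> 0"
    using three_points_symmetric[OF W'(1) neg_a] by metis
  have crit_iff: "poly (pderiv P) z = 0 \<longleftrightarrow> (\<Phi> z)\<^sup>2 = of_real (m p) * (a q0)\<^sup>2" if "z \<notin> E" for z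
    by (rule I.critical_point_iff_symmetric[OF I0(1-7)]) (use that E in simp)
  have crit_z: "of_real z \<notin> E" "(\<Phi> (of_real z))\<^sup>2 = of_real (m p) * (a q0)\<^sup>2" if "z \<in> {z\<^sub>1, z\<^sub>2}" for z
  proof -
    have z: "complex_of_real z \<notin> E \<and> poly (pderiv P) (complex_of_real z) = 0" using that crit by blast
    then show "of_real z \<notin> E" by simp
    show "(\<Phi> (of_real z))\<^sup>2 = of_real (m p) * (a q0)\<^sup>2" using z crit_iff by blast
  qed
  \<comment> \<open>The critical equation involves only the square of the odd map
    \<open>\<Phi>\<close>, so negation preserves the two-point set of real critical points off
    \<open>E\<close>.\<close>
  have z21: "z\<^sub>2 = - z\<^sub>1"
  proof -
    have "- z \<in> {z\<^sub>1, z\<^sub>2}" if z: "z \<in> {z\<^sub>1, z\<^sub>2}" for z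
    proof -
      have nz: "complex_of_real (- z) \<notin> E" using crit_z(1)[OF z] E_neg by simp
      have "\<Phi> (of_real (- z)) = - \<Phi> (of_real z)" using neg[OF crit_z(1)[OF z]] by (metis minus_minus of_real_minus)
      then have "(\<Phi> (of_real (- z)))\<^sup>2 = of_real (m p) * (a q0)\<^sup>2" using crit_z(2)[OF z] by simp
      then have "poly (pderiv P) (of_real (- z)) = 0" using crit_iff[OF nz] by blast
      then show ?thesis using nz crit by blast
    qed
    from this[of z\<^sub>1] this[of z\<^sub>2] show ?thesis using z12 by auto
  qed
  have mp: "m p > 0" using W'(2) I0(1) by blast
  \<comment> \<open>\<open>\<Phi>\<close> is real at the real point \<open>z\<^sub>2\<close> and
    nonzero there, as 0 is a center and lies in \<open>L\<close>. So the square of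
    \<open>a q0\<close> is positive, which excludes imaginary centers.\<close>
  have "Im (a q0) = 0"
  proof -
    define x where "x = Re (\<Phi> (of_real z\<^sub>2))"
    have z2: "complex_of_real z\<^sub>2 \<notin> E" using crit_z(1) by blast
    have "cnj (\<Phi> (of_real z\<^sub>2)) = \<Phi> (of_real z\<^sub>2)" using cnj'[OF z2] by simp
    then have x: "\<Phi> (of_real z\<^sub>2) = of_real x" unfolding x_def by (metis Reals_cnj_iff of_real_Re)
    have "\<Phi> (of_real z\<^sub>2) \<noteq> a p" by (rule M.\<Phi>_ne_a) (use z2 E I0(1) in auto)
    then have "x \<noteq> 0" using I0(5) x by auto
    have "of_real (m p) * (a q0)\<^sup>2 = complex_of_real (x\<^sup>2)" using crit_z(2)[of z\<^sub>2] x by simp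
    then have "m p * ((Re (a q0))\<^sup>2 - (Im (a q0))\<^sup>2) = x\<^sup>2" "m p * (2 * Re (a q0) * Im (a q0)) = 0"
      by (auto simp: complex_eq_iff power2_eq_square)
    then have "(Re (a q0))\<^sup>2 - (Im (a q0))\<^sup>2 > 0" "Re (a q0) * Im (a q0) = 0"
      using mp \<open>x \<noteq> 0\<close> by (metis zero_less_mult_pos zero_less_power2, simp)
    then show ?thesis by (smt (verit) mult_eq_0_iff zero_le_power2 power_zero_numeral)
  qed
  define \<beta> where "\<beta> = \<bar>Re (a q0)\<bar>"
  have aq0: "a q0 = of_real (Re (a q0))" using \<open>Im (a q0) = 0\<close> by (simp add: complex_eq_iff)
  have "\<beta> > 0" using I0(8) aq0 unfolding \<beta>_def by (metis of_real_0 zero_less_abs_iff)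
  have sq: "(a q0)\<^sup>2 = of_real (\<beta>\<^sup>2)" by (subst aq0) (simp add: \<beta>_def)
  obtain q r where I1: "{1..3} = {p, q, r}" "p \<noteq> q" "p \<noteq> r" "q \<noteq> r" "a q = - of_real \<beta>" "a r = of_real \<beta>" "nj r = nj q"
  proof (cases "Re (a q0) < 0")
    case True
    then have "a q0 = - of_real \<beta>" using aq0 by (simp add: \<beta>_def)
    then show ?thesis using I0 by (intro that[of q0 r0]) auto
  next
    case False
    then have "a q0 = of_real \<beta>" using aq0 by (simp add: \<beta>_def)
    then show ?thesis using I0 by (intro that[of r0 q0]) auto
  qed
  have pqr: "p \<in> {1..3}" "q \<in> {1..3}" "r \<in> {1..3}" using I1(1) by auto
  have pqr_cases: "k = p \<or> k = q \<or> k = r" if "k \<in> {1..3}" for k using that unfolding I1(1) by simp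
  have real: "a k \<in> \<real>" if "k \<in> {1..3}" for k using pqr_cases[OF that] I1(5,6) I0(5) by auto
  have real_Ej: "\<exists>x. complex_of_real x \<in> Ej j" if j: "j \<in> {1..3}" for j
  proof -
    have "Ej j \<in> components E" using bij_betwE[OF Ej] j by blast
    then show ?thesis
      using connected_cnj_invariant_meets_real[of "Ej j"] cnjEj[OF j] in_components_connected in_components_nonempty by metis
  qed
  \<comment> \<open>If the extreme real point of \<open>E\<close> in direction
    \<open>\<sigma>\<close> lies in \<open>Ej j\<close>, then the extreme center in that direction
    has label \<open>j\<close>.\<close>
  have label: "i = j"
    if \<sigma>: "\<sigma> = 1 \<or> \<sigma> = (-1::real)" and j: "j \<in> {1..3}" and i: "i \<in> {1..3}" "\<And>k. k \<in> {1..3} \<Longrightarrow> \<sigma> * Re (a k) \<le> \<sigma> * Re (a i)"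
      and ext: "\<And>x0. complex_of_real x0 \<in> E \<Longrightarrow> (\<And>y. complex_of_real y \<in> E \<Longrightarrow> \<sigma> * y \<le> \<sigma> * x0) \<Longrightarrow> complex_of_real x0 \<in> Ej j"
    for \<sigma> i j
  proof -
    have cE: "compact E" unfolding E by (rule M.compact_E)
    obtain x where "complex_of_real x \<in> E" using real_Ej[OF j] UE j by blast
    then obtain x0 where x0: "complex_of_real x0 \<in> E" "\<And>y. complex_of_real y \<in> E \<Longrightarrow> \<sigma> * y \<le> \<sigma> * x0"
      using compact_real_trace_extreme[OF cE _ \<sigma>] by metis
    have x0j: "complex_of_real x0 \<in> Ej j" by (rule ext[OF x0])
    obtain \<gamma> where \<gamma>: "path_image \<gamma> \<subseteq> - E" "jordan_surrounds \<gamma> (Ej j) E" "jordan_surrounds (\<Phi> \<circ> \<gamma>) (Lj j) L"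
      using ex\<gamma>[OF j] by blast
    have ray: "of_real (x0 + \<sigma> * t) \<notin> E" if "t > 0" for t
    proof
      assume "of_real (x0 + \<sigma> * t) \<in> E"
      then have "\<sigma> * (x0 + \<sigma> * t) \<le> \<sigma> * x0" by (rule x0(2))
      then show False using \<sigma> that by auto
    qed
    obtain y where y: "y \<in> inside (path_image (\<Phi> \<circ> \<gamma>))" "connected_component L (a i) y"
    proof (rule I.extreme_center_surrounded[OF _ _ real \<sigma> i])
      show "simple_path \<gamma>" "pathfinish \<gamma> = pathstart \<gamma>" "of_real x0 \<in> inside (path_image \<gamma>)"
        using \<gamma>(2) x0j unfolding jordan_surrounds_def by blast+
    qed (use \<gamma>(1) E_cnj' cnj' x0 ray in \<open>auto simp: E L_def\<close>)
    have "y \<in> L" using connected_component_in[OF y(2)] by blast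
    \<comment> \<open>The image curve has the rest of \<open>L\<close> outside, so a point of
      \<open>L\<close> inside it belongs to \<open>Lj j\<close>.\<close>
    moreover have "y \<notin> L - Lj j" using \<gamma>(3) y(1) inside_Int_outside unfolding jordan_surrounds_def by blast
    ultimately have "connected_component L (a j) y" using Lj_comp[OF j] by auto
    then have "a i \<in> Lj j" using y(2) Lj_comp[OF j] connected_component_sym connected_component_trans by (metis mem_Collect_eq)
    then show ?thesis by (rule in_Lj[OF j i(1)])
  qed
  have E123: "j = 1 \<or> j = 2 \<or> j = 3" if "j \<in> {1..3}" for j :: nat using that by auto
  \<comment> \<open>The order is given for neighbouring components only; the first and the third are
    compared through a real point of the second.\<close>
  have ord: "x < y" if "complex_of_real x \<in> Ej 1" "complex_of_real y \<in> Ej 2 \<or> complex_of_real y \<in> Ej 3" for x y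
  proof -
    obtain t where "complex_of_real t \<in> Ej 2" using real_Ej[of 2] by auto
    then show ?thesis
      using that order[of 1 x y, unfolded one_add_one] order[of 1 x t, unfolded one_add_one] order[of 2 t y] by auto
  qed
  have ord': "x < y" if "complex_of_real x \<in> Ej 1 \<or> complex_of_real x \<in> Ej 2" "complex_of_real y \<in> Ej 3" for x y
    using that ord[of x y] order[of 2 x y] by auto
  \<comment> \<open>The leftmost center \<open>- \<beta>\<close> belongs to the leftmost component;
    \<open>r = 3\<close> is the mirror image, and \<open>p = 2\<close> is what remains.\<close>
  have "q = 1"
  proof (rule label[of "-1"])
    show "- 1 * Re (a k) \<le> - 1 * Re (a q)" if "k \<in> {1..3}" for k
      using pqr_cases[OF that] I1(5,6) I0(5) \<open>\<beta> > 0\<close> by auto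
    fix x0 assume x0: "complex_of_real x0 \<in> E" "\<And>y. complex_of_real y \<in> E \<Longrightarrow> - 1 * y \<le> - 1 * x0"
    obtain x where x: "complex_of_real x \<in> Ej 1" using real_Ej[of 1] by auto
    then have "complex_of_real x \<in> E" using UE by auto
    then have "x0 \<le> x" using x0(2) by simp
    moreover obtain k where "k \<in> {1..3}" "complex_of_real x0 \<in> Ej k" using x0(1) UE by blast
    ultimately show "complex_of_real x0 \<in> Ej 1" using ord[OF x, of x0] E123[of k] by auto
  qed (use pqr in auto)
  have "r = 3"
  proof (rule label[of 1])
    show "1 * Re (a k) \<le> 1 * Re (a r)" if "k \<in> {1..3}" for k
      using pqr_cases[OF that] I1(5,6) I0(5) \<open>\<beta> > 0\<close> by auto
    fix x0 assume x0: "complex_of_real x0 \<in> E" "\<And>y. complex_of_real y \<in> E \<Longrightarrow> 1 * y \<le> 1 * x0"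
    obtain x where x: "complex_of_real x \<in> Ej 3" using real_Ej[of 3] by auto
    then have "complex_of_real x \<in> E" using UE by auto
    then have "x \<le> x0" using x0(2) by simp
    moreover obtain k where "k \<in> {1..3}" "complex_of_real x0 \<in> Ej k" using x0(1) UE by blast
    ultimately show "complex_of_real x0 \<in> Ej 3" using ord'[OF _ x, of x0] E123[of k] by auto
  qed (use pqr in auto)
  have "p = 2" using E123[OF pqr(1)] I1(2,3) \<open>q = 1\<close> \<open>r = 3\<close> by auto
  have formula: "a 3 = complex_of_real (sqrt (real n) *
         root n (norm (poly P (complex_of_real z) + S (complex_of_real z)) /
           (2 * norm p\<^sub>n * real (nj 2) powr (real (nj 2) / 2) * (2 * real (nj 3)) ^ nj 3)))" if z: "z \<in> {z\<^sub>1, z\<^sub>2}" for z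
  proof -
    have w: "complex_of_real z \<notin> preimage_interval P" "(\<Phi> (of_real z))\<^sup>2 = of_real (m p * \<beta>\<^sup>2)"
      using crit_z[OF z] sq E by simp_all
    note Jz = I.norm_J_critical[OF I1(1-4) I0(5) I1(6,5,7) \<open>\<beta> > 0\<close> w]
    have "lead_coeff P \<noteq> 0" using deg by auto
    then have "norm p\<^sub>n > 0" using assms(3) by simp
    have "nj 2 > 0" "nj 3 > 0" using I.nj_pos by auto
    have "nj 2 + 2 * nj 3 = n" using Jz(2) assms(1) \<open>p = 2\<close> \<open>r = 3\<close> by simp
    \<comment> \<open>Used with \<open>K = norm p\<^sub>n\<close>; its numerator is then the value
      of \<open>norm (J z)\<close> from \<open>norm_J_critical\<close>, the same at both critical
      points.\<close>
    from center_formula[OF this \<open>nj 2 > 0\<close> \<open>nj 3 > 0\<close> \<open>\<beta> > 0\<close> \<open>norm p\<^sub>n > 0\<close>]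
    have "\<beta> = sqrt (real n) * root n (norm (M.J (of_real z)) /
           (2 * norm p\<^sub>n * real (nj 2) powr (real (nj 2) / 2) * (2 * real (nj 3)) ^ nj 3))"
      using Jz(1) assms(1,3) \<open>p = 2\<close> \<open>r = 3\<close> by simp
    then show ?thesis using I1(6) \<open>r = 3\<close> by (simp only: M.J_def)
  qed
  show ?thesis
    using z21 I1(5-7) I0(5) \<open>p = 2\<close> \<open>q = 1\<close> \<open>r = 3\<close> \<open>\<beta> > 0\<close> formula by auto
qed

end
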